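(* Let $\ell$ be a Lagrangian subspace of $(\mathfrak g(-1),\omega)$ and let $\mathfrak m$, $Q$, $H$, $\mathcal C$, $\operatorname{Wh}$ be as defined in the context. The functor $V\mapsto Q\otimes_HV$ is an equivalence from the category of finitely generated left $H$-modules to the category $\mathcal C$. The inverse equivalence is given by the functor $E\mapsto\operatorname{Wh}(E)$; in particular, the functor $\operatorname{Wh}$ on $\mathcal C$ is exact.
   Context: $\mathfrak g$ is a complex semisimple Lie algebra, $e\in\mathfrak g$ a nonzero nilpotent element, and $(e,h,f)$ a fixed $\mathfrak{sl}_2$-triple: $[h,e]=2e$, $[h,f]=-2f$, $[e,f]=h$. Let $\Phi:\mathfrak g\to\mathfrak g^*$ be the isomorphism given by the scalar multiple of the Killing form normalized so that $\langle\Phi(e),f\rangle=1$, and $\chi=\Phi(e)$. Let $\mathfrak g(i)=\{x\in\mathfrak g:[h,x]=ix\}$. The form $\omega(x,y)=\chi([x,y])$ on $\mathfrak g(-1)$ is skew-symmetric and nondegenerate. For a Lagrangian subspace $\ell\subset\mathfrak g(-1)$ put $\mathfrak m=\ell\oplus\bigoplus_{i\le-2}\mathfrak g(i)$, a nilpotent Lie subalgebra of $\mathfrak g$ on which $\chi$ restricts to a character. Let $I\subset U\mathfrak g$ be the left ideal generated by $x-\chi(x)$, $x\in\mathfrak m$, and $Q=U\mathfrak g/I=U\mathfrak g\otimes_{U\mathfrak m}\mathbb C_\chi$. Let $H=Q^{\operatorname{ad}\mathfrak m}=\{x+I\in Q: nx-xn\in I\ \forall n\in\mathfrak m\}$, an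 algebra with the well-defined product $(x+I)(y+I)=xy+I$. $Q$ is a $(U\mathfrak g,H)$-bimodule, the right action of $H$ being $(u+I)(y+I)=uy+I$. $\mathcal C$ is the abelian category of finitely generated $U\mathfrak g$-modules on which $m-\chi(m)$ acts locally nilpotently for each $m\in\mathfrak m$. For $E\in\mathcal C$, $\operatorname{Wh}(E)=\{x\in E: mx=\chi(m)x\ \forall m\in\mathfrak m\}$, which is a left $H$-module via $(u+I)\cdot x=ux$. *)

theory Defs
  imports
    Complex_Main
    "HOL-Library.Poly_Mapping"
    "HOL-Library.FuncSet"
    "HOL-Algebra.Module"
    "HOL-Algebra.QuotRing"
    "HOL-Algebra.Free_Abelian_Groups"
begin

class complex_lie_algebra = ab_group_add +
  fixes cscale :: "complex \<Rightarrow> 'a \<Rightarrow> 'a"  (infixr \<open>*\<^sub>C\<close> 75)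
    and bracket :: "'a \<Rightarrow> 'a \<Rightarrow> 'a"
  assumes cscale_add_right: "c *\<^sub>C (x + y) = c *\<^sub>C x + c *\<^sub>C y"
    and cscale_add_left: "(c + d) *\<^sub>C x = c *\<^sub>C x + d *\<^sub>C x"
    and cscale_cscale: "c *\<^sub>C (d *\<^sub>C x) = (c * d) *\<^sub>C x"
    and cscale_one: "1 *\<^sub>C x = x"
    and bracket_add_left: "bracket (x + y) z = bracket x z + bracket y z"
    and bracket_add_right: "bracket z (x + y) = bracket z x + bracket z y"
    and bracket_cscale_left: "bracket (c *\<^sub>C x) y = c *\<^sub>C bracket x y"
    and bracket_cscale_right: "bracket x (c *\<^sub>C y) = c *\<^sub>C bracket x y"
    and bracket_self: "bracket x x = 0"
    and bracket_jacobi: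
      "bracket x (bracket y z) + bracket y (bracket z x) + bracket z (bracket x y) = 0"

global_interpretation cvs: vector_space "cscale :: complex \<Rightarrow> 'g \<Rightarrow> 'g::complex_lie_algebra"
  by standard (simp_all add: cscale_add_right cscale_add_left cscale_cscale cscale_one)

definition lie_ideal :: "'g::complex_lie_algebra set \<Rightarrow> bool" where
  "lie_ideal J \<longleftrightarrow> cvs.subspace J \<and> (\<forall>x. \<forall>y\<in>J. bracket x y \<in> J)"

fun derived_series :: "'g::complex_lie_algebra set \<Rightarrow> nat \<Rightarrow> 'g set" where
  "derived_series J 0 = J"
| "derived_series J (Suc n) =
     cvs.span {bracket x y | x y. x \<in> derived_series J n \<and> y \<in> derived_series J n}"

definition lie_solvable :: "'g::complex_lie_algebra set \<Rightarrow> bool" where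
  "lie_solvable J \<longleftrightarrow> (\<exists>n. derived_series J n = {0})"

definition semisimple_lie_algebra :: "'g::complex_lie_algebra itself \<Rightarrow> bool" where
  "semisimple_lie_algebra _ \<longleftrightarrow>
     (\<exists>B::'g set. finite B \<and> cvs.span B = UNIV) \<and>
     (\<forall>J::'g set. lie_ideal J \<and> lie_solvable J \<longrightarrow> J = {0})"

text \<open>The trace, computed in an arbitrarily chosen basis; meaningful in finite dimension,
  where it does not depend on the basis.\<close>

definition lie_trace :: "('g::complex_lie_algebra \<Rightarrow> 'g) \<Rightarrow> complex" where
  "lie_trace T = (\<Sum>b\<in>cvs.extend_basis {}. cvs.representation (cvs.extend_basis {}) (T b) b)"

definition killing_form :: "'g::complex_lie_algebra \<Rightarrow> 'g \<Rightarrow> complex" where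
  "killing_form x y = lie_trace (\<lambda>z. bracket x (bracket y z))"

definition ad_nilpotent :: "'g::complex_lie_algebra \<Rightarrow> bool" where
  "ad_nilpotent x \<longleftrightarrow> (\<exists>n. \<forall>y. (bracket x ^^ n) y = 0)"

definition sl2_triple :: "'g::complex_lie_algebra \<Rightarrow> 'g \<Rightarrow> 'g \<Rightarrow> bool" where
  "sl2_triple e h f \<longleftrightarrow>
     bracket h e = 2 *\<^sub>C e \<and> bracket h f = (- 2) *\<^sub>C f \<and> bracket e f = h"

definition grading :: "'g::complex_lie_algebra \<Rightarrow> int \<Rightarrow> 'g set" where
  "grading h i = {x. bracket h x = of_int i *\<^sub>C x}"

text \<open>The multiple of the Killing form normalised by
  \<open>normalized_form e f e f = 1\<close>.  For an \<open>sl\<^sub>2\<close>-triple in a semisimple Lie algebra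
  with \<open>e \<noteq> 0\<close> the denominator equals \<open>killing_form h h / 2\<close>, which is nonzero.\<close>

definition normalized_form ::
    "'g::complex_lie_algebra \<Rightarrow> 'g \<Rightarrow> 'g \<Rightarrow> 'g \<Rightarrow> complex" where
  "normalized_form e f x y = killing_form x y / killing_form e f"

definition nilpotent_char :: "'g::complex_lie_algebra \<Rightarrow> 'g \<Rightarrow> 'g \<Rightarrow> complex" where
  "nilpotent_char e f = normalized_form e f e"

definition lagrangian ::
    "('g::complex_lie_algebra \<Rightarrow> complex) \<Rightarrow> 'g \<Rightarrow> 'g set \<Rightarrow> bool" where
  "lagrangian \<chi> h l \<longleftrightarrow>
     cvs.subspace l \<and> l \<subseteq> grading h (- 1) \<and>
     l = {x \<in> grading h (- 1). \<forall>y\<in>l. \<chi> (bracket x y) = 0}"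

definition whittaker_subalgebra ::
    "'g::complex_lie_algebra \<Rightarrow> 'g set \<Rightarrow> 'g set" where
  "whittaker_subalgebra h l = cvs.span (l \<union> (\<Union>i\<in>{..- 2}. grading h i))"

text \<open>Words over \<open>'g\<close> form the free monoid, so \<open>'g word \<Rightarrow>\<^sub>0 complex\<close> is the free
  unital associative complex algebra on the underlying set of \<open>'g\<close>.\<close>

datatype 'g word = Word (letters: "'g list")

instantiation word :: (type) monoid_add
begin

definition "0 = Word []"
definition "v + w = Word (letters v @ letters w)"

instance
  by standard (simp_all add: zero_word_def plus_word_def)

end

type_synonym 'g free_algebra = "'g word \<Rightarrow>\<^sub>0 complex"

definition fa_gen :: "'g \<Rightarrow> 'g free_algebra" where
  "fa_gen x = Poly_Mapping.single (Word [x]) 1"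

definition fa_const :: "complex \<Rightarrow> 'g free_algebra" where
  "fa_const c = Poly_Mapping.single 0 c"

text \<open>The linearity relations turn the free algebra on the set \<open>'g\<close> into the tensor
  algebra of the vector space \<open>'g\<close>.\<close>

inductive_set uea_relations :: "'g::complex_lie_algebra free_algebra set" where
  "fa_gen (x + y) - fa_gen x - fa_gen y \<in> uea_relations"
| "fa_gen (c *\<^sub>C x) - fa_const c * fa_gen x \<in> uea_relations"
| "fa_gen x * fa_gen y - fa_gen y * fa_gen x - fa_gen (bracket x y) \<in> uea_relations"

inductive_set uea_ideal :: "'g::complex_lie_algebra free_algebra set" where
  uea_ideal_zero: "0 \<in> uea_ideal"
| uea_ideal_rel: "r \<in> uea_relations \<Longrightarrow> a * r * b \<in> uea_ideal"
| uea_ideal_add: "r \<in> uea_ideal \<Longrightarrow> s \<in> uea_ideal \<Longrightarrow> r + s \<in> uea_ideal"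

lemma uea_ideal_mult: "r \<in> uea_ideal \<Longrightarrow> a * r * b \<in> uea_ideal"
proof (induction rule: uea_ideal.induct)
  case (uea_ideal_rel r a' b')
  then show ?case
    using uea_ideal.uea_ideal_rel[of r "a * a'" "b' * b"] by (simp add: mult.assoc)
qed (auto simp: distrib_left distrib_right intro: uea_ideal.intros)

lemma uea_ideal_uminus: "r \<in> uea_ideal \<Longrightarrow> - r \<in> uea_ideal"
  using uea_ideal_mult[of r "- 1" 1] by simp

lemma uea_ideal_diff: "r \<in> uea_ideal \<Longrightarrow> s \<in> uea_ideal \<Longrightarrow> r - s \<in> uea_ideal"
  using uea_ideal_add[OF _ uea_ideal_uminus, of r s] by simp

lemma Word_eq_0: "(Word xs = 0) = (xs = [])"
  by (simp add: zero_word_def)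

lemma lookup_mult_empty_word:
  "Poly_Mapping.lookup (a * b) (0::'g word) = Poly_Mapping.lookup a 0 * Poly_Mapping.lookup b 0"
proof -
  have split: "(0 = v + w) = (v = 0 \<and> w = 0)" for v w :: "'g word"
    by (cases v; cases w) (auto simp: zero_word_def plus_word_def)
  have "(\<Sum>w. Poly_Mapping.lookup b w when (0::'g word) = v + w)
      = (Poly_Mapping.lookup b 0 when v = 0)" for v
  proof -
    have "(Poly_Mapping.lookup b w when (0::'g word) = v + w)
        = ((Poly_Mapping.lookup b w when v = 0) when w = 0)" for w
      by (auto simp: split when_def)
    then show ?thesis by simp
  qed
  then have "Poly_Mapping.lookup (a * b) 0
      = (\<Sum>v. Poly_Mapping.lookup a v * (Poly_Mapping.lookup b 0 when v = 0))"
    by (simp add: lookup_mult)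
  also have "\<dots> = (\<Sum>v. (Poly_Mapping.lookup a v * Poly_Mapping.lookup b 0) when v = 0)"
    by (simp add: mult_when)
  finally show ?thesis by simp
qed

lemma uea_ideal_augmentation: "r \<in> uea_ideal \<Longrightarrow> Poly_Mapping.lookup r 0 = 0"
proof (induction rule: uea_ideal.induct)
  case (uea_ideal_rel r a b)
  then have "Poly_Mapping.lookup r 0 = 0"
    by (auto elim!: uea_relations.cases
        simp: lookup_minus lookup_mult_empty_word fa_gen_def lookup_single Word_eq_0)
  then show ?case by (simp add: lookup_mult_empty_word)
qed (simp_all add: lookup_add)

quotient_type (overloaded) 'g uea = "'g::complex_lie_algebra free_algebra"
  / "\<lambda>a b. a - b \<in> uea_ideal"
proof (rule equivpI)
  show "reflp (\<lambda>a b. a - b \<in> (uea_ideal :: 'g free_algebra set))"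
    by (simp add: reflp_def uea_ideal_zero)
  show "symp (\<lambda>a b. a - b \<in> (uea_ideal :: 'g free_algebra set))"
    by (metis (mono_tags, lifting) minus_diff_eq sympI uea_ideal_uminus)
  show "transp (\<lambda>a b. a - b \<in> (uea_ideal :: 'g free_algebra set))"
  proof (rule transpI)
    fix a b c :: "'g free_algebra"
    assume "a - b \<in> uea_ideal" "b - c \<in> uea_ideal"
    from uea_ideal_add[OF this] show "a - c \<in> uea_ideal" by simp
  qed
qed

instantiation uea :: (complex_lie_algebra) ring_1
begin

lift_definition zero_uea :: "'a uea" is 0 .
lift_definition one_uea :: "'a uea" is 1 .
lift_definition plus_uea :: "'a uea \<Rightarrow> 'a uea \<Rightarrow> 'a uea" is "(+)"
  using uea_ideal_add by (fastforce simp: algebra_simps)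
lift_definition uminus_uea :: "'a uea \<Rightarrow> 'a uea" is uminus
  using uea_ideal_uminus by fastforce
lift_definition minus_uea :: "'a uea \<Rightarrow> 'a uea \<Rightarrow> 'a uea" is "(-)"
  using uea_ideal_diff by (fastforce simp: algebra_simps)
lift_definition times_uea :: "'a uea \<Rightarrow> 'a uea \<Rightarrow> 'a uea" is "(*)"
proof -
  fix a a' b b' :: "'a free_algebra"
  assume "a - a' \<in> uea_ideal" "b - b' \<in> uea_ideal"
  then have "1 * (a - a') * b + a' * (b - b') * 1 \<in> uea_ideal"
    by (intro uea_ideal_add uea_ideal_mult)
  then show "a * b - a' * b' \<in> uea_ideal" by (simp add: algebra_simps)
qed

instance
proof
  show "(0::'a uea) \<noteq> 1"
  proof (transfer, rule notI)
    assume "0 - 1 \<in> (uea_ideal :: 'a free_algebra set)"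
    from uea_ideal_augmentation[OF this] show False
      by (simp add: lookup_minus lookup_one)
  qed
qed (transfer; simp add: uea_ideal_zero algebra_simps)+

end

lift_definition uea_gen :: "'g::complex_lie_algebra \<Rightarrow> 'g uea" is fa_gen .

lift_definition uea_const :: "complex \<Rightarrow> 'g::complex_lie_algebra uea" is fa_const .

definition uea_ring :: "'g::complex_lie_algebra uea ring" where
  "uea_ring = \<lparr>carrier = UNIV, mult = (*), one = 1, ring.zero = 0, ring.add = (+)\<rparr>"

text \<open>The library's \<^locale>\<open>module\<close> requires a commutative ring; its record of operations
  is reused.  The fields \<^const>\<open>mult\<close> and \<^const>\<open>one\<close> that this record inherits
  from rings play no role.\<close>

locale left_module = R?: ring R + M?: abelian_group M
  for R :: "'r ring" and M :: "('r, 'u) module" (structure) +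
  assumes smult_closed:
      "\<lbrakk>a \<in> carrier R; x \<in> carrier M\<rbrakk> \<Longrightarrow> a \<odot>\<^bsub>M\<^esub> x \<in> carrier M"
    and smult_l_distr:
      "\<lbrakk>a \<in> carrier R; b \<in> carrier R; x \<in> carrier M\<rbrakk> \<Longrightarrow>
        (a \<oplus>\<^bsub>R\<^esub> b) \<odot>\<^bsub>M\<^esub> x = a \<odot>\<^bsub>M\<^esub> x \<oplus>\<^bsub>M\<^esub> b \<odot>\<^bsub>M\<^esub> x"
    and smult_r_distr:
      "\<lbrakk>a \<in> carrier R; x \<in> carrier M; y \<in> carrier M\<rbrakk> \<Longrightarrow>
        a \<odot>\<^bsub>M\<^esub> (x \<oplus>\<^bsub>M\<^esub> y) = a \<odot>\<^bsub>M\<^esub> x \<oplus>\<^bsub>M\<^esub> a \<odot>\<^bsub>M\<^esub> y"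
    and smult_assoc1:
      "\<lbrakk>a \<in> carrier R; b \<in> carrier R; x \<in> carrier M\<rbrakk> \<Longrightarrow>
        (a \<otimes>\<^bsub>R\<^esub> b) \<odot>\<^bsub>M\<^esub> x = a \<odot>\<^bsub>M\<^esub> (b \<odot>\<^bsub>M\<^esub> x)"
    and smult_one: "x \<in> carrier M \<Longrightarrow> \<one>\<^bsub>R\<^esub> \<odot>\<^bsub>M\<^esub> x = x"

definition finitely_generated :: "'r ring \<Rightarrow> ('r, 'u) module \<Rightarrow> bool" where
  "finitely_generated R M \<longleftrightarrow>
     (\<exists>S. finite S \<and> S \<subseteq> carrier M \<and>
        (\<forall>x\<in>carrier M. \<exists>c\<in>S \<rightarrow> carrier R. x = (\<Oplus>\<^bsub>M\<^esub>s\<in>S. c s \<odot>\<^bsub>M\<^esub> s)))"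

definition module_homs :: "'r ring \<Rightarrow> ('r, 'u) module \<Rightarrow> ('r, 'v) module \<Rightarrow> ('u \<Rightarrow> 'v) set"
  where
  "module_homs R M N = {\<phi> \<in> carrier M \<rightarrow>\<^sub>E carrier N.
     (\<forall>x\<in>carrier M. \<forall>y\<in>carrier M. \<phi> (x \<oplus>\<^bsub>M\<^esub> y) = \<phi> x \<oplus>\<^bsub>N\<^esub> \<phi> y) \<and>
     (\<forall>a\<in>carrier R. \<forall>x\<in>carrier M. \<phi> (a \<odot>\<^bsub>M\<^esub> x) = a \<odot>\<^bsub>N\<^esub> \<phi> x)}"

text \<open>Hom-sets are indexed by source and target and need not be disjoint; this is why
  composition and the action of functors on morphisms take objects as arguments.
  \<open>Comp C X Y Z g f\<close> is \<open>g\<close> after \<open>f\<close> for \<open>f : X \<rightarrow> Y\<close> and \<open>g : Y \<rightarrow> Z\<close>.\<close>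

record ('o, 'a) cat =
  Obj :: "'o set"
  Hom :: "'o \<Rightarrow> 'o \<Rightarrow> 'a set"
  Ident :: "'o \<Rightarrow> 'a"
  Comp :: "'o \<Rightarrow> 'o \<Rightarrow> 'o \<Rightarrow> 'a \<Rightarrow> 'a \<Rightarrow> 'a"

definition is_category :: "('o, 'a) cat \<Rightarrow> bool" where
  "is_category C \<longleftrightarrow>
     (\<forall>X\<in>Obj C. Ident C X \<in> Hom C X X) \<and>
     (\<forall>X\<in>Obj C. \<forall>Y\<in>Obj C. \<forall>Z\<in>Obj C. \<forall>f\<in>Hom C X Y. \<forall>g\<in>Hom C Y Z.
        Comp C X Y Z g f \<in> Hom C X Z) \<and>
     (\<forall>X\<in>Obj C. \<forall>Y\<in>Obj C. \<forall>f\<in>Hom C X Y.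
        Comp C X X Y f (Ident C X) = f \<and> Comp C X Y Y (Ident C Y) f = f) \<and>
     (\<forall>W\<in>Obj C. \<forall>X\<in>Obj C. \<forall>Y\<in>Obj C. \<forall>Z\<in>Obj C.
        \<forall>f\<in>Hom C W X. \<forall>g\<in>Hom C X Y. \<forall>k\<in>Hom C Y Z.
        Comp C W X Z (Comp C X Y Z k g) f = Comp C W Y Z k (Comp C W X Y g f))"

record ('o, 'a, 'p, 'b) cat_functor =
  omap :: "'o \<Rightarrow> 'p"
  amap :: "'o \<Rightarrow> 'o \<Rightarrow> 'a \<Rightarrow> 'b"

definition is_functor ::
    "('o, 'a) cat \<Rightarrow> ('p, 'b) cat \<Rightarrow> ('o, 'a, 'p, 'b) cat_functor \<Rightarrow> bool" where
  "is_functor C D F \<longleftrightarrow>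
     is_category C \<and> is_category D \<and>
     (\<forall>X\<in>Obj C. omap F X \<in> Obj D) \<and>
     (\<forall>X\<in>Obj C. \<forall>Y\<in>Obj C. \<forall>f\<in>Hom C X Y. amap F X Y f \<in> Hom D (omap F X) (omap F Y)) \<and>
     (\<forall>X\<in>Obj C. amap F X X (Ident C X) = Ident D (omap F X)) \<and>
     (\<forall>X\<in>Obj C. \<forall>Y\<in>Obj C. \<forall>Z\<in>Obj C. \<forall>f\<in>Hom C X Y. \<forall>g\<in>Hom C Y Z.
        amap F X Z (Comp C X Y Z g f) =
          Comp D (omap F X) (omap F Y) (omap F Z) (amap F Y Z g) (amap F X Y f))"

definition identity_functor :: "('o, 'a, 'o, 'a) cat_functor" where
  "identity_functor = \<lparr>omap = (\<lambda>X. X), amap = (\<lambda>X Y f. f)\<rparr>"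

definition functor_comp ::
    "('p, 'b, 'q, 'c) cat_functor \<Rightarrow> ('o, 'a, 'p, 'b) cat_functor \<Rightarrow> ('o, 'a, 'q, 'c) cat_functor"
  where
  "functor_comp G F =
     \<lparr>omap = (\<lambda>X. omap G (omap F X)),
      amap = (\<lambda>X Y f. amap G (omap F X) (omap F Y) (amap F X Y f))\<rparr>"

definition is_isomorphism :: "('o, 'a) cat \<Rightarrow> 'o \<Rightarrow> 'o \<Rightarrow> 'a \<Rightarrow> bool" where
  "is_isomorphism C X Y f \<longleftrightarrow>
     f \<in> Hom C X Y \<and>
     (\<exists>g\<in>Hom C Y X. Comp C X Y X g f = Ident C X \<and> Comp C Y X Y f g = Ident C Y)"

definition naturally_isomorphic ::
    "('o, 'a) cat \<Rightarrow> ('p, 'b) cat \<Rightarrow>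
     ('o, 'a, 'p, 'b) cat_functor \<Rightarrow> ('o, 'a, 'p, 'b) cat_functor \<Rightarrow> bool" where
  "naturally_isomorphic C D F G \<longleftrightarrow>
     is_functor C D F \<and> is_functor C D G \<and>
     (\<exists>\<eta>. (\<forall>X\<in>Obj C. is_isomorphism D (omap F X) (omap G X) (\<eta> X)) \<and>
          (\<forall>X\<in>Obj C. \<forall>Y\<in>Obj C. \<forall>f\<in>Hom C X Y.
             Comp D (omap F X) (omap G X) (omap G Y) (amap G X Y f) (\<eta> X) =
             Comp D (omap F X) (omap F Y) (omap G Y) (\<eta> Y) (amap F X Y f)))"

definition inverse_equivalences ::
    "('o, 'a) cat \<Rightarrow> ('p, 'b) cat \<Rightarrow>
     ('o, 'a, 'p, 'b) cat_functor \<Rightarrow> ('p, 'b, 'o, 'a) cat_functor \<Rightarrow> bool" where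
  "inverse_equivalences C D F G \<longleftrightarrow>
     is_functor C D F \<and> is_functor D C G \<and>
     naturally_isomorphic C C (functor_comp G F) identity_functor \<and>
     naturally_isomorphic D D (functor_comp F G) identity_functor"

definition equivalence_of_categories ::
    "('o, 'a) cat \<Rightarrow> ('p, 'b) cat \<Rightarrow> ('o, 'a, 'p, 'b) cat_functor \<Rightarrow> bool" where
  "equivalence_of_categories C D F \<longleftrightarrow> (\<exists>G. inverse_equivalences C D F G)"

definition module_cat ::
    "'r ring \<Rightarrow> (('r, 'u) module \<Rightarrow> bool) \<Rightarrow> (('r, 'u) module, 'u \<Rightarrow> 'u) cat" where
  "module_cat R P =
     \<lparr>Obj = {M. left_module R M \<and> P M},
      Hom = module_homs R,
      Ident = (\<lambda>M. \<lambda>x\<in>carrier M. x),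
      Comp = (\<lambda>L M N g f. compose (carrier L) g f)\<rparr>"

text \<open>Exactness of \<open>0 \<rightarrow> L \<rightarrow> M \<rightarrow> N \<rightarrow> 0\<close>, for module homomorphisms
  \<open>\<phi> : L \<rightarrow> M\<close> and \<open>\<psi> : M \<rightarrow> N\<close>.\<close>

definition short_exact ::
    "('r, 'u) module \<Rightarrow> ('r, 'u) module \<Rightarrow> ('r, 'u) module \<Rightarrow>
     ('u \<Rightarrow> 'u) \<Rightarrow> ('u \<Rightarrow> 'u) \<Rightarrow> bool" where
  "short_exact L M N \<phi> \<psi> \<longleftrightarrow>
     inj_on \<phi> (carrier L) \<and>
     \<phi> ` carrier L = {x \<in> carrier M. \<psi> x = \<zero>\<^bsub>N\<^esub>} \<and>
     \<psi> ` carrier M = carrier N"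

definition exact_functor ::
    "(('r, 'u) module, 'u \<Rightarrow> 'u) cat \<Rightarrow> (('s, 'v) module, 'v \<Rightarrow> 'v) cat \<Rightarrow>
     (('r, 'u) module, 'u \<Rightarrow> 'u, ('s, 'v) module, 'v \<Rightarrow> 'v) cat_functor \<Rightarrow> bool" where
  "exact_functor C D F \<longleftrightarrow>
     is_functor C D F \<and>
     (\<forall>L\<in>Obj C. \<forall>M\<in>Obj C. \<forall>N\<in>Obj C. \<forall>\<phi>\<in>Hom C L M. \<forall>\<psi>\<in>Hom C M N.
        short_exact L M N \<phi> \<psi> \<longrightarrow>
        short_exact (omap F L) (omap F M) (omap F N) (amap F L M \<phi>) (amap F M N \<psi>))"

record ('s, 'q, 'r) bimodule = "('s, 'q) module" +
  rsmult :: "'q \<Rightarrow> 'r \<Rightarrow> 'q"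

text \<open>\<open>Q \<otimes>\<^sub>R V\<close> is the quotient of the free abelian group on \<open>Q \<times> V\<close> by the subgroup
  that makes \<open>(q, v) \<mapsto> q \<otimes> v\<close> biadditive and \<open>R\<close>-balanced.\<close>

abbreviation tensor_gens ::
    "('s, 'q, 'r) bimodule \<Rightarrow> ('r, 'v) module \<Rightarrow> ('q \<times> 'v \<Rightarrow>\<^sub>0 int) monoid" where
  "tensor_gens Q V \<equiv> free_Abelian_group (carrier Q \<times> carrier V)"

inductive_set tensor_relations ::
    "'r ring \<Rightarrow> ('s, 'q, 'r) bimodule \<Rightarrow> ('r, 'v) module \<Rightarrow> ('q \<times> 'v \<Rightarrow>\<^sub>0 int) set"
  for R Q V where
  "\<lbrakk>p \<in> carrier Q; q \<in> carrier Q; v \<in> carrier V\<rbrakk> \<Longrightarrow>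
     frag_of (p \<oplus>\<^bsub>Q\<^esub> q, v) - frag_of (p, v) - frag_of (q, v) \<in> tensor_relations R Q V"
| "\<lbrakk>q \<in> carrier Q; v \<in> carrier V; w \<in> carrier V\<rbrakk> \<Longrightarrow>
     frag_of (q, v \<oplus>\<^bsub>V\<^esub> w) - frag_of (q, v) - frag_of (q, w) \<in> tensor_relations R Q V"
| "\<lbrakk>q \<in> carrier Q; r \<in> carrier R; v \<in> carrier V\<rbrakk> \<Longrightarrow>
     frag_of (rsmult Q q r, v) - frag_of (q, r \<odot>\<^bsub>V\<^esub> v) \<in> tensor_relations R Q V"

definition tensor_kernel ::
    "'r ring \<Rightarrow> ('s, 'q, 'r) bimodule \<Rightarrow> ('r, 'v) module \<Rightarrow> ('q \<times> 'v \<Rightarrow>\<^sub>0 int) set" where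
  "tensor_kernel R Q V = generate (tensor_gens Q V) (tensor_relations R Q V)"

text \<open>The union in the scalar multiplication runs over all representatives of a coset;
  all of them yield the same coset.  The same device is used in \<open>tensor_map\<close>, and in the
  library's \<^const>\<open>rcoset_mult\<close>.\<close>

definition tensor_product ::
    "'r ring \<Rightarrow> ('s, 'q, 'r) bimodule \<Rightarrow> ('r, 'v) module \<Rightarrow> ('s, ('q \<times> 'v \<Rightarrow>\<^sub>0 int) set) module"
  where
  "tensor_product R Q V =
     \<lparr>carrier = carrier (tensor_gens Q V Mod tensor_kernel R Q V),
      mult = undefined,
      one = undefined,
      ring.zero = \<one>\<^bsub>tensor_gens Q V Mod tensor_kernel R Q V\<^esub>,
      ring.add = mult (tensor_gens Q V Mod tensor_kernel R Q V),
      smult = (\<lambda>s X. \<Union>c\<in>X. tensor_kernel R Q V #>\<^bsub>tensor_gens Q V\<^esub>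
                 frag_extend (\<lambda>(q, v). frag_of (s \<odot>\<^bsub>Q\<^esub> q, v)) c)\<rparr>"

definition tensor_map ::
    "'r ring \<Rightarrow> ('s, 'q, 'r) bimodule \<Rightarrow> ('r, 'w) module \<Rightarrow> ('v \<Rightarrow> 'w) \<Rightarrow>
     ('q \<times> 'v \<Rightarrow>\<^sub>0 int) set \<Rightarrow> ('q \<times> 'w \<Rightarrow>\<^sub>0 int) set" where
  "tensor_map R Q W \<phi> X = (\<Union>c\<in>X. tensor_kernel R Q W #>\<^bsub>tensor_gens Q W\<^esub>
     frag_extend (\<lambda>(q, v). frag_of (q, \<phi> v)) c)"

text \<open>The categories below consist of modules whose carrier is a subset of a fixed
  universe type \<open>'u\<close>, whereas the elements of \<^const>\<open>tensor_product\<close> live in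
  another type.  So the tensor product is transported along an injection of its carrier
  into \<open>'u\<close>.  Such an injection exists for all tensor products that are finitely
  generated over \<open>U\<close>, provided that \<open>'u\<close> has at least the cardinality of the continuum.\<close>

definition relabelling :: "('s, 'v) module \<Rightarrow> 'v \<Rightarrow> 'u" where
  "relabelling M = (SOME i. inj_on i (carrier M))"

definition relabel :: "('s, 'v) module \<Rightarrow> ('s, 'u) module" where
  "relabel M = (let i = relabelling M; i' = inv_into (carrier M) i in
     \<lparr>carrier = i ` carrier M,
      mult = undefined,
      one = undefined,
      ring.zero = i \<zero>\<^bsub>M\<^esub>,
      ring.add = (\<lambda>x y. i (i' x \<oplus>\<^bsub>M\<^esub> i' y)),
      smult = (\<lambda>s x. i (s \<odot>\<^bsub>M\<^esub> i' x))\<rparr>)"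

definition tensor_functor ::
    "'r ring \<Rightarrow> ('s, 'q, 'r) bimodule \<Rightarrow>
     (('r, 'u) module, 'u \<Rightarrow> 'u, ('s, 'u) module, 'u \<Rightarrow> 'u) cat_functor" where
  "tensor_functor R Q =
     \<lparr>omap = (\<lambda>V. relabel (tensor_product R Q V)),
      amap = (\<lambda>V W \<phi>. \<lambda>x\<in>carrier (relabel (tensor_product R Q V)).
         relabelling (tensor_product R Q W) (tensor_map R Q W \<phi>
           (inv_into (carrier (tensor_product R Q V)) (relabelling (tensor_product R Q V)) x)))\<rparr>"

text \<open>Throughout, \<open>\<chi>\<close> is a linear form on \<open>'g\<close> and \<open>\<mm>\<close> a subalgebra
  on which \<open>\<chi>\<close> is a character.\<close>

definition whit_shift ::
    "('g::complex_lie_algebra \<Rightarrow> complex) \<Rightarrow> 'g \<Rightarrow> 'g uea" where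
  "whit_shift \<chi> x = uea_gen x - uea_const (\<chi> x)"

inductive_set whit_ideal ::
    "('g::complex_lie_algebra \<Rightarrow> complex) \<Rightarrow> 'g set \<Rightarrow> 'g uea set"
  for \<chi> :: "'g::complex_lie_algebra \<Rightarrow> complex" and \<mm> :: "'g set" where
  whit_ideal_zero: "0 \<in> whit_ideal \<chi> \<mm>"
| whit_ideal_gen: "x \<in> \<mm> \<Longrightarrow> u * whit_shift \<chi> x \<in> whit_ideal \<chi> \<mm>"
| whit_ideal_add: "\<lbrakk>u \<in> whit_ideal \<chi> \<mm>; v \<in> whit_ideal \<chi> \<mm>\<rbrakk> \<Longrightarrow> u + v \<in> whit_ideal \<chi> \<mm>"

abbreviation whit_coset ::
    "('g::complex_lie_algebra \<Rightarrow> complex) \<Rightarrow> 'g set \<Rightarrow> 'g uea \<Rightarrow> 'g uea set" where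
  "whit_coset \<chi> \<mm> u \<equiv> whit_ideal \<chi> \<mm> +>\<^bsub>uea_ring\<^esub> u"

definition whit_algebra ::
    "('g::complex_lie_algebra \<Rightarrow> complex) \<Rightarrow> 'g set \<Rightarrow> 'g uea set ring" where
  "whit_algebra \<chi> \<mm> =
     \<lparr>carrier = {whit_coset \<chi> \<mm> x | x.
        \<forall>n\<in>\<mm>. uea_gen n * x - x * uea_gen n \<in> whit_ideal \<chi> \<mm>},
      mult = rcoset_mult uea_ring (whit_ideal \<chi> \<mm>),
      one = whit_coset \<chi> \<mm> 1,
      ring.zero = whit_ideal \<chi> \<mm>,
      ring.add = set_add uea_ring\<rparr>"

definition whit_bimodule ::
    "('g::complex_lie_algebra \<Rightarrow> complex) \<Rightarrow> 'g set \<Rightarrow>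
     ('g uea, 'g uea set, 'g uea set) bimodule" where
  "whit_bimodule \<chi> \<mm> =
     \<lparr>carrier = a_rcosets\<^bsub>uea_ring\<^esub> (whit_ideal \<chi> \<mm>),
      mult = undefined,
      one = undefined,
      ring.zero = whit_ideal \<chi> \<mm>,
      ring.add = set_add uea_ring,
      smult = (\<lambda>u X. \<Union>x\<in>X. whit_coset \<chi> \<mm> (u * x)),
      rsmult = rcoset_mult uea_ring (whit_ideal \<chi> \<mm>)\<rparr>"

definition locally_whittaker ::
    "('g::complex_lie_algebra \<Rightarrow> complex) \<Rightarrow> 'g set \<Rightarrow> ('g uea, 'u) module \<Rightarrow> bool" where
  "locally_whittaker \<chi> \<mm> E \<longleftrightarrow>
     (\<forall>m\<in>\<mm>. \<forall>x\<in>carrier E. \<exists>n. (whit_shift \<chi> m ^ n) \<odot>\<^bsub>E\<^esub> x = \<zero>\<^bsub>E\<^esub>)"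

definition whit_category ::
    "('g::complex_lie_algebra \<Rightarrow> complex) \<Rightarrow> 'g set \<Rightarrow> (('g uea, 'u) module, 'u \<Rightarrow> 'u) cat" where
  "whit_category \<chi> \<mm> =
     module_cat uea_ring (\<lambda>E. finitely_generated uea_ring E \<and> locally_whittaker \<chi> \<mm> E)"

definition fg_module_category :: "'r ring \<Rightarrow> (('r, 'u) module, 'u \<Rightarrow> 'u) cat" where
  "fg_module_category R = module_cat R (finitely_generated R)"

text \<open>In the scalar multiplication the representative of the coset \<open>X\<close> is immaterial,
  since \<^const>\<open>whit_ideal\<close> annihilates all Whittaker vectors.\<close>

definition Wh ::
    "('g::complex_lie_algebra \<Rightarrow> complex) \<Rightarrow> 'g set \<Rightarrow>
     ('g uea, 'u) module \<Rightarrow> ('g uea set, 'u) module" where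
  "Wh \<chi> \<mm> E =
     \<lparr>carrier = {x \<in> carrier E. \<forall>m\<in>\<mm>. uea_gen m \<odot>\<^bsub>E\<^esub> x = uea_const (\<chi> m) \<odot>\<^bsub>E\<^esub> x},
      mult = undefined,
      one = undefined,
      ring.zero = \<zero>\<^bsub>E\<^esub>,
      ring.add = add E,
      smult = (\<lambda>X x. (SOME u. u \<in> X) \<odot>\<^bsub>E\<^esub> x)\<rparr>"

definition Wh_functor ::
    "('g::complex_lie_algebra \<Rightarrow> complex) \<Rightarrow> 'g set \<Rightarrow>
     (('g uea, 'u) module, 'u \<Rightarrow> 'u, ('g uea set, 'u) module, 'u \<Rightarrow> 'u) cat_functor" where
  "Wh_functor \<chi> \<mm> =
     \<lparr>omap = Wh \<chi> \<mm>,
      amap = (\<lambda>E F \<phi>. restrict \<phi> (carrier (Wh \<chi> \<mm> E)))\<rparr>"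

end

theory Submission
  imports Defs "HOL-Computational_Algebra.Fundamental_Theorem_Algebra"
begin

text \<open>
  Let \<open>I\<close> be the left ideal generated by the elements \<open>\<rho> x = x - \<chi> x\<close> with \<open>x\<close> in \<open>\<mm>\<close>, and for
  \<open>x\<close> of degree \<open>- d\<close> call \<open>d\<close> the depth of \<open>\<rho> x\<close>.  Let \<open>J n\<close> be the left ideal generated by all
  products of elements \<open>\<rho> x\<close> whose depths add up to at least \<open>n\<close>.  The theorem rests on one fact
  about the enveloping algebra, \<open>ex_whittaker_projector\<close>: for every \<open>n\<close> there is an element \<open>\<pi>\<close> of
  \<open>1 + I\<close> such that \<open>I \<pi>\<close> is contained in \<open>J n\<close>.

  In a module \<open>E\<close> of the category \<open>\<C>\<close> every vector \<open>v\<close> is killed by some \<open>J n\<close>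
  (\<open>whittaker_killed\<close>, an application of Engel's theorem).  For this \<open>n\<close> \<open>\<pi> v\<close> is a Whittaker vector,
  and \<open>\<pi> v = v\<close> if \<open>v\<close> was one already.  Since \<open>\<pi>\<close> is an element of the enveloping algebra, this
  projection is compatible with all homomorphisms.  Consequently:

  \<^item> \<open>Wh\<close> is exact: lift a Whittaker vector along a surjection and apply \<open>\<pi>\<close> to the lift.
  \<^item> Whittaker vectors generate \<open>E\<close>, since a proper submodule containing them would by Engel's
    theorem leave a vector \<open>v\<close> outside with \<open>I v\<close> inside, although \<open>\<pi> v\<close> is inside.
  \<^item> \<open>v \<mapsto> 1 \<otimes> v\<close> is an isomorphism from \<open>V\<close> onto \<open>Wh (Q \<otimes> V)\<close>.  If \<open>t = \<Sum> q\<^sub>i \<otimes> v\<^sub>i\<close> is a Whittaker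
    vector, then \<open>t = \<pi> t = \<Sum> \<pi> q\<^sub>i \<otimes> v\<^sub>i = 1 \<otimes> \<Sum> (\<pi> q\<^sub>i) v\<^sub>i\<close>, because \<open>\<pi> q\<^sub>i\<close> lies in \<open>Wh Q = H\<close>; and
    a left inverse is \<open>q \<otimes> v \<mapsto> (\<pi> q) v\<close>, where \<open>\<pi>\<close> runs through a sequence of such elements for growing \<open>n\<close>.
  \<^item> \<open>Q \<otimes> Wh E \<rightarrow> E\<close> is an isomorphism: it is onto because Whittaker vectors generate \<open>E\<close>, and its
    kernel contains no Whittaker vectors, hence is zero by Engel's theorem.

  The elements \<open>\<pi>\<close> are found as in Kashiwara's theorem on modules over a Weyl algebra.  For \<open>x\<close> of
  degree \<open>- d\<close> there is \<open>u\<close> of degree \<open>d - 2\<close> with \<open>\<chi> [x, u] = 1\<close>.  Up to terms of higher depth \<open>x\<close>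
  acts like the partial derivative by \<open>u\<close>, so that the product of the operators \<open>1 - u (\<rho> x) / r\<close>
  for \<open>r = 1, \<dots>, n\<close> projects onto the kernel of \<open>x\<close>.  Treating the elements of \<open>\<mm>\<close> one at
  a time, deepest first and in a triangular order with respect to the pairing \<open>\<chi> [x, u]\<close>, improves
  the annihilator of a vector from \<open>J (n + 1)\<close> to \<open>J n\<close> (\<open>ex_projector_step\<close>).

  That enough elements \<open>u\<close> exist means that the pairing \<open>\<chi> [x, u]\<close>, a multiple of the Killing form of
  \<open>[e, x]\<close> and \<open>u\<close>, is nondegenerate (\<open>char_pairing_nondegenerate\<close>).  This combines the nondegeneracy
  of the Killing form (Cartan's criterion, \<open>killing_nondegenerate\<close>) with two facts on
  finite-dimensional representations of \<open>sl\<^sub>2\<close>: \<open>h\<close> is diagonalizable with integer eigenvalues, and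
  \<open>e\<close> is injective in negative degrees.
\<close>

section \<open>Linear operators and the trace\<close>

locale fd_lie = finite_dimensional_vector_space
  "cscale :: complex \<Rightarrow> 'g::complex_lie_algebra \<Rightarrow> 'g" Basis for Basis :: "'g::complex_lie_algebra set"
begin

sublocale vp: vector_space_pair "cscale :: complex \<Rightarrow> 'g \<Rightarrow> 'g" "cscale :: complex \<Rightarrow> 'g \<Rightarrow> 'g" ..

abbreviation lin :: "('g \<Rightarrow> 'g) \<Rightarrow> bool" where
  "lin \<equiv> Vector_Spaces.linear (*\<^sub>C) (*\<^sub>C)"

lemma linI:
  assumes "\<And>x y. T (x + y) = T x + T y" "\<And>c x. T (c *\<^sub>C x) = c *\<^sub>C T x"
  shows "lin T"
  using assms by (auto simp: Vector_Spaces.linear_iff vector_space_axioms)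

lemma lin_comp: "lin S \<Longrightarrow> lin T \<Longrightarrow> lin (\<lambda>x. S (T x))"
  by (rule linI) (auto simp: vp.linear_add vp.linear_scale)

lemma lin_funpow: "lin A \<Longrightarrow> lin (A ^^ n)"
  by (induction n) (auto intro!: linI simp: vp.linear_add vp.linear_scale)

lemma representation_sum_basis:
  assumes "independent C" "span C = UNIV"
  shows "(\<Sum>c\<in>C. representation C v c *\<^sub>C c) = v"
  using sum_representation_eq[of C v C] assms finiteI_independent by auto

lemma representation_lin_sum:
  assumes "independent C" "span C = UNIV"
  shows "representation C (\<Sum>i\<in>I. a i *\<^sub>C v i) b = (\<Sum>i\<in>I. a i * representation C (v i) b)"
  using assms by (simp add: representation_sum representation_scale)

text \<open>Both sides are the same double sum of products of matrix entries of \<open>S\<close> and \<open>T\<close>.  For \<open>S\<close> the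
  identity this is the independence of the trace from the basis, for \<open>B = C\<close> it is
  \<open>tr (S T) = tr (T S)\<close>.\<close>

lemma basis_trace_commute:
  assumes B: "independent B" "span B = UNIV" and C: "independent C" "span C = UNIV"
    and S: "lin S" and T: "lin T"
  shows "(\<Sum>b\<in>B. representation B (S (T b)) b) = (\<Sum>c\<in>C. representation C (T (S c)) c)"
proof -
  have 1: "representation B (S (T b)) b = (\<Sum>c\<in>C. representation C (T b) c * representation B (S c) b)" for b
  proof -
    have "S (T b) = S (\<Sum>c\<in>C. representation C (T b) c *\<^sub>C c)"
      by (simp add: representation_sum_basis C)
    also have "\<dots> = (\<Sum>c\<in>C. representation C (T b) c *\<^sub>C S c)"
      by (simp add: vp.linear_sum[OF S] vp.linear_scale[OF S])
    finally show ?thesis by (simp add: representation_lin_sum B)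
  qed
  have 2: "representation C (T (S c)) c = (\<Sum>b\<in>B. representation B (S c) b * representation C (T b) c)" for c
  proof -
    have "T (S c) = T (\<Sum>b\<in>B. representation B (S c) b *\<^sub>C b)"
      by (simp add: representation_sum_basis B)
    also have "\<dots> = (\<Sum>b\<in>B. representation B (S c) b *\<^sub>C T b)"
      by (simp add: vp.linear_sum[OF T] vp.linear_scale[OF T])
    finally show ?thesis by (simp add: representation_lin_sum C)
  qed
  show ?thesis unfolding 1 2
    by (subst sum.swap) (simp add: mult.commute)
qed

lemma extend_basis_empty: "independent (extend_basis {})" "span (extend_basis {}) = UNIV"
  by (simp_all add: independent_extend_basis independent_empty)

lemma lie_trace_basis:
  assumes "independent B" "span B = UNIV" "lin T"
  shows "lie_trace T = (\<Sum>b\<in>B. representation B (T b) b)"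
  using basis_trace_commute[OF extend_basis_empty assms(1,2,3), of "\<lambda>x. x"] linear_ident
  by (simp add: lie_trace_def)

lemma lie_trace_commute:
  assumes "lin S" "lin T"
  shows "lie_trace (\<lambda>x. S (T x)) = lie_trace (\<lambda>x. T (S x))"
  unfolding lie_trace_def by (rule basis_trace_commute[OF extend_basis_empty extend_basis_empty assms])

lemma lie_trace_add:
  fixes S T :: "'g \<Rightarrow> 'g"
  shows "lie_trace (\<lambda>x. S x + T x) = lie_trace S + lie_trace T"
  unfolding lie_trace_def using extend_basis_empty by (simp add: representation_add sum.distrib)

lemma lie_trace_scale:
  fixes T :: "'g \<Rightarrow> 'g"
  shows "lie_trace (\<lambda>x. c *\<^sub>C T x) = c * lie_trace T"
  unfolding lie_trace_def using extend_basis_empty by (simp add: representation_scale sum_distrib_left)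

lemma lie_trace_diff:
  fixes S T :: "'g \<Rightarrow> 'g"
  shows "lie_trace (\<lambda>x. S x - T x) = lie_trace S - lie_trace T"
  unfolding lie_trace_def using extend_basis_empty by (simp add: representation_diff sum_subtractf)

section \<open>Generalised eigenspaces\<close>

definition shift :: "('g \<Rightarrow> 'g) \<Rightarrow> complex \<Rightarrow> 'g \<Rightarrow> 'g" where
  "shift A a x = A x - a *\<^sub>C x"

definition gspace :: "('g \<Rightarrow> 'g) \<Rightarrow> complex \<Rightarrow> 'g set" where
  "gspace A a = {v. \<exists>n. (shift A a ^^ n) v = 0}"

lemma lin_shift: "lin A \<Longrightarrow> lin (shift A a)"
  by (rule linI) (auto simp: shift_def vp.linear_add vp.linear_scale algebra_simps cscale_add_right
      scale_right_diff_distrib cscale_cscale)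

lemma shift_commute: "lin A \<Longrightarrow> shift A a (shift A b x) = shift A b (shift A a x)"
  by (simp add: shift_def vp.linear_diff vp.linear_scale algebra_simps scale_right_diff_distrib cscale_cscale)

lemma shift_funpow_commute: "lin A \<Longrightarrow> (shift A a ^^ n) (shift A b x) = shift A b ((shift A a ^^ n) x)"
  by (induction n) (auto simp: shift_commute)

lemma shift_funpow_mono:
  assumes "lin A" "(shift A a ^^ n) v = 0" "n \<le> m" shows "(shift A a ^^ m) v = 0"
proof -
  have "(shift A a ^^ m) v = (shift A a ^^ (m - n)) ((shift A a ^^ n) v)"
    using assms(3) by (metis funpow_add le_add_diff_inverse2 o_apply)
  then show ?thesis using assms lin_funpow[OF lin_shift[OF assms(1)]] vp.linear_0 by metis
qed

lemma gspace_subspace: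
  assumes "lin A" shows "subspace (gspace A a)"
proof (rule subspaceI)
  note l = lin_funpow[OF lin_shift[OF assms]]
  show "0 \<in> gspace A a" by (auto simp: gspace_def intro: exI[of _ 0])
  fix x y assume "x \<in> gspace A a" "y \<in> gspace A a"
  then obtain n m where "(shift A a ^^ n) x = 0" "(shift A a ^^ m) y = 0" by (auto simp: gspace_def)
  then have "(shift A a ^^ max n m) x = 0" "(shift A a ^^ max n m) y = 0"
    using shift_funpow_mono[OF assms] by auto
  then have "(shift A a ^^ max n m) (x + y) = 0" by (simp add: vp.linear_add[OF l])
  then show "x + y \<in> gspace A a" by (auto simp: gspace_def)
next
  note l = lin_funpow[OF lin_shift[OF assms]]
  fix c x assume "x \<in> gspace A a"
  then show "c *\<^sub>C x \<in> gspace A a" by (auto simp: gspace_def vp.linear_scale[OF l])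
qed

lemma gspace_shift:
  assumes "lin A" "v \<in> gspace A a" shows "shift A b v \<in> gspace A a"
proof -
  obtain n where "(shift A a ^^ n) v = 0" using assms by (auto simp: gspace_def)
  then have "(shift A a ^^ n) (shift A b v) = 0"
    using shift_funpow_commute[OF assms(1)] vp.linear_0[OF lin_shift[OF assms(1)]] by simp
  then show ?thesis by (auto simp: gspace_def)
qed

lemma gspace_shiftD: "shift A a v \<in> gspace A a \<Longrightarrow> v \<in> gspace A a"
  unfolding gspace_def by (auto simp del: funpow.simps simp: funpow_Suc_right intro: exI[of _ "Suc _"])

lemma gspace_inj:
  assumes A: "lin A" and v: "v \<in> gspace A a" "shift A b v = 0" and ne: "a \<noteq> b"
  shows "v = 0"
proof -
  obtain n where n: "(shift A a ^^ n) v = 0" using v by (auto simp: gspace_def)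
  have s: "shift A a v = (b - a) *\<^sub>C v" using v(2) by (simp add: shift_def scale_left_diff_distrib)
  have "(shift A a ^^ k) v = (b - a) ^ k *\<^sub>C v" for k
    by (induction k) (auto simp: vp.linear_scale[OF lin_shift[OF A]] s cscale_cscale mult.commute)
  with n ne show ?thesis by simp
qed

text \<open>Induction on the order \<open>n\<close> of \<open>v\<close> with respect to \<open>A - a\<close>: the vector \<open>(a - b) v\<close> differs from
  \<open>(A - b) v\<close> by \<open>(A - a) v\<close>, whose order is smaller.\<close>

lemma gspace_surj:
  assumes A: "lin A" and v: "v \<in> gspace A a" and ne: "a \<noteq> b"
  shows "\<exists>w\<in>gspace A a. shift A b w = v"
proof -
  have "(shift A a ^^ n) v = 0 \<Longrightarrow> \<exists>w\<in>gspace A a. shift A b w = v" for n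
    using v
  proof (induction n arbitrary: v)
    case 0
    then show ?case using subspace_0[OF gspace_subspace[OF A]]
      by (auto simp: vp.linear_0[OF lin_shift[OF A]] intro!: bexI[of _ 0])
  next
    case (Suc n)
    have "(shift A a ^^ n) (shift A a v) = 0"
      using Suc.prems(1) by (simp add: funpow_swap1)
    from Suc.IH[OF this gspace_shift[OF A Suc.prems(2)]]
    obtain w where w: "w \<in> gspace A a" "shift A b w = shift A a v" by blast
    let ?w = "(1 / (a - b)) *\<^sub>C (v - w)"
    have "?w \<in> gspace A a"
      using gspace_subspace[OF A] Suc.prems(2) w(1) by (simp add: subspace_diff subspace_scale)
    moreover have "shift A b v - shift A a v = (a - b) *\<^sub>C v"
      by (simp add: shift_def scale_left_diff_distrib)
    then have "shift A b ?w = v"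
      using ne w(2) by (simp add: vp.linear_scale[OF lin_shift[OF A]] vp.linear_diff[OF lin_shift[OF A]] cscale_cscale cscale_one)
    ultimately show ?case by blast
  qed
  moreover obtain n where "(shift A a ^^ n) v = 0" using v by (auto simp: gspace_def)
  ultimately show ?thesis by blast
qed

text \<open>A power of \<open>A - b\<close> removes the summand at \<open>b\<close> and is injective on the other generalised
  eigenspaces, which leaves a shorter relation.\<close>

lemma gspace_independent:
  assumes A: "lin A" and "finite F" "\<And>a. a \<in> F \<Longrightarrow> v a \<in> gspace A a" "(\<Sum>a\<in>F. v a) = 0"
  shows "\<forall>a\<in>F. v a = 0"
  using assms(2-)
proof (induction F arbitrary: v rule: finite_induct)
  case (insert b F)
  obtain n where n: "(shift A b ^^ n) (v b) = 0" using insert.prems(1)[of b] by (auto simp: gspace_def)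
  note l = lin_funpow[OF lin_shift[OF A]]
  have inG: "a \<in> F \<Longrightarrow> (shift A b ^^ k) (v a) \<in> gspace A a" for a k
    by (induction k) (auto intro: gspace_shift[OF A] insert.prems(1))
  have "(\<Sum>a\<in>insert b F. (shift A b ^^ n) (v a)) = 0"
    using insert.prems(2) vp.linear_sum[OF l] vp.linear_0[OF l] by metis
  then have "(\<Sum>a\<in>F. (shift A b ^^ n) (v a)) = 0" using insert.hyps n by simp
  from insert.IH[OF inG this] have z: "\<forall>a\<in>F. (shift A b ^^ n) (v a) = 0" by blast
  have zF: "v a = 0" if "a \<in> F" for a
  proof -
    have "(shift A b ^^ k) (v a) = 0 \<Longrightarrow> v a = 0" for k
    proof (induction k)
      case (Suc k)
      then have "shift A b ((shift A b ^^ k) (v a)) = 0" by simp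
      from gspace_inj[OF A inG[OF that] this] that insert.hyps
      have "(shift A b ^^ k) (v a) = 0" by blast
      then show ?case by (rule Suc.IH)
    qed simp
    then show ?thesis using z that by blast
  qed
  then have "(\<Sum>a\<in>F. v a) = 0" by simp
  with insert.prems(2) insert.hyps have "v b = 0" by simp
  with zF show ?case by blast
qed simp

lemma span_gspace_decomp:
  assumes A: "lin A" and v: "v \<in> span (\<Union>a. gspace A a)"
  shows "\<exists>F w. finite F \<and> (\<forall>a. w a \<in> gspace A a) \<and> v = (\<Sum>a\<in>F. w a)"
  using v
proof (induction rule: span_induct_alt)
  case base
  show ?case using subspace_0[OF gspace_subspace[OF A]] by (intro exI[of _ "{}"] exI[of _ "\<lambda>_. 0"]) auto
next
  case (step c x y)
  then obtain F w b where F: "finite F" "\<forall>a. w a \<in> gspace A a" "y = (\<Sum>a\<in>F. w a)" "x \<in> gspace A b"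
    by blast
  note sub = gspace_subspace[OF A]
  let ?w = "\<lambda>a. (if a \<in> F then w a else 0) + (if a = b then c *\<^sub>C x else 0)"
  have "(\<Sum>a\<in>insert b F. ?w a) = (\<Sum>a\<in>insert b F. if a \<in> F then w a else 0) + c *\<^sub>C x"
    using F(1) by (simp add: sum.distrib del: sum.insert)
  also have "(\<Sum>a\<in>insert b F. if a \<in> F then w a else 0) = y"
    using F by (subst sum.inter_restrict[symmetric]) (auto simp: insert_absorb Int_insert_left)
  finally have "c *\<^sub>C x + y = (\<Sum>a\<in>insert b F. ?w a)" by simp
  moreover have "\<forall>a. ?w a \<in> gspace A a"
    using F(2,4) sub subspace_0[OF sub] by (auto intro!: subspace_add[OF sub] subspace_scale[OF sub])
  ultimately show ?case using F(1) by (intro exI[of _ "insert b F"] exI[of _ ?w]) auto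
qed

definition peval :: "('g \<Rightarrow> 'g) \<Rightarrow> complex poly \<Rightarrow> 'g \<Rightarrow> 'g" where
  "peval A p v = (\<Sum>i\<le>degree p. coeff p i *\<^sub>C (A ^^ i) v)"

lemma peval_bound: "degree p \<le> n \<Longrightarrow> peval A p v = (\<Sum>i\<le>n. coeff p i *\<^sub>C (A ^^ i) v)"
  unfolding peval_def by (rule sum.mono_neutral_left) (auto simp: coeff_eq_0)

lemma peval_diff: "peval A (p - q) v = peval A p v - peval A q v"
  using degree_diff_le_max[of p q]
  by (simp add: peval_bound[of p "max (degree p) (degree q)"] peval_bound[of q "max (degree p) (degree q)"]
      peval_bound[of "p - q" "max (degree p) (degree q)"] scale_left_diff_distrib sum_subtractf)

lemma peval_linear_factor:
  assumes A: "lin A" shows "peval A ([:- a, 1:] * p) v = shift A a (peval A p v)"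
proof -
  let ?n = "degree p"
  have "degree ([:- a, 1:] * p) \<le> Suc ?n"
    using degree_mult_le[of "[:- a, 1:]" p] by simp
  then have "peval A ([:- a, 1:] * p) v = (\<Sum>i\<le>Suc ?n. coeff ([:- a, 1:] * p) i *\<^sub>C (A ^^ i) v)"
    by (rule peval_bound)
  also have "[:- a, 1:] * p = pCons 0 p - smult a p" by simp
  also have "(\<Sum>i\<le>Suc ?n. coeff (pCons 0 p - smult a p) i *\<^sub>C (A ^^ i) v)
      = (\<Sum>i\<le>Suc ?n. coeff (pCons 0 p) i *\<^sub>C (A ^^ i) v) - (\<Sum>i\<le>Suc ?n. (a * coeff p i) *\<^sub>C (A ^^ i) v)"
    by (simp add: scale_left_diff_distrib sum_subtractf del: sum.atMost_Suc)
  also have "(\<Sum>i\<le>Suc ?n. coeff (pCons 0 p) i *\<^sub>C (A ^^ i) v) = A (peval A p v)"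
    by (subst sum.atMost_Suc_shift)
      (simp add: peval_def vp.linear_sum[OF A] vp.linear_scale[OF A])
  also have "(\<Sum>i\<le>Suc ?n. (a * coeff p i) *\<^sub>C (A ^^ i) v) = a *\<^sub>C peval A p v"
    by (simp add: peval_bound[of p "Suc ?n"] scale_sum_right cscale_cscale cscale_add_right del: sum.atMost_Suc)
  finally show ?thesis by (simp add: shift_def)
qed

lemma ex_annihilating_poly: "\<exists>p. p \<noteq> 0 \<and> peval A p v = 0"
proof -
  let ?S = "\<lambda>k. (\<lambda>i. (A ^^ i) v) ` {..<k}"
  have "\<exists>k. (A ^^ k) v \<in> span (?S k)"
  proof (rule ccontr)
    assume *: "\<not> ?thesis"
    have ind: "independent (?S k) \<and> card (?S k) = k" for k
    proof (induction k)
      case (Suc k)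
      have n: "(A ^^ k) v \<notin> span (?S k)" using * by simp
      then have "(A ^^ k) v \<notin> ?S k" using span_base[of "(A ^^ k) v" "?S k"] by (rule contrapos_nn)
      then show ?case using Suc independent_insertI[OF n] by (simp add: lessThan_Suc)
    qed (simp add: independent_empty)
    have "card (?S (Suc dimension)) \<le> dimension"
      using independent_card_le_dim[of "?S (Suc dimension)" UNIV] ind[of "Suc dimension"]
      by (simp add: dimension_def del: funpow.simps)
    then show False using ind[of "Suc dimension"] by linarith
  qed
  then obtain k where k: "(A ^^ k) v \<in> span (?S k)" by blast
  have "x \<in> span (?S k) \<Longrightarrow> \<exists>p. (\<forall>i\<ge>k. coeff p i = 0) \<and> peval A p v = x" for x
  proof (induction rule: span_induct_alt)
    case base
    show ?case by (rule exI[of _ 0]) (simp add: peval_def)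
  next
    case (step c x y)
    then obtain p j where p: "\<forall>i\<ge>k. coeff p i = 0" "peval A p v = y" "j < k" "x = (A ^^ j) v" by auto
    have "peval A (monom (- c) j) v = - (c *\<^sub>C x)"
    proof -
      have "peval A (monom (- c) j) v = (\<Sum>i\<le>j. coeff (monom (- c) j) i *\<^sub>C (A ^^ i) v)"
        by (rule peval_bound) (simp add: degree_monom_le)
      also have "\<dots> = (\<Sum>i\<le>j. if i = j then - (c *\<^sub>C x) else 0)"
        by (rule sum.cong) (auto simp: p)
      finally show ?thesis by simp
    qed
    then show ?case using p by (intro exI[of _ "p - monom (- c) j"]) (auto simp: peval_diff)
  qed
  from this[OF k] obtain p where p: "\<forall>i\<ge>k. coeff p i = 0" "peval A p v = (A ^^ k) v" by blast
  have "peval A (monom 1 k) v = (\<Sum>i\<le>k. coeff (monom 1 k) i *\<^sub>C (A ^^ i) v)"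
    by (rule peval_bound) (simp add: degree_monom_le)
  also have "\<dots> = (\<Sum>i\<le>k. if i = k then (A ^^ k) v else 0)"
    by (rule sum.cong) (auto simp: cscale_one)
  finally have "peval A (monom 1 k - p) v = 0" by (simp add: peval_diff p)
  moreover have "coeff (monom 1 k - p) k \<noteq> 0" using p(1) by simp
  then have "monom 1 k - p \<noteq> 0" by auto
  ultimately show ?thesis by blast
qed

text \<open>The class of \<open>w\<close> is an eigenvector of \<open>A\<close> modulo \<open>G\<close>.  Among the nonzero polynomials \<open>p\<close> with
  \<open>p(A) v \<in> G\<close> take one of least degree and split off a linear factor \<open>X - a\<close>; the cofactor
  evaluated at \<open>A\<close> sends \<open>v\<close> to \<open>w\<close>.\<close>

lemma ex_eigenvector_mod:
  assumes A: "lin A" and G: "subspace G" and v: "v \<notin> G"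
  shows "\<exists>w a. w \<notin> G \<and> shift A a w \<in> G"
proof -
  define P where "P p \<longleftrightarrow> p \<noteq> 0 \<and> peval A p v \<in> G" for p
  have "\<exists>p. P p" using ex_annihilating_poly[of A v] subspace_0[OF G] by (auto simp: P_def)
  then obtain p where p: "P p" and min: "\<And>q. P q \<Longrightarrow> degree p \<le> degree q"
    using ex_has_least_nat[of P _ degree] by blast
  have "degree p \<noteq> 0"
  proof
    assume "degree p = 0"
    then have "peval A p v = coeff p 0 *\<^sub>C v" "coeff p 0 \<noteq> 0"
      using p leading_coeff_0_iff[of p] by (auto simp: peval_def P_def)
    then show False using p v G by (metis P_def scale_one divide_self_if times_divide_eq_left
          mult_1 subspace_scale scale_scale nonzero_divide_eq_eq)
  qed
  then have "\<not> constant (poly p)" by (simp add: constant_degree)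
  then obtain a where "poly p a = 0" using fundamental_theorem_of_algebra by blast
  then obtain q where q: "p = [:- a, 1:] * q" by (auto simp: poly_eq_0_iff_dvd elim: dvdE)
  have "q \<noteq> 0" using p q by (auto simp: P_def)
  then have "degree q < degree p" unfolding q by (subst degree_mult_eq) auto
  with \<open>q \<noteq> 0\<close> have "peval A q v \<notin> G" using min[of q] by (auto simp: P_def)
  moreover have "shift A a (peval A q v) \<in> G" using p unfolding P_def q peval_linear_factor[OF A] by blast
  ultimately show ?thesis by blast
qed

text \<open>If the span \<open>S\<close> of the generalised eigenvectors were proper, some \<open>w\<close> outside \<open>S\<close> would satisfy
  \<open>(A - b) w \<in> S\<close>.  All components of \<open>(A - b) w\<close> at eigenvalues different from \<open>b\<close> can be removed
  by changing \<open>w\<close> within \<open>S\<close>, as \<open>A - b\<close> is invertible there.  Then \<open>w\<close> is a generalised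
  eigenvector for \<open>b\<close> itself.\<close>

lemma span_gspace:
  assumes A: "lin A" shows "span (\<Union>a. gspace A a) = UNIV"
proof (rule ccontr)
  let ?G = "span (\<Union>a. gspace A a)"
  assume "?G \<noteq> UNIV"
  then obtain v where "v \<notin> ?G" by blast
  from ex_eigenvector_mod[OF A subspace_span this]
  obtain w b where w: "w \<notin> ?G" "shift A b w \<in> ?G" by blast
  obtain F u where F: "finite F" "\<forall>a. u a \<in> gspace A a" "shift A b w = (\<Sum>a\<in>F. u a)"
    using span_gspace_decomp[OF A w(2)] by blast
  have "\<exists>z. \<forall>a\<in>F-{b}. z a \<in> gspace A a \<and> shift A b (z a) = u a"
    by (rule bchoice) (use F(2) gspace_surj[OF A] in blast)
  then obtain z where z: "\<And>a. a \<in> F - {b} \<Longrightarrow> z a \<in> gspace A a" "\<And>a. a \<in> F - {b} \<Longrightarrow> shift A b (z a) = u a" by blast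
  have zG: "(\<Sum>a\<in>F-{b}. z a) \<in> ?G" by (rule span_sum) (use z(1) in \<open>auto intro: span_base\<close>)
  have "shift A b (w - (\<Sum>a\<in>F-{b}. z a)) = (\<Sum>a\<in>F. u a) - (\<Sum>a\<in>F-{b}. u a)"
    using z(2) by (simp add: vp.linear_diff[OF lin_shift[OF A]] vp.linear_sum[OF lin_shift[OF A]] F(3))
  also have "\<dots> = (if b \<in> F then u b else 0)" using F(1) by (auto simp: sum.remove)
  also have "\<dots> \<in> gspace A b" using F(2) subspace_0[OF gspace_subspace[OF A]] by auto
  finally have "w - (\<Sum>a\<in>F-{b}. z a) \<in> gspace A b" by (rule gspace_shiftD)
  then have "w - (\<Sum>a\<in>F-{b}. z a) \<in> ?G" by (auto intro: span_base)
  from span_add[OF this zG] w(1) show False by simp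
qed

lemma gspace_decomp:
  assumes A: "lin A"
  obtains F w where "finite F" "\<And>a. w a \<in> gspace A a" "v = (\<Sum>a\<in>F. w a)"
  using span_gspace_decomp[OF A, of v] span_gspace[OF A] by auto

text \<open>In the basis \<open>B\<close> the diagonal entry of \<open>A\<close> at \<open>b\<close> is \<open>\<mu> b\<close>.  This is the part of triangularity
  that a trace sees, and it persists when \<open>B\<close> is enlarged.\<close>

definition eigenbasis :: "('g \<Rightarrow> 'g) \<Rightarrow> ('g \<Rightarrow> complex) \<Rightarrow> 'g set \<Rightarrow> bool" where
  "eigenbasis A \<mu> B \<longleftrightarrow> independent B \<and>
     (\<forall>b\<in>B. b \<in> gspace A (\<mu> b) \<and> shift A (\<mu> b) b \<in> span (B - {b}))"

text \<open>Given a generalised eigenvector \<open>v\<close> outside the span of \<open>B\<close>, the last of \<open>v\<close>, \<open>(A - a) v\<close>,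
  \<open>(A - a)\<^sup>2 v\<close>, \<open>\<dots>\<close> outside this span may be added to \<open>B\<close>.\<close>

lemma ex_eigenbasis:
  assumes A: "lin A"
  shows "\<exists>\<mu> B. eigenbasis A \<mu> B \<and> span B = UNIV"
proof -
  have "\<exists>\<mu> B. eigenbasis A \<mu> B \<and> (span B = UNIV \<or> card B = n)" for n
  proof (induction n)
    case 0
    have "eigenbasis A (\<lambda>_. 0) {}" by (simp add: eigenbasis_def independent_empty)
    then show ?case by fastforce
  next
    case (Suc n)
    then obtain \<mu> B where B: "eigenbasis A \<mu> B" "span B = UNIV \<or> card B = n" by blast
    show ?case
    proof (cases "span B = UNIV")
      case True
      with B show ?thesis by blast
    next
      case False
      have iB: "independent B" using B by (simp add: eigenbasis_def)
      obtain v a where v: "v \<in> gspace A a" "v \<notin> span B"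
        using False span_gspace[OF A] by (metis UN_iff UNIV_I span_mono span_span subsetI subset_antisym top_greatest)
      then obtain m where "(shift A a ^^ m) v = 0" by (auto simp: gspace_def)
      then have "(shift A a ^^ m) v \<in> span B" by (simp add: span_zero)
      then obtain k where k: "(shift A a ^^ k) v \<notin> span B" "(shift A a ^^ Suc k) v \<in> span B"
      proof (induction m)
        case 0 then show ?case using v(2) by simp
      next
        case (Suc m) then show ?case by blast
      qed
      define b where "b = (shift A a ^^ k) v"
      have bG: "b \<in> gspace A a" unfolding b_def
        by (induction k) (use v(1) gspace_shift[OF A] in auto)
      have b: "b \<notin> span B" "shift A a b \<in> span B" using k by (auto simp: b_def)
      then have bB: "b \<notin> B" using span_base by blast
      have "eigenbasis A (\<mu>(b := a)) (insert b B)"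
        unfolding eigenbasis_def
      proof (intro conjI ballI)
        show "independent (insert b B)" using b(1) iB by (rule independent_insertI)
      next
        fix c assume "c \<in> insert b B"
        then show "c \<in> gspace A ((\<mu>(b := a)) c)" using bG B(1) bB by (auto simp: eigenbasis_def)
      next
        fix c assume c: "c \<in> insert b B"
        show "shift A ((\<mu>(b := a)) c) c \<in> span (insert b B - {c})"
        proof (cases "c = b")
          case True
          then show ?thesis using b bB by simp
        next
          case False
          then have "shift A (\<mu> c) c \<in> span (B - {c})" using c B(1) by (auto simp: eigenbasis_def)
          moreover have "span (B - {c}) \<subseteq> span (insert b B - {c})" by (rule span_mono) auto
          ultimately show ?thesis using False by auto
        qed
      qed
      moreover have "card (insert b B) = Suc n"
        using bB B(2) False finiteI_independent[OF iB] by simp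
      ultimately show ?thesis by blast
    qed
  qed
  from this[of "Suc dimension"] obtain \<mu> B where B: "eigenbasis A \<mu> B" "span B = UNIV \<or> card B = Suc dimension" by blast
  then have "card B \<le> dimension"
    using independent_card_le_dim[of B UNIV] by (simp add: eigenbasis_def dimension_def)
  with B show ?thesis by auto
qed

lemma eigenbasis_finite: "eigenbasis A \<mu> B \<Longrightarrow> finite B"
  using finiteI_independent by (auto simp: eigenbasis_def)

lemma gspace_eigenvalue:
  assumes A: "lin A" and B: "eigenbasis A \<mu> B" "span B = UNIV" and v: "v \<in> gspace A a"
  shows "v = (\<Sum>b\<in>{b\<in>B. \<mu> b = a}. representation B v b *\<^sub>C b)"
proof -
  have iB: "independent B" and fB: "finite B" using B eigenbasis_finite by (auto simp: eigenbasis_def)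
  note sub = gspace_subspace[OF A]
  define u where "u c = (\<Sum>b\<in>{b\<in>B. \<mu> b = c}. representation B v b *\<^sub>C b)" for c
  have uG: "u c \<in> gspace A c" for c
    unfolding u_def by (rule subspace_sum[OF sub]) (use B in \<open>auto simp: eigenbasis_def intro!: subspace_scale[OF sub]\<close>)
  let ?F = "insert a (\<mu> ` B)"
  have "v = (\<Sum>b\<in>B. representation B v b *\<^sub>C b)" using representation_sum_basis[OF iB B(2)] by simp
  also have "\<dots> = (\<Sum>c\<in>?F. u c)"
    unfolding u_def using fB by (subst sum.group) auto
  finally have v_eq: "v = (\<Sum>c\<in>?F. u c)" .
  have "(\<Sum>c\<in>?F. u c - (if c = a then v else 0)) = 0"
    using fB by (simp add: sum_subtractf v_eq[symmetric] del: sum.insert)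
  moreover have "u c - (if c = a then v else 0) \<in> gspace A c" for c
    using uG v subspace_0[OF sub] by (auto intro!: subspace_diff[OF sub])
  ultimately have "\<forall>c\<in>?F. u c - (if c = a then v else 0) = 0"
    using fB by (intro gspace_independent[OF A]) auto
  then have "u a = v" by auto
  then show ?thesis by (simp add: u_def)
qed

end

lemma bracket_zero_left [simp]: "bracket 0 (x :: 'g::complex_lie_algebra) = 0"
  using bracket_add_left[of 0 0 x] by simp

lemma bracket_zero_right [simp]: "bracket (x :: 'g::complex_lie_algebra) 0 = 0"
  using bracket_add_right[of x 0 0] by simp

lemma bracket_skew: "bracket x y = - bracket y (x :: 'g::complex_lie_algebra)"
proof -
  have "0 = bracket (x + y) (x + y)" by (simp add: bracket_self)
  also have "\<dots> = bracket x y + bracket y x"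
    by (simp only: bracket_add_left bracket_add_right) (simp add: bracket_self)
  finally show ?thesis by (simp add: eq_neg_iff_add_eq_0)
qed

lemma bracket_minus_right: "bracket x (- y) = - bracket x (y :: 'g::complex_lie_algebra)"
  using bracket_add_right[of x y "- y"] by (simp add: eq_neg_iff_add_eq_0 add.commute)

lemma bracket_minus_left: "bracket (- x) y = - bracket x (y :: 'g::complex_lie_algebra)"
  using bracket_add_left[of x "- x" y] by (simp add: eq_neg_iff_add_eq_0 add.commute)

lemma bracket_diff_right: "bracket x (y - z) = bracket x y - bracket x (z :: 'g::complex_lie_algebra)"
  using bracket_add_right[of x y "- z"] by (simp add: bracket_minus_right)

lemma bracket_diff_left: "bracket (x - y) z = bracket x z - bracket y (z :: 'g::complex_lie_algebra)"
  using bracket_add_left[of x "- y" z] by (simp add: bracket_minus_left)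

lemma bracket_leibniz:
  "bracket x (bracket y z) = bracket (bracket x y) z + bracket y (bracket x (z :: 'g::complex_lie_algebra))"
proof -
  have "bracket z (bracket x y) = - bracket (bracket x y) z" "bracket y (bracket z x) = - bracket y (bracket x z)"
    using bracket_skew[of z "bracket x y"] bracket_skew[of z x] by (simp_all add: bracket_minus_right)
  with bracket_jacobi[of x y z] show ?thesis by (simp add: algebra_simps eq_neg_iff_add_eq_0)
qed

context fd_lie
begin

definition subalg :: "'g set \<Rightarrow> bool" where
  "subalg K \<longleftrightarrow> subspace K \<and> (\<forall>x\<in>K. \<forall>y\<in>K. bracket x y \<in> K)"

lemma lin_bracket: "lin (bracket x)"
  by (rule linI) (auto simp: bracket_add_right bracket_cscale_right)

section \<open>Engel's theorem\<close>

text \<open>Engel's theorem for the action of \<open>T\<close> on the quotient \<open>W / W'\<close>: some nonzero class is killed by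
  \<open>T\<close>.  Let \<open>K\<close> be a largest subalgebra that kills a nonzero class.  If \<open>K\<close> is proper, take \<open>w\<close> in
  \<open>T - K\<close> normalizing \<open>K\<close>.  Then \<open>w\<close> preserves the classes killed by \<open>K\<close>, and the last nonzero one
  among \<open>v\<close>, \<open>w v\<close>, \<open>w\<^sup>2 v\<close>, \<open>\<dots>\<close> is killed by \<open>K + \<complex> w\<close>.  The quotient is given by two sets and the
  action by an arbitrary function, so that both the adjoint representation and modules over the
  enveloping algebra are instances.\<close>

lemma engel_pair:
  fixes \<rho> :: "'g \<Rightarrow> 'v \<Rightarrow> 'v"
  assumes T: "subalg T"
    and norm: "\<And>K. subalg K \<Longrightarrow> K \<subset> T \<Longrightarrow> \<exists>w\<in>T - K. \<forall>k\<in>K. bracket k w \<in> K"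
    and W: "W' \<subset> W"
    and inv: "\<And>x v. x \<in> T \<Longrightarrow> v \<in> W \<Longrightarrow> \<rho> x v \<in> W" "\<And>x v. x \<in> T \<Longrightarrow> v \<in> W' \<Longrightarrow> \<rho> x v \<in> W'"
    and nil: "\<And>x v. x \<in> T \<Longrightarrow> v \<in> W \<Longrightarrow> \<exists>n. (\<rho> x ^^ n) v \<in> W'"
    and brk: "\<And>x y v. x \<in> T \<Longrightarrow> y \<in> T \<Longrightarrow> v \<in> W \<Longrightarrow> \<rho> y (\<rho> x v) \<in> W' \<Longrightarrow> \<rho> (bracket x y) v \<in> W' \<Longrightarrow> \<rho> x (\<rho> y v) \<in> W'"
    and lin: "\<And>x y c v. x \<in> T \<Longrightarrow> y \<in> T \<Longrightarrow> v \<in> W \<Longrightarrow> \<rho> x v \<in> W' \<Longrightarrow> \<rho> y v \<in> W' \<Longrightarrow> \<rho> (x + c *\<^sub>C y) v \<in> W'"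
    and zero: "\<And>v. v \<in> W \<Longrightarrow> \<rho> 0 v \<in> W'"
  shows "\<exists>v\<in>W - W'. \<forall>x\<in>T. \<rho> x v \<in> W'"
proof -
  define Q where "Q K \<longleftrightarrow> subalg K \<and> K \<subseteq> T \<and> (\<exists>v\<in>W - W'. \<forall>x\<in>K. \<rho> x v \<in> W')" for K
  have Q0: "Q {0}" using W T zero by (auto simp: Q_def subalg_def subspace_0)
  have "\<forall>K. Q K \<longrightarrow> dim K < Suc dimension"
    using dim_subset_UNIV by (auto simp: less_Suc_eq_le)
  from ex_has_greatest_nat[OF Q0 this] obtain K where
    K: "Q K" and max: "\<And>L. Q L \<Longrightarrow> dim L \<le> dim K" by blast
  have sK: "subspace K" and K_alg: "subalg K" "K \<subseteq> T" using K by (auto simp: Q_def subalg_def)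
  obtain v where v: "v \<in> W" "v \<notin> W'" "\<And>x. x \<in> K \<Longrightarrow> \<rho> x v \<in> W'" using K by (auto simp: Q_def)
  have "K = T"
  proof (rule ccontr)
    assume "K \<noteq> T"
    then obtain w where w: "w \<in> T" "w \<notin> K" "\<And>k. k \<in> K \<Longrightarrow> bracket k w \<in> K"
      using norm[OF K_alg(1)] K_alg(2) by blast
    have it: "(\<rho> w ^^ j) v \<in> W \<and> (\<forall>k\<in>K. \<rho> k ((\<rho> w ^^ j) v) \<in> W')" for j
    proof (induction j)
      case 0
      show ?case using v by simp
    next
      case (Suc j)
      let ?u = "(\<rho> w ^^ j) v"
      have "\<rho> k (\<rho> w ?u) \<in> W'" if k: "k \<in> K" for k
      proof (rule brk)
        show "\<rho> w (\<rho> k ?u) \<in> W'" using Suc k w inv(2) by blast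
        show "\<rho> (bracket k w) ?u \<in> W'" using Suc k w by blast
      qed (use k K_alg w Suc in auto)
      then show ?case using Suc inv(1) w by simp
    qed
    obtain n where "(\<rho> w ^^ n) v \<in> W'" using nil w v by blast
    then obtain m where m: "(\<rho> w ^^ m) v \<notin> W'" "(\<rho> w ^^ Suc m) v \<in> W'"
    proof (induction n)
      case 0 then show ?case using v(2) by simp
    next
      case (Suc n) then show ?case by blast
    qed
    let ?u = "(\<rho> w ^^ m) v" and ?L = "span (insert w K)"
    have L: "x \<in> ?L \<longleftrightarrow> (\<exists>c. x - c *\<^sub>C w \<in> K)" for x
      using sK by (simp add: span_breakdown_eq span_eq_iff[THEN iffD2])
    have "subalg ?L"
      unfolding subalg_def
    proof (intro conjI ballI)
      show "subspace ?L" by simp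
      fix x y assume "x \<in> ?L" "y \<in> ?L"
      then obtain c d where cd: "x - c *\<^sub>C w \<in> K" "y - d *\<^sub>C w \<in> K" using L by blast
      define a b where "a = x - c *\<^sub>C w" and "b = y - d *\<^sub>C w"
      have x: "x = a + c *\<^sub>C w" and y: "y = b + d *\<^sub>C w" by (auto simp: a_def b_def)
      have ab: "a \<in> K" "b \<in> K" using cd by (auto simp: a_def b_def)
      have "bracket x y = bracket a b + d *\<^sub>C bracket a w - c *\<^sub>C bracket b w"
        unfolding x y using bracket_skew[of w b]
        by (simp add: bracket_add_left bracket_add_right bracket_cscale_left bracket_cscale_right bracket_self)
      also have "\<dots> \<in> K"
        using ab w(3) K_alg(1) by (auto simp: subalg_def intro!: subspace_add[OF sK] subspace_diff[OF sK] subspace_scale[OF sK])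
      finally show "bracket x y \<in> ?L" by (intro span_base) simp
    qed
    moreover have "?L \<subseteq> T"
      using w K_alg T by (intro span_minimal) (auto simp: subalg_def)
    moreover have "\<forall>x\<in>?L. \<rho> x ?u \<in> W'"
    proof
      fix x assume "x \<in> ?L"
      then obtain c where c: "x - c *\<^sub>C w \<in> K" using L by blast
      have "\<rho> ((x - c *\<^sub>C w) + c *\<^sub>C w) ?u \<in> W'"
        by (rule lin) (use c w m it[of m] K_alg in auto)
      then show "\<rho> x ?u \<in> W'" by simp
    qed
    ultimately have "Q ?L" using it m(1) unfolding Q_def by blast
    then have "dim ?L \<le> dim K" by (rule max)
    moreover have "span K \<subset> span ?L"
      using w(2) sK by (metis insertI1 psubsetI span_base span_eq_iff span_mono span_span subset_insertI)
    then have "dim K < dim ?L" by (rule dim_psubset)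
    ultimately show False by simp
  qed
  then show ?thesis using v by auto
qed

text \<open>By induction every proper subalgebra of \<open>K\<close> is smaller than its normalizer in \<open>K\<close>.  So Engel's
  theorem applies to \<open>K\<close> acting on \<open>T / K\<close>.\<close>

lemma engel_normalizer:
  assumes "subalg T" "\<And>x y. x \<in> T \<Longrightarrow> y \<in> T \<Longrightarrow> \<exists>n. (bracket x ^^ n) y = 0" "subalg K" "K \<subset> T"
  shows "\<exists>w\<in>T - K. \<forall>k\<in>K. bracket k w \<in> K"
  using assms
proof (induction "dim T" arbitrary: T K rule: less_induct)
  case less
  have sT: "subspace T" and sK: "subspace K" using less.prems by (auto simp: subalg_def)
  have "span K \<subset> span T" using less.prems(4) sT sK by (metis span_eq_iff)
  then have d: "dim K < dim T" by (rule dim_psubset)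
  have K0: "0 \<in> K" using sK by (rule subspace_0)
  have "\<exists>v\<in>T - K. \<forall>x\<in>K. bracket x v \<in> K"
  proof (rule engel_pair[where \<rho> = bracket])
    show "\<exists>w\<in>K - L. \<forall>k\<in>L. bracket k w \<in> L" if "subalg L" "L \<subset> K" for L
      by (rule less.hyps[OF d less.prems(3)]) (use that less.prems in auto)
    show "\<exists>n. (bracket x ^^ n) v \<in> K" if "x \<in> K" "v \<in> T" for x v
    proof -
      have "\<exists>n. (bracket x ^^ n) v = 0" using that less.prems(4) by (intro less.prems(2)) auto
      then show ?thesis using K0 by metis
    qed
    show "bracket x (bracket y v) \<in> K" if "bracket y (bracket x v) \<in> K" "bracket (bracket x y) v \<in> K" for x y v
      using that subspace_add[OF sK] by (subst bracket_leibniz) auto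
    show "bracket (x + c *\<^sub>C y) v \<in> K" if "bracket x v \<in> K" "bracket y v \<in> K" for x y c v
      using that by (simp add: bracket_add_left bracket_cscale_left subspace_add[OF sK] subspace_scale[OF sK])
  qed (use less.prems K0 in \<open>auto simp: subalg_def\<close>)
  then show ?case .
qed

lemma engel_center:
  assumes T: "subalg T" and nil: "\<And>x y. x \<in> T \<Longrightarrow> \<exists>n. (bracket x ^^ n) y = 0" and ne: "T \<noteq> {0}"
  shows "\<exists>z\<in>T. z \<noteq> 0 \<and> (\<forall>x\<in>T. bracket x z = 0)"
proof -
  have T0: "0 \<in> T" using T by (auto simp: subalg_def subspace_0)
  have "\<exists>v\<in>T - {0}. \<forall>x\<in>T. bracket x v \<in> {0}"
  proof (rule engel_pair[where \<rho> = bracket])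
    show "\<exists>w\<in>T - K. \<forall>k\<in>K. bracket k w \<in> K" if "subalg K" "K \<subset> T" for K
      using engel_normalizer[OF T _ that] nil by blast
    show "bracket x (bracket y v) \<in> {0}" if "bracket y (bracket x v) \<in> {0}" "bracket (bracket x y) v \<in> {0}" for x y v
      using that by (subst bracket_leibniz) auto
    show "bracket (x + c *\<^sub>C y) v \<in> {0}" if "bracket x v \<in> {0}" "bracket y v \<in> {0}" for x y c v
      using that by (simp add: bracket_add_left bracket_cscale_left)
  qed (use T ne nil T0 in \<open>auto simp: subalg_def\<close>)
  then show ?thesis by auto
qed

section \<open>Nondegeneracy of the Killing form\<close>

text \<open>This follows from \<open>(A - (a + b)) [x, y] = [(A - a) x, y] + [x, (A - b) y]\<close> by induction on the
  orders of \<open>x\<close> and \<open>y\<close>.\<close>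

lemma gspace_derivation_bracket:
  assumes A: "lin A" and der: "\<And>x y. A (bracket x y) = bracket (A x) y + bracket x (A y)"
    and "x \<in> gspace A a" "y \<in> gspace A b"
  shows "bracket x y \<in> gspace A (a + b)"
proof -
  note sub = gspace_subspace[OF A, of "a + b"]
  have "(shift A a ^^ n) x = 0 \<Longrightarrow> (shift A b ^^ m) y = 0 \<Longrightarrow> bracket x y \<in> gspace A (a + b)" for n m
  proof (induction "n + m" arbitrary: n m x y)
    case 0
    then show ?case using subspace_0[OF sub] by simp
  next
    case (Suc k)
    have 1: "bracket (shift A a x) y \<in> gspace A (a + b)"
    proof (cases n)
      case 0
      then have "shift A a x = 0" using Suc.prems(1) vp.linear_0[OF lin_shift[OF A]] by simp
      then show ?thesis using subspace_0[OF sub] by simp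
    next
      case (Suc n')
      then show ?thesis using Suc.hyps(1)[of n' m "shift A a x" y] Suc.hyps(2) Suc.prems
        by (simp add: funpow_swap1)
    qed
    have 2: "bracket x (shift A b y) \<in> gspace A (a + b)"
    proof (cases m)
      case 0
      then have "shift A b y = 0" using Suc.prems(2) vp.linear_0[OF lin_shift[OF A]] by simp
      then show ?thesis using subspace_0[OF sub] by simp
    next
      case (Suc m')
      then show ?thesis using Suc.hyps(1)[of n m' x "shift A b y"] Suc.hyps(2) Suc.prems
        by (simp add: funpow_swap1)
    qed
    have "shift A (a + b) (bracket x y) = bracket (shift A a x) y + bracket x (shift A b y)"
      by (simp add: shift_def der bracket_diff_left bracket_diff_right bracket_cscale_left
          bracket_cscale_right cscale_add_left)
    with 1 2 subspace_add[OF sub] have "shift A (a + b) (bracket x y) \<in> gspace A (a + b)" by simp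
    then show ?case by (rule gspace_shiftD)
  qed
  then show ?thesis using assms(3,4) by (auto simp: gspace_def)
qed

lemma killing_sym: "killing_form x y = killing_form y (x::'g)"
  unfolding killing_form_def by (rule lie_trace_commute[OF lin_bracket lin_bracket])

lemma killing_add_right: "killing_form x (y + z) = killing_form x y + killing_form x (z::'g)"
  unfolding killing_form_def by (simp add: bracket_add_left bracket_add_right lie_trace_add)

lemma killing_scale_right: "killing_form x (c *\<^sub>C y) = c * killing_form x (y::'g)"
  unfolding killing_form_def by (simp add: bracket_cscale_left bracket_cscale_right lie_trace_scale)

lemma killing_minus_right: "killing_form x (- y) = - killing_form x (y::'g)"
  using killing_scale_right[of x "- 1" y] by simp

lemma killing_sum_right: "killing_form x (\<Sum>i\<in>I. y i) = (\<Sum>i\<in>I. killing_form x (y i :: 'g))"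
  using killing_scale_right[of x 0 0]
  by (induction I rule: infinite_finite_induct) (auto simp: killing_add_right)

lemma killing_invariant: "killing_form (bracket x y) z = killing_form x (bracket y (z::'g))"
proof -
  have "killing_form (bracket x y) z
      = lie_trace (\<lambda>v. bracket x (bracket y (bracket z v)) - bracket y (bracket x (bracket z v)))"
    unfolding killing_form_def by (simp add: bracket_leibniz[of x y])
  also have "\<dots> = lie_trace (\<lambda>v. bracket x (bracket y (bracket z v))) - lie_trace (\<lambda>v. bracket x (bracket z (bracket y v)))"
    unfolding lie_trace_diff
    using lie_trace_commute[OF lin_bracket[of y] lin_comp[OF lin_bracket[of x] lin_bracket[of z]]] by simp
  also have "\<dots> = killing_form x (bracket y z)"
    unfolding killing_form_def lie_trace_diff[symmetric]
    by (simp add: bracket_leibniz[of y z] bracket_add_right)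
  finally show ?thesis .
qed

lemma representation_span_delete:
  assumes "independent B" "v \<in> span (B - {b})" shows "representation B v b = 0"
  using representation_extend[OF assms(1,2)] representation_ne_zero[of "B - {b}" v b] by auto

text \<open>The core of Cartan's criterion.  Let \<open>D\<close> act on the generalised eigenspace of \<open>ad x\<close> for \<open>a\<close> as
  the complex conjugate of \<open>a\<close>.  Conjugation being additive, \<open>D\<close> is a derivation.  For \<open>x = [s, y]\<close> this
  gives \<open>tr (ad x D) = - tr (ad s (ad (D y)))\<close>, and the Killing form of \<open>s\<close> and \<open>D y\<close> is zero.  But
  the trace is also the sum of the numbers \<open>\<bar>a\<bar>\<^sup>2\<close> over the eigenvalues \<open>a\<close> of \<open>ad x\<close>, which therefore
  all vanish.\<close>

lemma ad_nilpotent_killing_radical: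
  assumes S: "\<And>s y. s \<in> S \<Longrightarrow> killing_form s y = 0"
    and x: "x \<in> span {bracket s y | s y. s \<in> S}"
  shows "\<exists>n. (bracket x ^^ n) v = 0"
proof -
  define A where "A = bracket x"
  have A: "lin A" unfolding A_def by (rule lin_bracket)
  obtain \<mu> B where B: "eigenbasis A \<mu> B" "span B = UNIV" using ex_eigenbasis[OF A] by blast
  have iB: "independent B" and fB: "finite B" using B eigenbasis_finite by (auto simp: eigenbasis_def)
  \<comment> \<open>Defined on a basis; the next facts identify its action on each generalised eigenspace.\<close>
  define D where "D = vp.construct B (\<lambda>b. cnj (\<mu> b) *\<^sub>C b)"
  have D: "lin D" unfolding D_def using iB by (rule vp.linear_construct)
  have Db: "D b = cnj (\<mu> b) *\<^sub>C b" if "b \<in> B" for b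
    unfolding D_def by (rule vp.construct_basis[OF iB that])
  have Dg: "D u = cnj a *\<^sub>C u" if u: "u \<in> gspace A a" for u a
  proof -
    note e = gspace_eigenvalue[OF A B u]
    have "D u = (\<Sum>b\<in>{b\<in>B. \<mu> b = a}. representation B u b *\<^sub>C D b)"
      by (subst e) (simp add: vp.linear_sum[OF D] vp.linear_scale[OF D])
    also have "\<dots> = (\<Sum>b\<in>{b\<in>B. \<mu> b = a}. cnj a *\<^sub>C (representation B u b *\<^sub>C b))"
      by (rule sum.cong) (auto simp: Db cscale_cscale mult.commute)
    also have "\<dots> = cnj a *\<^sub>C (\<Sum>b\<in>{b\<in>B. \<mu> b = a}. representation B u b *\<^sub>C b)"
      by (rule scale_sum_right[symmetric])
    also have "\<dots> = cnj a *\<^sub>C u" using e by simp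
    finally show ?thesis .
  qed
  have der_basis: "D (bracket b c) = bracket (D b) c + bracket b (D c)" if "b \<in> B" "c \<in> B" for b c
  proof -
    have "bracket b c \<in> gspace A (\<mu> b + \<mu> c)"
      using that B by (intro gspace_derivation_bracket[OF A]) (auto simp: A_def eigenbasis_def bracket_leibniz[of x])
    then show ?thesis using that
      by (simp add: Dg Db bracket_cscale_left bracket_cscale_right cscale_add_left)
  qed
  have der: "D (bracket y z) = bracket (D y) z + bracket y (D z)" for y z
  proof -
    have bas: "D (bracket b z) = bracket (D b) z + bracket b (D z)" if b: "b \<in> B" for b
    proof -
      have "z \<in> span B" using B by simp
      then show ?thesis
      proof (induction rule: span_induct_alt)
        case (step c w z)
        then show ?case using der_basis[OF b, of w]
          by (simp add: bracket_add_right bracket_cscale_right vp.linear_add[OF D] vp.linear_scale[OF D] cscale_add_right)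
      qed (simp add: vp.linear_0[OF D])
    qed
    have "y \<in> span B" using B by simp
    then show ?thesis
    proof (induction rule: span_induct_alt)
      case (step c w y)
      then show ?case using bas[of w]
        by (simp add: bracket_add_left bracket_cscale_left vp.linear_add[OF D] vp.linear_scale[OF D] cscale_add_right)
    qed (simp add: vp.linear_0[OF D])
  qed
  have tr0: "lie_trace (\<lambda>w. bracket (bracket s y) (D w)) = 0" if s: "s \<in> S" for s y
  proof -
    have "lie_trace (\<lambda>w. bracket (bracket s y) (D w))
        = lie_trace (\<lambda>w. bracket s (bracket y (D w)) - bracket y (bracket s (D w)))"
      by (simp add: bracket_leibniz[of s y])
    also have "\<dots> = lie_trace (\<lambda>w. bracket s (bracket y (D w))) - lie_trace (\<lambda>w. bracket s (D (bracket y w)))"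
      unfolding lie_trace_diff
      using lie_trace_commute[OF lin_bracket[of y] lin_comp[OF lin_bracket[of s] D]] by simp
    also have "\<dots> = lie_trace (\<lambda>w. (- 1) *\<^sub>C bracket s (bracket (D y) w))"
      unfolding lie_trace_diff[symmetric] by (simp add: der bracket_add_right)
    also have "\<dots> = - killing_form s (D y)"
      unfolding lie_trace_scale killing_form_def by simp
    also have "\<dots> = 0" using S[OF s] by simp
    finally show ?thesis .
  qed
  have "lie_trace (\<lambda>w. bracket x (D w)) = 0" using x
  proof (induction rule: span_induct_alt)
    case base
    show ?case using lie_trace_scale[of 0 "\<lambda>_. 0"] by simp
  next
    case (step c w y)
    then show ?case using tr0 by (auto simp: bracket_add_left bracket_cscale_left lie_trace_add lie_trace_scale)
  qed
  moreover have "lie_trace (\<lambda>w. A (D w)) = (\<Sum>b\<in>B. representation B (A (D b)) b)"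
    by (rule lie_trace_basis[OF iB B(2) lin_comp[OF A D]])
  moreover have "representation B (A (D b)) b = of_real ((cmod (\<mu> b))\<^sup>2)" if b: "b \<in> B" for b
  proof -
    have "A b = shift A (\<mu> b) b + \<mu> b *\<^sub>C b" by (simp add: shift_def)
    moreover have "representation B (shift A (\<mu> b) b) b = 0"
      using B b by (intro representation_span_delete[OF iB]) (auto simp: eigenbasis_def)
    ultimately have "representation B (A b) b = \<mu> b"
      using B iB b by (simp add: representation_add representation_scale representation_basis)
    then have "representation B (A (D b)) b = \<mu> b * cnj (\<mu> b)" using b iB B
      by (simp add: Db vp.linear_scale[OF A] representation_scale mult.commute)
    then show ?thesis by (simp only: complex_norm_square)
  qed
  ultimately have "(\<Sum>b\<in>B. of_real ((cmod (\<mu> b))\<^sup>2)) = (0::complex)" by (simp add: A_def)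
  then have "(\<Sum>b\<in>B. (cmod (\<mu> b))\<^sup>2) = 0"
    unfolding of_real_sum[symmetric] of_real_eq_0_iff .
  then have mu0: "\<mu> b = 0" if "b \<in> B" for b
    using fB that by (subst (asm) sum_nonneg_eq_0_iff) auto
  have "B \<subseteq> gspace A 0" using B mu0 by (auto simp: eigenbasis_def)
  then have "span B \<subseteq> gspace A 0" by (rule span_minimal) (rule gspace_subspace[OF A])
  then have "v \<in> gspace A 0" using B by auto
  moreover have "shift A 0 = A" by (auto simp: shift_def)
  ultimately show ?thesis by (simp add: gspace_def A_def)
qed

lemma abelian_ideal_zero:
  assumes ss: "semisimple_lie_algebra TYPE('g)" and J: "lie_ideal (J :: 'g set)"
    and ab: "\<And>x y. x \<in> J \<Longrightarrow> y \<in> J \<Longrightarrow> bracket x y = 0"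
  shows "J = {0}"
proof -
  have "{bracket x y | x y. x \<in> J \<and> y \<in> J} \<subseteq> {0}" using ab by auto
  then have "span {bracket x y | x y. x \<in> J \<and> y \<in> J} = {0}"
    using span_mono span_0 span_zero by (metis (no_types, lifting) span_empty span_insert_0 subset_antisym subset_singletonD)
  then have "derived_series J 1 = {0}" by simp
  then have "lie_solvable J" unfolding lie_solvable_def by blast
  with ss J show ?thesis by (simp add: semisimple_lie_algebra_def)
qed

text \<open>Let \<open>S\<close> be the radical of the Killing form and \<open>T = [S, g]\<close>.  All elements of \<open>T\<close> are ad-nilpotent,
  so by Engel's theorem \<open>T\<close> has nonzero centre unless \<open>T = 0\<close>.  The centre of \<open>T\<close> is an abelian ideal
  of \<open>g\<close>, hence zero.  So \<open>T = 0\<close>, whence \<open>S\<close> is an abelian ideal and vanishes too.\<close>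

theorem killing_nondegenerate:
  assumes ss: "semisimple_lie_algebra TYPE('g)" and x: "\<And>y. killing_form (x::'g) y = 0"
  shows "x = 0"
proof -
  define S where "S = {x::'g. \<forall>y. killing_form x y = 0}"
  have sS: "subspace S"
    by (rule subspaceI) (auto simp: S_def killing_sym[of _ "_ :: 'g"] killing_add_right killing_scale_right
        killing_scale_right[of _ 0 0, simplified])
  have S_ideal: "bracket y s \<in> S" if "s \<in> S" for y s
  proof -
    have "killing_form (bracket y s) z = 0" for z
    proof -
      have "killing_form (bracket y s) z = - killing_form (bracket s y) z"
        by (subst bracket_skew[of y s]) (simp add: killing_sym[of _ z] killing_minus_right)
      then show ?thesis using that killing_invariant[of s y z] by (simp add: S_def)
    qed
    then show ?thesis by (simp add: S_def)
  qed
  define T where "T = span {bracket s y | s y. s \<in> S}"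
  have TS: "T \<subseteq> S"
    unfolding T_def
  proof (rule span_minimal[OF _ sS], clarify)
    fix s y assume "s \<in> S"
    then have "- bracket y s \<in> S" by (intro subspace_neg[OF sS] S_ideal)
    then show "bracket s y \<in> S" by (simp add: bracket_skew[of s y])
  qed
  have T_ideal: "bracket y t \<in> T" if "t \<in> T" for y t
  proof -
    have "bracket t y \<in> T" using that TS unfolding T_def by (blast intro: span_base)
    then show ?thesis using bracket_skew[of y t] by (simp add: T_def span_neg)
  qed
  have T_alg: "subalg T" using T_ideal by (auto simp: subalg_def T_def)
  have "T = {0}"
  proof (rule ccontr)
    assume "T \<noteq> {0}"
    with engel_center[OF T_alg] obtain z where z: "z \<in> T" "z \<noteq> 0" "\<And>x. x \<in> T \<Longrightarrow> bracket x z = 0"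
      using ad_nilpotent_killing_radical[of S] unfolding T_def S_def by blast
    define Z where "Z = {z\<in>T. \<forall>x\<in>T. bracket x z = 0}"
    have "lie_ideal Z"
      unfolding lie_ideal_def
    proof (intro conjI allI ballI)
      show "subspace Z" using T_alg
        by (auto simp: Z_def subalg_def subspace_def bracket_add_right bracket_cscale_right)
      fix y z assume "z \<in> Z"
      then show "bracket y z \<in> Z"
        using T_ideal bracket_skew[of _ y] bracket_leibniz[of _ y z]
        by (auto simp: Z_def bracket_minus_left)
    qed
    then have "Z = {0}" by (rule abelian_ideal_zero[OF ss]) (auto simp: Z_def)
    then show False using z by (auto simp: Z_def)
  qed
  then have "bracket s y = 0" if "s \<in> S" for s y
    using that unfolding T_def by (metis (mono_tags, lifting) mem_Collect_eq singletonD span_base)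
  then have "S = {0}"
    using sS S_ideal by (intro abelian_ideal_zero[OF ss]) (auto simp: lie_ideal_def)
  then show ?thesis using x by (auto simp: S_def)
qed

end

section \<open>The grading of an \<open>sl\<^sub>2\<close>-triple\<close>

locale sl2_lie = fd_lie Basis for Basis :: "'g::complex_lie_algebra set" +
  fixes e h f :: 'g
  assumes triple: "sl2_triple e h f" and nilp: "ad_nilpotent e"
begin

abbreviation "E \<equiv> bracket e"
abbreviation "H \<equiv> bracket h"
abbreviation "F \<equiv> bracket f"

lemma HE: "H (E v) = E (H v) + 2 *\<^sub>C E v"
  using triple bracket_leibniz[of h e v] by (simp add: sl2_triple_def bracket_cscale_left)

lemma HF: "H (F v) = F (H v) - 2 *\<^sub>C F v"
  using triple bracket_leibniz[of h f v] by (simp add: sl2_triple_def bracket_cscale_left bracket_minus_left)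

lemma EF: "E (F v) = F (E v) + H v"
  using triple bracket_leibniz[of e f v] by (simp add: sl2_triple_def)

lemma Fpow_lin: "(F ^^ n) (v + w) = (F ^^ n) v + (F ^^ n) w" "(F ^^ n) (v - w) = (F ^^ n) v - (F ^^ n) w"
    "(F ^^ n) (c *\<^sub>C v) = c *\<^sub>C (F ^^ n) v" "(F ^^ n) 0 = 0"
  using lin_funpow[OF lin_bracket, of n f] by (simp_all add: vp.linear_add vp.linear_diff vp.linear_scale vp.linear_0)

lemma Epow_lin: "(E ^^ n) (v + w) = (E ^^ n) v + (E ^^ n) w" "(E ^^ n) (v - w) = (E ^^ n) v - (E ^^ n) w"
    "(E ^^ n) (c *\<^sub>C v) = c *\<^sub>C (E ^^ n) v" "(E ^^ n) 0 = 0"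
  using lin_funpow[OF lin_bracket, of n e] by (simp_all add: vp.linear_add vp.linear_diff vp.linear_scale vp.linear_0)

lemma affine_combination:
  "1 + a = c \<Longrightarrow> a * b = c * d \<Longrightarrow> x + a *\<^sub>C (x - b *\<^sub>C v) = c *\<^sub>C (x - d *\<^sub>C (v::'g))"
  by (auto simp: scale_right_diff_distrib cscale_cscale cscale_add_left cscale_one)

lemma E_Fpow: "E ((F ^^ Suc n) v) = (F ^^ Suc n) (E v) + of_nat (Suc n) *\<^sub>C (F ^^ n) (shift H (of_nat n) v)"
proof (induction n arbitrary: v)
  case 0
  show ?case by (simp add: EF shift_def cscale_one)
next
  case (Suc n)
  have "E ((F ^^ Suc (Suc n)) v) = E ((F ^^ Suc n) (F v))" by (simp only: funpow_Suc_right o_apply)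
  also have "\<dots> = (F ^^ Suc n) (E (F v)) + of_nat (Suc n) *\<^sub>C (F ^^ n) (shift H (of_nat n) (F v))"
    by (rule Suc.IH)
  also have "shift H (of_nat n) (F v) = F (shift H (of_nat n + 2) v)"
    by (simp add: shift_def HF bracket_diff_right bracket_cscale_right cscale_add_left algebra_simps bracket_add_right)
  also have "(F ^^ n) (F (shift H (of_nat n + 2) v)) = (F ^^ Suc n) (shift H (of_nat n + 2) v)"
    by (simp only: funpow_Suc_right o_apply)
  also have "(F ^^ Suc n) (E (F v)) = (F ^^ Suc (Suc n)) (E v) + (F ^^ Suc n) (H v)"
    by (simp only: EF Fpow_lin) (simp only: funpow_Suc_right o_apply)
  finally have *: "E ((F ^^ Suc (Suc n)) v) = (F ^^ Suc (Suc n)) (E v) + (F ^^ Suc n) (H v)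
      + of_nat (Suc n) *\<^sub>C (F ^^ Suc n) (shift H (of_nat n + 2) v)" .
  have "(F ^^ Suc n) (H v) + of_nat (Suc n) *\<^sub>C (F ^^ Suc n) (shift H (of_nat n + 2) v)
     = (F ^^ Suc n) (H v + of_nat (Suc n) *\<^sub>C shift H (of_nat n + 2) v)"
    by (simp only: Fpow_lin)
  also have "H v + of_nat (Suc n) *\<^sub>C shift H (of_nat n + 2) v = of_nat (Suc (Suc n)) *\<^sub>C shift H (of_nat (Suc n)) v"
    unfolding shift_def by (rule affine_combination) (simp_all add: algebra_simps)
  finally show ?case unfolding * by (simp only: add.assoc Fpow_lin)
qed

lemma Epow_F: "(E ^^ Suc n) (F v) = F ((E ^^ Suc n) v) + of_nat (Suc n) *\<^sub>C (E ^^ n) (shift H (- of_nat n) v)"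
proof (induction n arbitrary: v)
  case 0
  show ?case by (simp add: EF shift_def cscale_one)
next
  case (Suc n)
  have "(E ^^ Suc (Suc n)) (F v) = (E ^^ Suc n) (E (F v))" by (simp only: funpow_Suc_right o_apply)
  also have "\<dots> = (E ^^ Suc n) (F (E v)) + (E ^^ Suc n) (H v)" by (simp only: EF Epow_lin)
  also have "(E ^^ Suc n) (F (E v)) = F ((E ^^ Suc n) (E v)) + of_nat (Suc n) *\<^sub>C (E ^^ n) (shift H (- of_nat n) (E v))"
    by (rule Suc.IH)
  also have "shift H (- of_nat n) (E v) = E (shift H (- of_nat n - 2) v)"
    by (simp add: shift_def HE bracket_diff_right bracket_cscale_right cscale_add_left algebra_simps
       scale_left_diff_distrib bracket_add_right)
  also have "(E ^^ n) (E (shift H (- of_nat n - 2) v)) = (E ^^ Suc n) (shift H (- of_nat n - 2) v)"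
    by (simp only: funpow_Suc_right o_apply)
  also have "(E ^^ Suc n) (E v) = (E ^^ Suc (Suc n)) v" by (simp only: funpow_Suc_right o_apply)
  finally have *: "(E ^^ Suc (Suc n)) (F v) = F ((E ^^ Suc (Suc n)) v)
      + of_nat (Suc n) *\<^sub>C (E ^^ Suc n) (shift H (- of_nat n - 2) v) + (E ^^ Suc n) (H v)" .
  have "of_nat (Suc n) *\<^sub>C (E ^^ Suc n) (shift H (- of_nat n - 2) v) + (E ^^ Suc n) (H v)
     = (E ^^ Suc n) (of_nat (Suc n) *\<^sub>C shift H (- of_nat n - 2) v + H v)"
    by (simp only: Epow_lin)
  also have "of_nat (Suc n) *\<^sub>C shift H (- of_nat n - 2) v + H v = of_nat (Suc (Suc n)) *\<^sub>C shift H (- of_nat (Suc n)) v"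
    unfolding shift_def add.commute[of _ "H v"] by (rule affine_combination) (simp_all add: algebra_simps)
  finally show ?case unfolding * by (simp only: add.assoc Epow_lin)
qed

lemma gspace_E: "v \<in> gspace H a \<Longrightarrow> E v \<in> gspace H (a + 2)"
proof -
  have "(shift H 2 ^^ 1) e = 0" using triple by (simp add: shift_def sl2_triple_def)
  then have "e \<in> gspace H 2" unfolding gspace_def by blast
  moreover assume "v \<in> gspace H a"
  ultimately show ?thesis
    using gspace_derivation_bracket[OF lin_bracket bracket_leibniz, of e h 2 v a] by (simp add: add.commute)
qed

lemma gspace_F: "v \<in> gspace H a \<Longrightarrow> F v \<in> gspace H (a - 2)"
proof -
  have "(shift H (- 2) ^^ 1) f = 0" using triple by (simp add: shift_def sl2_triple_def)
  then have "f \<in> gspace H (- 2)" unfolding gspace_def by blast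
  moreover assume "v \<in> gspace H a"
  ultimately show ?thesis
    using gspace_derivation_bracket[OF lin_bracket bracket_leibniz, of f h "- 2" v a] by (simp add: add.commute)
qed

lemma finite_eigenvalues:
  assumes A: "lin A" shows "finite {a. gspace A a \<noteq> {0}}"
proof -
  obtain \<mu> B where B: "eigenbasis A \<mu> B" "span B = UNIV" using ex_eigenbasis[OF A] by blast
  have "a \<in> \<mu> ` B" if "gspace A a \<noteq> {0}" for a
  proof (rule ccontr)
    assume "a \<notin> \<mu> ` B"
    then have "{b\<in>B. \<mu> b = a} = {}" by auto
    then have "v \<in> gspace A a \<Longrightarrow> v = 0" for v using gspace_eigenvalue[OF A B, of v a] by (simp only: sum.empty)
    then show False using that subspace_0[OF gspace_subspace[OF A]] by blast
  qed
  then have "{a. gspace A a \<noteq> {0}} \<subseteq> \<mu> ` B" by blast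
  then show ?thesis using eigenbasis_finite[OF B(1)] finite_subset by blast
qed

text \<open>\<open>F\<close> lowers the eigenvalue of \<open>H\<close> by \<open>2\<close>, and there are only finitely many eigenvalues.\<close>

lemma F_nilpotent_on_gspace:
  assumes "v \<in> gspace H a" shows "\<exists>m. (F ^^ m) v = 0"
proof (rule ccontr)
  assume *: "\<not> ?thesis"
  have "(F ^^ m) v \<in> gspace H (a - 2 * of_nat m)" for m
  proof (induction m)
    case (Suc m)
    have "a - 2 * of_nat m - 2 = a - 2 * of_nat (Suc m)" by simp
    with gspace_F[OF Suc] show ?case by simp
  qed (use assms in simp)
  then have "range (\<lambda>m. a - 2 * of_nat m) \<subseteq> {a. gspace H a \<noteq> {0}}" using * by blast
  then have "finite (range (\<lambda>m. a - 2 * of_nat m))"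
    using finite_eigenvalues[OF lin_bracket] finite_subset by blast
  moreover have "inj (\<lambda>m::nat. a - 2 * of_nat m)" by (auto simp: inj_def)
  ultimately show False using finite_imageD infinite_UNIV_nat by blast
qed

text \<open>The operator \<open>H (H - 1) \<cdots> (H - (n - 1))\<close>.\<close>

primrec hprod :: "nat \<Rightarrow> 'g \<Rightarrow> 'g" where
  "hprod 0 v = v"
| "hprod (Suc n) v = hprod n (shift H (of_nat n) v)"

lemma E_shift: "E (shift H a v) = shift H (a + 2) (E v)"
  by (simp add: shift_def HE bracket_diff_right bracket_cscale_right cscale_add_left)

text \<open>If \<open>e v = 0\<close> then \<open>e f\<^sup>m v\<close> is a nonzero multiple of \<open>f\<^sup>m\<^sup>-\<^sup>1 (h - (m - 1)) v\<close>.\<close>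

lemma hprod_highest: "E v = 0 \<Longrightarrow> (F ^^ m) v = 0 \<Longrightarrow> hprod m v = 0"
proof (induction m arbitrary: v)
  case (Suc m)
  have "of_nat (Suc m) *\<^sub>C (F ^^ m) (shift H (of_nat m) v) = 0"
    using E_Fpow[of m v] Suc.prems by (simp only: bracket_zero_right Fpow_lin(4)) simp
  then have "(F ^^ m) (shift H (of_nat m) v) = 0" by (simp del: of_nat_Suc)
  moreover have "E (shift H (of_nat m) v) = 0"
    by (simp only: E_shift Suc.prems(1)) (simp add: shift_def)
  ultimately show ?case using Suc.IH by simp
qed simp

lemma hprod_gspace:
  assumes "v \<in> gspace H a" "hprod m v = 0"
  shows "v = 0 \<or> (\<exists>j<m. a = of_nat j \<and> shift H a v = 0)"
  using assms
proof (induction m arbitrary: v)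
  case (Suc m)
  let ?w = "shift H (of_nat m) v"
  have w: "?w \<in> gspace H a" using Suc.prems gspace_shift lin_bracket by blast
  with Suc.IH[of ?w] Suc.prems consider "?w = 0" | j where "j < m" "a = of_nat j" "shift H a ?w = 0" by auto
  then show ?case
  proof cases
    case 1
    show ?thesis
    proof (cases "a = of_nat m")
      case True
      then show ?thesis using 1 by auto
    next
      case False
      then show ?thesis using gspace_inj[OF lin_bracket Suc.prems(1) 1] by simp
    qed
  next
    case 2
    have "shift H (of_nat m) (shift H a v) = 0" using 2(3) shift_commute[OF lin_bracket] by metis
    moreover have "shift H a v \<in> gspace H a" using Suc.prems gspace_shift lin_bracket by blast
    ultimately have "shift H a v = 0" using 2 gspace_inj[OF lin_bracket, of "shift H a v" h a "of_nat m"] by simp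
    then show ?thesis using 2 less_SucI by blast
  qed
qed simp

text \<open>The product \<open>h (h - 1) \<cdots> (h - (m - 1))\<close> kills \<open>v\<close> for some \<open>m\<close>, and on a generalised eigenspace
  at most one of its factors fails to be injective.\<close>

lemma highest_weight:
  assumes "v \<in> gspace H a" "E v = 0"
  shows "shift H a v = 0" "v = 0 \<or> (\<exists>j. a = of_nat j)"
proof -
  obtain m where "(F ^^ m) v = 0" using F_nilpotent_on_gspace[OF assms(1)] by blast
  from hprod_gspace[OF assms(1) hprod_highest[OF assms(2) this]]
  show "shift H a v = 0" "v = 0 \<or> (\<exists>j. a = of_nat j)"
    using vp.linear_0[OF lin_shift[OF lin_bracket]] by auto
qed

text \<open>Let \<open>\<mu>\<close> be the weight of \<open>y\<close> and \<open>e\<^sup>n\<^sup>+\<^sup>1 y = 0\<close>.  The vector \<open>(f e - n (\<mu> + n + 1)) y\<close> is killed by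
  \<open>e\<^sup>n\<close>, so by induction it lies in the image of \<open>e\<close>.  Since \<open>e f y = f e y + \<mu> y\<close>, so does
  \<open>(n + 1) (\<mu> + n) y\<close>, and the factor is not zero.\<close>

lemma positive_weight_in_image:
  assumes "(E ^^ n) y = 0" "H y = of_nat (Suc m) *\<^sub>C y"
  shows "\<exists>z. H z = (of_nat (Suc m) - 2) *\<^sub>C z \<and> E z = y"
  using assms
proof (induction n arbitrary: y)
  case 0
  then show ?case by (intro exI[of _ 0]) auto
next
  case (Suc n)
  define \<mu> :: complex where "\<mu> = of_nat (Suc m)"
  have Hy: "H y = \<mu> *\<^sub>C y" using Suc.prems by (simp add: \<mu>_def)
  have HEy: "H (E y) = (\<mu> + 2) *\<^sub>C E y"
    by (simp add: HE Hy bracket_cscale_right cscale_add_left)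
  have HFy: "H (F y) = (\<mu> - 2) *\<^sub>C F y"
    by (simp add: HF Hy bracket_cscale_right scale_left_diff_distrib)
  define c where "c = of_nat n * (\<mu> + of_nat n + 1)"
  define y2 where "y2 = F (E y) - c *\<^sub>C y"
  have "(E ^^ n) (F (E y)) = c *\<^sub>C (E ^^ n) y"
  proof (cases n)
    case 0
    then show ?thesis using Suc.prems by (simp add: c_def)
  next
    case (Suc k)
    have "shift H (- of_nat k) (E y) = (\<mu> + of_nat n + 1) *\<^sub>C E y"
      by (simp add: shift_def HEy Suc algebra_simps cscale_add_left scale_left_diff_distrib)
    moreover have "(E ^^ Suc k) (E y) = 0" using Suc.prems Suc by (simp add: funpow_swap1)
    ultimately show ?thesis using Epow_F[of k "E y"]
      by (simp add: Suc c_def Epow_lin cscale_cscale funpow_swap1 del: of_nat_Suc)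
  qed
  then have "(E ^^ n) y2 = 0" by (simp add: y2_def Epow_lin)
  moreover have "H (F (E y)) = \<mu> *\<^sub>C F (E y)"
    by (simp add: HF HEy bracket_cscale_right cscale_add_left bracket_add_right)
  then have "H y2 = of_nat (Suc m) *\<^sub>C y2"
    by (simp add: y2_def bracket_diff_right bracket_cscale_right Hy scale_right_diff_distrib cscale_cscale
        mult.commute \<mu>_def[symmetric] del: of_nat_Suc)
  ultimately obtain z where z: "H z = (\<mu> - 2) *\<^sub>C z" "E z = y2"
    using Suc.IH[of y2] by (auto simp: \<mu>_def)
  have "of_nat (Suc n) * of_nat (Suc m + n) \<noteq> (0::complex)" by (metis mult_eq_0_iff of_nat_0_neq of_nat_eq_0_iff add_Suc Zero_neq_Suc)
  moreover have cm: "c + \<mu> = of_nat (Suc n) * of_nat (Suc m + n)" by (simp add: c_def \<mu>_def algebra_simps)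
  ultimately have nz: "c + \<mu> \<noteq> 0" by simp
  have "E (F y) - y2 = (c + \<mu>) *\<^sub>C y" by (simp add: EF Hy y2_def cscale_add_left)
  then have "E ((1 / (c + \<mu>)) *\<^sub>C (F y - z)) = y"
    using nz by (simp add: bracket_cscale_right bracket_diff_right z cscale_cscale cscale_one)
  moreover have "H ((1 / (c + \<mu>)) *\<^sub>C (F y - z)) = (\<mu> - 2) *\<^sub>C ((1 / (c + \<mu>)) *\<^sub>C (F y - z))"
    by (simp add: bracket_cscale_right bracket_diff_right z HFy scale_right_diff_distrib cscale_cscale mult.commute)
  ultimately show ?case unfolding \<mu>_def by blast
qed

text \<open>Induction on the least \<open>n\<close> with \<open>e\<^sup>n v = 0\<close>.  By induction \<open>(h - a) v\<close> is killed by \<open>e\<close>, and hence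
  vanishes unless \<open>a\<close> is a natural number.  In that case \<open>e v\<close> has positive weight, so that
  \<open>e v = e z\<close> with \<open>z\<close> of weight \<open>a\<close>, and \<open>v - z\<close> is covered by the case of vectors killed by \<open>e\<close>.\<close>

lemma weight_integral_diagonalizable:
  assumes "v \<in> gspace H a"
  shows "shift H a v = 0 \<and> (v = 0 \<or> a \<in> \<int>)"
proof -
  have "(E ^^ n) v = 0 \<Longrightarrow> shift H a v = 0 \<and> (v = 0 \<or> a \<in> \<int>)" for n
    using assms
  proof (induction n arbitrary: v a)
    case 0
    then show ?case by (simp add: shift_def)
  next
    case (Suc n)
    have u: "(E ^^ n) (E v) = 0" "E v \<in> gspace H (a + 2)"
      using Suc.prems gspace_E by (auto simp: funpow_swap1)
    note IH = Suc.IH[OF u]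
    have w: "shift H a v \<in> gspace H a" using Suc.prems gspace_shift lin_bracket by blast
    have Ew: "E (shift H a v) = 0" using IH by (simp add: E_shift)
    show ?case
    proof (cases "\<exists>j. a = of_nat j")
      case False
      then have "shift H a v = 0" using highest_weight(2)[OF w Ew] by blast
      moreover have "v = 0 \<or> a \<in> \<int>"
      proof (cases "E v = 0")
        case True
        then show ?thesis using highest_weight(2)[OF Suc.prems(2) True] False by blast
      next
        case nz: False
        then have "a + 2 - 2 \<in> \<int>" using IH by (intro Ints_diff) auto
        then show ?thesis by simp
      qed
      ultimately show ?thesis by blast
    next
      case True
      then obtain j where j: "a = of_nat j" by blast
      have "H (E v) = of_nat (Suc (Suc j)) *\<^sub>C E v" using IH by (simp add: shift_def j add.commute)
      from positive_weight_in_image[OF u(1) this] obtain z where z: "H z = a *\<^sub>C z" "E z = E v"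
        by (auto simp: j)
      have "(shift H a ^^ 1) z = 0" using z by (simp add: shift_def)
      then have "z \<in> gspace H a" unfolding gspace_def by blast
      then have "v - z \<in> gspace H a" using Suc.prems subspace_diff gspace_subspace[OF lin_bracket] by blast
      moreover have "E (v - z) = 0" using z by (simp add: bracket_diff_right)
      ultimately have "shift H a (v - z) = 0" by (rule highest_weight(1))
      then have "shift H a v = 0" using z by (simp add: shift_def bracket_diff_right scale_right_diff_distrib algebra_simps)
      then show ?thesis using j by simp
    qed
  qed
  moreover obtain n where "(E ^^ n) v = 0" using nilp unfolding ad_nilpotent_def by blast
  ultimately show ?thesis by blast
qed

lemma grading_gspace: "grading h k = gspace H (of_int k)"
proof
  show "grading h k \<subseteq> gspace H (of_int k)"
  proof
    fix x assume "x \<in> grading h k"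
    then have "(shift H (of_int k) ^^ 1) x = 0" by (simp add: grading_def shift_def)
    then show "x \<in> gspace H (of_int k)" unfolding gspace_def by blast
  qed
  show "gspace H (of_int k) \<subseteq> grading h k"
    using weight_integral_diagonalizable by (auto simp: grading_def shift_def)
qed

lemma grading_decomp:
  obtains K w where "finite K" "\<And>k. w k \<in> grading h k" "v = (\<Sum>k\<in>K. w k)"
proof -
  obtain F w where F: "finite F" "\<And>a. w a \<in> gspace H a" "v = (\<Sum>a\<in>F. w a)"
    using gspace_decomp[OF lin_bracket] by metis
  let ?K = "{k::int. of_int k \<in> F}"
  have inj: "inj (of_int :: int \<Rightarrow> complex)" by (simp add: inj_def)
  have "w a = 0" if "a \<in> F - of_int ` ?K" for a
    using weight_integral_diagonalizable[OF F(2)[of a]] that by (auto simp: Ints_def)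
  then have "v = (\<Sum>a\<in>of_int ` ?K. w a)"
    unfolding F(3) by (intro sum.mono_neutral_right) (use F(1) in auto)
  also have "\<dots> = (\<Sum>k\<in>?K. w (of_int k))"
    using inj by (subst sum.reindex) (auto simp: inj_def inj_on_def)
  finally have "v = (\<Sum>k\<in>?K. w (of_int k))" .
  moreover have "finite ?K" using finite_vimageI[OF F(1) inj] by (simp add: vimage_def)
  ultimately show ?thesis using that[of ?K "\<lambda>k. w (of_int k)"] F(2) grading_gspace by auto
qed

lemma grading_subspace: "subspace (grading h k)"
  unfolding grading_gspace by (rule gspace_subspace[OF lin_bracket])

lemma grading_bracket: "x \<in> grading h i \<Longrightarrow> y \<in> grading h j \<Longrightarrow> bracket x y \<in> grading h (i + j)"
  unfolding grading_gspace
  using gspace_derivation_bracket[OF lin_bracket bracket_leibniz, of x h _ y] by simp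

lemma grading_bounded: "\<exists>D::nat. \<forall>k. k < - int D \<longrightarrow> grading h k = {0}"
proof -
  have "finite ((of_int :: int \<Rightarrow> complex) -` {a. gspace H a \<noteq> {0}})"
    by (rule finite_vimageI[OF finite_eigenvalues[OF lin_bracket]]) (simp add: inj_def)
  then obtain M where M: "\<And>k. grading h k \<noteq> {0} \<Longrightarrow> M \<le> k"
    unfolding grading_gspace vimage_def
    by (metis (mono_tags, lifting) finite_has_minimal2 mem_Collect_eq bdd_below.unfold bdd_below_finite)
  show ?thesis by (rule exI[of _ "nat (- M)"]) (intro allI impI, rule ccontr, drule M, simp split: if_splits)
qed

lemma killing_grading:
  assumes "x \<in> grading h i" "y \<in> grading h j" "i + j \<noteq> 0" shows "killing_form x y = 0"
proof -
  have "of_int i * killing_form x y = killing_form (H x) y"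
    using assms(1) by (simp add: grading_def killing_sym[of _ y] killing_scale_right)
  also have "\<dots> = - killing_form (bracket x h) y"
    by (subst bracket_skew) (simp add: killing_sym[of _ y] killing_minus_right)
  also have "\<dots> = - (of_int j * killing_form x y)"
    using assms(2) by (simp add: grading_def killing_invariant killing_scale_right)
  finally have "of_int (i + j) * killing_form x y = 0" by (simp add: algebra_simps)
  with assms(3) show ?thesis by (simp only: mult_eq_0_iff of_int_eq_0_iff) simp
qed

lemma e_grading: "e \<in> grading h 2" and f_grading: "f \<in> grading h (- 2)"
  using triple by (auto simp: grading_def sl2_triple_def)

text \<open>The Killing form of \<open>h\<close> with itself is twice this value, and it is the sum of the squares of
  the eigenvalues of \<open>ad h\<close>, which are integers, one of them being \<open>2\<close>.\<close>

lemma killing_e_f_nonzero: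
  assumes "e \<noteq> 0" shows "killing_form e f \<noteq> 0"
proof -
  obtain \<mu> B where B: "eigenbasis H \<mu> B" "span B = UNIV" using ex_eigenbasis[OF lin_bracket] by blast
  have iB: "independent B" and fB: "finite B" using B eigenbasis_finite by (auto simp: eigenbasis_def)
  have Hb: "H b = \<mu> b *\<^sub>C b" "\<mu> b \<in> \<int>" if "b \<in> B" for b
  proof -
    have "b \<noteq> 0" using that iB dependent_zero by blast
    moreover have "b \<in> gspace H (\<mu> b)" using that B by (auto simp: eigenbasis_def)
    ultimately show "H b = \<mu> b *\<^sub>C b" "\<mu> b \<in> \<int>"
      using weight_integral_diagonalizable by (auto simp: shift_def)
  qed
  have "killing_form h h = (\<Sum>b\<in>B. representation B (H (H b)) b)"
    unfolding killing_form_def by (rule lie_trace_basis[OF iB B(2) lin_comp[OF lin_bracket lin_bracket]])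
  also have "\<dots> = (\<Sum>b\<in>B. (\<mu> b)\<^sup>2)"
    by (rule sum.cong)
      (auto simp: Hb bracket_cscale_right cscale_cscale representation_scale representation_basis iB B power2_eq_square)
  also have "\<dots> = of_real (\<Sum>b\<in>B. (Re (\<mu> b))\<^sup>2)"
  proof -
    have "of_real (Re (\<mu> b)) = \<mu> b" if "b \<in> B" for b using Hb(2)[OF that] by (auto elim!: Ints_cases)
    then show ?thesis unfolding of_real_sum of_real_power by simp
  qed
  finally have hh: "killing_form h h = of_real (\<Sum>b\<in>B. (Re (\<mu> b))\<^sup>2)" .
  have "{b\<in>B. \<mu> b = 2} \<noteq> {}"
  proof
    assume none: "{b\<in>B. \<mu> b = 2} = {}"
    have "e \<in> gspace H 2" using e_grading grading_gspace[of 2] by simp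
    then have "e = (\<Sum>b\<in>{b\<in>B. \<mu> b = 2}. representation B e b *\<^sub>C b)"
      by (rule gspace_eigenvalue[OF lin_bracket B])
    also have "\<dots> = 0" unfolding none by simp
    finally show False using assms by simp
  qed
  then obtain b where b: "b \<in> B" "\<mu> b = 2" by blast
  have "0 < (\<Sum>b\<in>B. (Re (\<mu> b))\<^sup>2)" using b fB by (intro sum_pos2[of _ b]) auto
  then have "killing_form h h \<noteq> 0" unfolding hh of_real_eq_0_iff by simp
  moreover have "killing_form h h = 2 * killing_form e f"
  proof -
    have "killing_form h h = killing_form e (bracket f h)"
      using triple killing_invariant[of e f h] by (simp add: sl2_triple_def)
    also have "bracket f h = 2 *\<^sub>C f" using triple bracket_skew[of f h] by (simp add: sl2_triple_def)
    finally show ?thesis by (simp add: killing_scale_right)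
  qed
  ultimately show ?thesis by auto
qed

lemma nilpotent_char_linear:
  "nilpotent_char e f (x + y) = nilpotent_char e f x + nilpotent_char e f y"
  "nilpotent_char e f (c *\<^sub>C x) = c * nilpotent_char e f x"
  by (simp_all add: nilpotent_char_def normalized_form_def killing_add_right killing_scale_right add_divide_distrib)

lemma nilpotent_char_grading: "x \<in> grading h k \<Longrightarrow> k \<noteq> - 2 \<Longrightarrow> nilpotent_char e f x = 0"
  using killing_grading[OF e_grading, of x k] by (simp add: nilpotent_char_def normalized_form_def)

text \<open>Up to a nonzero factor \<open>\<chi> [x, u]\<close> is the Killing form of \<open>[e, x]\<close> and \<open>u\<close>.  Here \<open>[e, x] \<noteq> 0\<close>
  because vectors killed by \<open>e\<close> have nonnegative weight, and the Killing form pairs the degree of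
  \<open>[e, x]\<close> only with its negative.\<close>

lemma char_pairing_nondegenerate:
  assumes ss: "semisimple_lie_algebra TYPE('g)" and "e \<noteq> 0"
    and x: "x \<in> grading h (- int d)" "x \<noteq> 0" and d: "d \<ge> 1"
  shows "\<exists>u\<in>grading h (int d - 2). nilpotent_char e f (bracket x u) \<noteq> 0"
proof -
  have xg: "x \<in> gspace H (- of_nat d)" using x(1) grading_gspace[of "- int d"] by simp
  have "E x \<noteq> 0"
  proof
    assume "E x = 0"
    from highest_weight(2)[OF xg this] x(2) obtain j where "- of_nat d = (of_nat j :: complex)" by blast
    then have "of_nat (d + j) = (0::complex)" by (simp add: algebra_simps neg_eq_iff_add_eq_0)
    with d show False by (simp only: of_nat_eq_0_iff)
  qed
  then obtain u where u: "killing_form (E x) u \<noteq> 0" using killing_nondegenerate[OF ss] by blast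
  obtain K w where K: "finite K" "\<And>k. w k \<in> grading h k" "u = (\<Sum>k\<in>K. w k)"
    using grading_decomp by metis
  with u obtain k where k: "killing_form (E x) (w k) \<noteq> 0" by (metis killing_sum_right sum.neutral)
  have "E x \<in> grading h (2 - int d)" using grading_bracket[OF e_grading x(1)] by simp
  with k have "k = int d - 2" using killing_grading[OF _ K(2)[of k]] by fastforce
  moreover have "nilpotent_char e f (bracket x (w k)) \<noteq> 0"
    using k killing_invariant[of e x "w k"] killing_e_f_nonzero[OF \<open>e \<noteq> 0\<close>]
    by (simp add: nilpotent_char_def normalized_form_def)
  ultimately show ?thesis using K(2) by metis
qed

end

section \<open>The enveloping algebra\<close>

lemma uea_gen_add: "uea_gen (x + y) = uea_gen x + uea_gen y"
proof (transfer)
  fix x y :: "'g::complex_lie_algebra"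
  show "fa_gen (x + y) - (fa_gen x + fa_gen y) \<in> uea_ideal"
    using uea_ideal_rel[OF uea_relations.intros(1)[of x y], of 1 1] by (simp add: algebra_simps)
qed

lemma uea_gen_scale: "uea_gen (c *\<^sub>C x) = uea_const c * uea_gen x"
proof (transfer)
  fix c and x :: "'g::complex_lie_algebra"
  show "fa_gen (c *\<^sub>C x) - fa_const c * fa_gen x \<in> uea_ideal"
    using uea_ideal_rel[OF uea_relations.intros(2)[of c x], of 1 1] by simp
qed

lemma uea_gen_commutator: "uea_gen x * uea_gen y - uea_gen y * uea_gen x = uea_gen (bracket x y)"
proof (transfer)
  fix x y :: "'g::complex_lie_algebra"
  show "fa_gen x * fa_gen y - fa_gen y * fa_gen x - fa_gen (bracket x y) \<in> uea_ideal"
    using uea_ideal_rel[OF uea_relations.intros(3)[of x y], of 1 1] by simp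
qed

lemma uea_const_add: "uea_const (c + d) = uea_const c + uea_const d"
  by transfer (simp add: fa_const_def single_add uea_ideal_zero)

lemma uea_const_mult: "uea_const (c * d) = uea_const c * uea_const d"
  by transfer (simp add: fa_const_def mult_single uea_ideal_zero)

lemma uea_const_one [simp]: "uea_const 1 = 1"
  by transfer (simp add: fa_const_def uea_ideal_zero)

lemma uea_const_zero [simp]: "uea_const 0 = 0"
  by transfer (simp add: fa_const_def uea_ideal_zero)

lemma uea_const_of_nat: "uea_const (of_nat n) = of_nat n"
  by (induction n) (simp_all add: uea_const_add)

lemma uea_gen_zero [simp]: "uea_gen 0 = 0"
  using uea_gen_add[of 0 0] by simp

lemma free_algebra_sum_words: "a = (\<Sum>w\<in>Poly_Mapping.keys a. Poly_Mapping.single w (Poly_Mapping.lookup a w))"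
  for a :: "'a \<Rightarrow>\<^sub>0 'b::comm_monoid_add"
proof (rule poly_mapping_eqI)
  fix k
  have "Poly_Mapping.lookup (\<Sum>w\<in>Poly_Mapping.keys a. Poly_Mapping.single w (Poly_Mapping.lookup a w)) k
     = (\<Sum>w\<in>Poly_Mapping.keys a. if w = k then Poly_Mapping.lookup a w else 0)"
    unfolding lookup_sum by (rule sum.cong) (auto simp: lookup_single)
  also have "\<dots> = Poly_Mapping.lookup a k" by (auto simp: in_keys_iff)
  finally show "Poly_Mapping.lookup a k = Poly_Mapping.lookup (\<Sum>w\<in>Poly_Mapping.keys a. Poly_Mapping.single w (Poly_Mapping.lookup a w)) k"
    by simp
qed

lemma uea_induct [case_names const add gen]:
  fixes u :: "'g::complex_lie_algebra uea"
  assumes const: "\<And>c. P (uea_const c)" and add: "\<And>u v. P u \<Longrightarrow> P v \<Longrightarrow> P (u + v)"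
    and gen: "\<And>x u. P u \<Longrightarrow> P (uea_gen x * u)"
  shows "P u"
proof -
  define \<pi> where "\<pi> = (abs_uea :: 'g free_algebra \<Rightarrow> 'g uea)"
  have \<pi>_add: "\<pi> (a + b) = \<pi> a + \<pi> b" for a b unfolding \<pi>_def by (rule plus_uea.abs_eq[symmetric])
  have \<pi>_mult: "\<pi> (a * b) = \<pi> a * \<pi> b" for a b unfolding \<pi>_def by (rule times_uea.abs_eq[symmetric])
  have \<pi>_zero: "\<pi> 0 = 0" unfolding \<pi>_def by (simp add: zero_uea.abs_eq)
  have w: "P (\<pi> (Poly_Mapping.single (Word xs) c))" for xs c
  proof (induction xs)
    case Nil
    then show ?case using const[of c] by (simp add: \<pi>_def uea_const.abs_eq fa_const_def zero_word_def)
  next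
    case (Cons x xs)
    have "Poly_Mapping.single (Word (x # xs)) c = fa_gen x * Poly_Mapping.single (Word xs) c"
      by (simp add: fa_gen_def mult_single plus_word_def)
    then have "\<pi> (Poly_Mapping.single (Word (x # xs)) c) = uea_gen x * \<pi> (Poly_Mapping.single (Word xs) c)"
      by (simp add: \<pi>_mult) (simp add: \<pi>_def uea_gen.abs_eq)
    then show ?case using gen[OF Cons] by simp
  qed
  have P0: "P 0" using const[of 0] by simp
  have "P (\<pi> (\<Sum>w\<in>W. Poly_Mapping.single w (k w)))" if "finite W" for W and k :: "'g word \<Rightarrow> complex"
    using that
  proof (induction W)
    case (insert v W)
    then show ?case using add w by (cases v) (simp add: \<pi>_add)
  qed (simp add: \<pi>_zero P0)
  then have all: "P (\<pi> a)" for a using free_algebra_sum_words[of a] finite_keys by metis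
  show ?thesis by (rule uea.abs_induct) (use all in \<open>simp add: \<pi>_def\<close>)
qed

lemma uea_const_central: "uea_const c * u = u * uea_const c"
proof (induction u rule: uea_induct)
  case (const d)
  show ?case by (simp add: uea_const_mult[symmetric] mult.commute)
next
  case (gen x u)
  have "uea_const c * uea_gen x = uea_gen x * uea_const c"
    by transfer (simp add: fa_const_def fa_gen_def mult_single uea_ideal_zero)
  with gen show ?case by (metis mult.assoc)
qed (simp add: algebra_simps)

lemma whit_ideal_left: "u \<in> whit_ideal \<chi> \<mm> \<Longrightarrow> v * u \<in> whit_ideal \<chi> \<mm>"
proof (induction rule: whit_ideal.induct)
  case (whit_ideal_gen x u)
  then show ?case using whit_ideal.whit_ideal_gen[of x \<mm> "v * u" \<chi>] by (simp add: mult.assoc)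
qed (auto simp: distrib_left intro: whit_ideal.intros)

lemma whit_ideal_minus: "u \<in> whit_ideal \<chi> \<mm> \<Longrightarrow> - u \<in> whit_ideal \<chi> \<mm>"
  using whit_ideal_left[of u \<chi> \<mm> "- 1"] by simp

lemma whit_ideal_diff: "u \<in> whit_ideal \<chi> \<mm> \<Longrightarrow> v \<in> whit_ideal \<chi> \<mm> \<Longrightarrow> u - v \<in> whit_ideal \<chi> \<mm>"
  using whit_ideal_add[OF _ whit_ideal_minus] by fastforce

section \<open>The depth filtration\<close>

text \<open>The data on which the algebraic argument depends: a grading \<open>G\<close> and the graded pieces \<open>M d\<close> of
  \<open>\<mm>\<close> in degree \<open>- d\<close>, where \<open>d \<ge> 1\<close>.  The Lagrangian subspace is \<open>M 1\<close>; from \<open>d = 2\<close> on the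
  pieces are full homogeneous components.\<close>

locale whittaker_pair = fd_lie Basis for Basis :: "'g::complex_lie_algebra set" +
  fixes \<chi> :: "'g \<Rightarrow> complex" and G :: "int \<Rightarrow> 'g set" and M :: "nat \<Rightarrow> 'g set" and D :: nat
  assumes chi_add: "\<chi> (x + y) = \<chi> x + \<chi> y" and chi_scale: "\<chi> (c *\<^sub>C x) = c * \<chi> x"
    and G_subspace: "cvs.subspace (G k)"
    and G_bracket: "x \<in> G i \<Longrightarrow> y \<in> G j \<Longrightarrow> bracket x y \<in> G (i + j)"
    and G_span: "cvs.span (\<Union>k. G k) = UNIV"
    and M_subspace: "cvs.subspace (M d)"
    and M_G: "M d \<subseteq> G (- int d)"
    and M_eq: "2 \<le> d \<Longrightarrow> M d = G (- int d)"
    and M_isotropic: "x \<in> M 1 \<Longrightarrow> y \<in> M 1 \<Longrightarrow> \<chi> (bracket x y) = 0"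
    and chi_G: "x \<in> G k \<Longrightarrow> k \<noteq> - 2 \<Longrightarrow> \<chi> x = 0"
    and nondeg: "1 \<le> d \<Longrightarrow> x \<in> M d \<Longrightarrow> x \<noteq> 0 \<Longrightarrow> \<exists>u\<in>G (int d - 2). \<chi> (bracket x u) \<noteq> 0"
    and M_bound: "D < d \<Longrightarrow> M d = {0}"
begin

definition \<mm> :: "'g set" where "\<mm> = span (\<Union>d\<in>{1..}. M d)"

abbreviation \<rho> :: "'g \<Rightarrow> 'g uea" where "\<rho> \<equiv> whit_shift \<chi>"
abbreviation gen :: "'g \<Rightarrow> 'g uea" where "gen \<equiv> uea_gen"
abbreviation I :: "'g uea set" where "I \<equiv> whit_ideal \<chi> \<mm>"

lemma chi_zero [simp]: "\<chi> 0 = 0" using chi_add[of 0 0] by simp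

lemma chi_diff: "\<chi> (x - y) = \<chi> x - \<chi> y"
  using chi_add[of "x - y" y] by simp

lemma rho_add: "\<rho> (x + y) = \<rho> x + \<rho> y"
  by (simp add: whit_shift_def uea_gen_add uea_const_add chi_add)

lemma rho_scale: "\<rho> (c *\<^sub>C x) = uea_const c * \<rho> x"
  by (simp add: whit_shift_def uea_gen_scale uea_const_mult chi_scale algebra_simps)

lemma rho_zero [simp]: "\<rho> 0 = 0" by (simp add: whit_shift_def)

lemma gen_rho: "gen x = \<rho> x + uea_const (\<chi> x)" by (simp add: whit_shift_def)

lemma rho_gen: "\<rho> x * gen y = gen y * \<rho> x + gen (bracket x y)"
  using uea_gen_commutator[of x y] uea_const_central[of "\<chi> x" "gen y"]
  by (simp add: whit_shift_def algebra_simps)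

lemma rho_rho: "\<rho> x * \<rho> y = \<rho> y * \<rho> x + gen (bracket x y)"
  using rho_gen[of x y] uea_const_central[of "\<chi> y" "\<rho> x"]
  by (simp add: gen_rho[of y] algebra_simps)

lemma M_bracket:
  assumes "x \<in> M a" "y \<in> M b" "1 \<le> a" "1 \<le> b"
  shows "bracket x y \<in> M (a + b)" "\<chi> (bracket x y) = 0"
proof -
  have *: "bracket x y \<in> G (- int (a + b))"
    using G_bracket[of x "- int a" y "- int b"] M_G assms by (simp add: subset_iff algebra_simps)
  then show "bracket x y \<in> M (a + b)" using M_eq[of "a + b"] assms by simp
  show "\<chi> (bracket x y) = 0"
  proof (cases "a + b = 2")
    case True
    then have "a = 1" "b = 1" using assms by auto
    then show ?thesis using M_isotropic assms by simp
  next
    case False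
    then have "- int (a + b) \<noteq> - 2" by presburger
    then show ?thesis using chi_G[OF *] by simp
  qed
qed

lemma rho_rho_M:
  assumes "x \<in> M a" "y \<in> M b" "1 \<le> a" "1 \<le> b"
  shows "\<rho> x * \<rho> y = \<rho> y * \<rho> x + \<rho> (bracket x y)"
  using rho_rho[of x y] M_bracket(2)[OF assms] by (simp add: whit_shift_def)

text \<open>The left ideal spanned by the products \<open>a (\<rho> x\<^sub>1) \<cdots> (\<rho> x\<^sub>r)\<close> with \<open>x\<^sub>i \<in> M d\<^sub>i\<close> and
  \<open>d\<^sub>1 + \<dots> + d\<^sub>r \<ge> n\<close>.\<close>

inductive J :: "nat \<Rightarrow> 'g uea \<Rightarrow> bool" where
  J_all: "J 0 u"
| J_zero: "J n 0"
| J_add: "J n a \<Longrightarrow> J n b \<Longrightarrow> J n (a + b)"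
| J_step: "J n a \<Longrightarrow> x \<in> M d \<Longrightarrow> 1 \<le> d \<Longrightarrow> J (n + d) (a * \<rho> x)"
| J_Suc: "J (Suc n) a \<Longrightarrow> J n a"

lemma J_antimono: "J n a \<Longrightarrow> m \<le> n \<Longrightarrow> J m a"
  by (rule inc_induct[of m n "\<lambda>k. J k a"]) (auto intro: J_Suc)

lemma J_left: "J n a \<Longrightarrow> J n (u * a)"
  by (induction rule: J.induct) (auto simp: distrib_left mult.assoc[symmetric] intro: J.intros)

lemma J_minus: "J n a \<Longrightarrow> J n (- a)" using J_left[of n a "- 1"] by simp

lemma J_diff: "J n a \<Longrightarrow> J n b \<Longrightarrow> J n (a - b)"
  using J_add[OF _ J_minus] by fastforce

lemma J_rho: "J n a \<Longrightarrow> x \<in> M d \<Longrightarrow> 1 \<le> d \<Longrightarrow> m \<le> n + d \<Longrightarrow> J m (a * \<rho> x)"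
  using J_antimono J_step by blast

text \<open>Moving a factor \<open>y\<close> of degree \<open>k\<close> to the left past the elements \<open>\<rho> x\<close> costs at most its Kazhdan
  degree \<open>k + 2\<close> in depth: each commutator \<open>[x, y]\<close> loses the depth of \<open>x\<close>, but has the degree of
  \<open>y\<close> lowered by the same amount.\<close>

lemma J_gen: "J n a \<Longrightarrow> y \<in> G k \<Longrightarrow> J (nat (int n - k - 2)) (a * gen y)"
proof (induction arbitrary: y k rule: J.induct)
  case (J_all u)
  show ?case
  proof (cases "k \<le> - 3")
    case True
    then have "gen y = \<rho> y" "y \<in> M (nat (- k))"
      using chi_G[OF J_all] M_eq[of "nat (- k)"] J_all by (auto simp: whit_shift_def)
    then show ?thesis using J_rho[OF J.J_all, of y "nat (- k)" _ u] True by simp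
  qed (simp add: J.J_all)
next
  case (J_zero n)
  then show ?case by (simp add: J.J_zero)
next
  case (J_add n a b)
  then show ?case by (simp add: distrib_right J.J_add)
next
  case (J_step n a x d)
  have "x \<in> G (- int d)" using J_step M_G by blast
  then have "bracket x y \<in> G (k - int d)" using G_bracket[OF _ J_step.prems] by fastforce
  from J_step.IH[OF this] have 2: "J (nat (int (n + d) - k - 2)) (a * gen (bracket x y))"
    by (simp add: algebra_simps)
  have 1: "J (nat (int (n + d) - k - 2)) (a * gen y * \<rho> x)"
    by (rule J_rho[OF J_step.IH[OF J_step.prems] J_step.hyps(2,3)]) auto
  have "a * \<rho> x * gen y = a * gen y * \<rho> x + a * gen (bracket x y)"
    using rho_gen[of x y] by (simp add: mult.assoc distrib_left)
  then show ?case using J.J_add[OF 1 2] by simp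
next
  case (J_Suc n a)
  show ?case by (rule J_antimono[OF J_Suc.IH[OF J_Suc.prems]]) auto
qed

lemma J_gen_shift: "J n a \<Longrightarrow> u \<in> G (int d - 2) \<Longrightarrow> J (n - d) (a * gen u)"
  by (rule J_antimono[OF J_gen]) auto

lemma J_const: "J n a \<Longrightarrow> J n (a * uea_const c)"
  using J_left[of n a "uea_const c"] by (simp add: uea_const_central)

lemma J_imp_I: "J n a \<Longrightarrow> 1 \<le> n \<Longrightarrow> a \<in> I"
proof (induction rule: J.induct)
  case (J_step n a x d)
  then have "x \<in> \<mm>" unfolding \<mm>_def by (intro span_base) auto
  then show ?case by (rule whit_ideal_gen)
qed (auto intro: whit_ideal.intros)

lemma M_subset_m: "x \<in> M d \<Longrightarrow> 1 \<le> d \<Longrightarrow> x \<in> \<mm>"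
  unfolding \<mm>_def by (intro span_base) auto

lemma J_rho_m: assumes "J n a" "x \<in> \<mm>" shows "J (Suc n) (a * \<rho> x)"
  using assms(2) unfolding \<mm>_def
proof (induction rule: span_induct_alt)
  case base
  show ?case by (simp add: J_zero)
next
  case (step c x y)
  then obtain d where d: "x \<in> M d" "1 \<le> d" by auto
  have "J (Suc n) (uea_const c * (a * \<rho> x))"
    by (rule J_left, rule J_rho[OF assms(1) d]) (use d in simp)
  moreover have "a * \<rho> (c *\<^sub>C x) = uea_const c * (a * \<rho> x)"
    by (metis rho_scale uea_const_central mult.assoc)
  ultimately have "J (Suc n) (a * \<rho> (c *\<^sub>C x))" by simp
  then show ?case using step by (simp add: rho_add distrib_left J_add)
qed

lemma I_iff_J: "a \<in> I \<longleftrightarrow> J 1 a"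
proof
  assume "a \<in> I"
  then show "J 1 a"
    by (induction rule: whit_ideal.induct) (auto intro: J_zero J_add J_rho_m[OF J_all, simplified])
qed (simp add: J_imp_I)

lemma J_rho_power: "J n a \<Longrightarrow> x \<in> M d \<Longrightarrow> 1 \<le> d \<Longrightarrow> J (n + r * d) (a * \<rho> x ^ r)"
proof (induction r)
  case (Suc r)
  have "J (n + r * d + d) (a * \<rho> x ^ r * \<rho> x)" by (rule J_step) (use Suc in auto)
  then show ?case by (simp add: mult.assoc power_commutes add.commute add.left_commute)
qed simp

section \<open>Construction of the projectors\<close>

text \<open>On a module let \<open>F\<^sub>n\<close> be the subspace killed by \<open>J (n + 1)\<close>.  Then \<open>L n d N\<close> kills those \<open>v\<close> in
  \<open>F\<^sub>n\<close> for which \<open>\<rho> x v\<close> lies one step deeper in the filtration than expected, for all \<open>x\<close> of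
  depth greater than \<open>d\<close> and for all \<open>x\<close> in the subspace \<open>N\<close> of \<open>M d\<close>.  Lowering \<open>d\<close> and enlarging
  \<open>N\<close> interpolates between \<open>J (n + 1)\<close> and \<open>J n\<close>.\<close>

inductive L :: "nat \<Rightarrow> nat \<Rightarrow> 'g set \<Rightarrow> 'g uea \<Rightarrow> bool" for n d N where
  L_J: "J (Suc n) a \<Longrightarrow> L n d N a"
| L_deep: "J (n - c) a \<Longrightarrow> x \<in> M c \<Longrightarrow> d < c \<Longrightarrow> L n d N (a * \<rho> x)"
| L_top: "J (n - d) a \<Longrightarrow> x \<in> N \<Longrightarrow> L n d N (a * \<rho> x)"
| L_add: "L n d N a \<Longrightarrow> L n d N b \<Longrightarrow> L n d N (a + b)"

lemma L_left: "L n d N a \<Longrightarrow> L n d N (u * a)"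
  by (induction rule: L.induct) (auto simp: distrib_left mult.assoc[symmetric] intro: L.intros J_left)

lemma L_minus: "L n d N a \<Longrightarrow> L n d N (- a)" using L_left[of n d N a "- 1"] by simp

lemma L_diff: "L n d N a \<Longrightarrow> L n d N b \<Longrightarrow> L n d N (a - b)"
  using L_add[OF _ L_minus] by fastforce

lemma L_const: "L n d N a \<Longrightarrow> L n d N (a * uea_const c)"
  using L_left[of n d N a "uea_const c"] by (simp add: uea_const_central)

text \<open>With respect to the filtration \<open>x\<close> acts like the derivative by \<open>u\<close>, which makes \<open>u (\<rho> x)\<close> an Euler
  operator.  The elements \<open>y\<close> defining \<open>L\<close> commute with \<open>u\<close> up to terms of greater depth, because
  \<open>\<chi> [y, u] = 0\<close>, and with \<open>\<rho> x\<close> up to the deeper element \<open>\<rho> [y, x]\<close>.\<close>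

lemma L_right_euler:
  assumes N: "N \<subseteq> M d" "\<And>y. y \<in> N \<Longrightarrow> \<chi> (bracket y u) = 0" and d: "1 \<le> d"
    and x: "x \<in> M d" and u: "u \<in> G (int d - 2)"
    and a: "L n d N a"
  shows "L n d N (a * gen u * \<rho> x)"
proof -
  have main: "L n d N (a * \<rho> y * gen u * \<rho> x)"
    if a: "J (n - c) a" and y: "y \<in> M c" and c: "d \<le> c" and chi: "\<chi> (bracket y u) = 0"
      and cl: "\<And>b. J (n - c) b \<Longrightarrow> L n d N (b * \<rho> y)" for a y c
  proof -
    have c1: "1 \<le> c" using c d by simp
    define b where "b = a * gen u"
    have b: "J (n - c - d) b" using J_gen_shift[OF a u] by (simp add: b_def)
    have "J (n - c) (b * \<rho> x)" by (rule J_rho[OF b x d]) auto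
    then have 1: "L n d N (b * \<rho> x * \<rho> y)" by (rule cl)
    have yx: "bracket y x \<in> M (c + d)" by (rule M_bracket[OF y x c1 d])
    have 2: "L n d N (b * \<rho> (bracket y x))"
      by (rule L_deep[OF _ yx]) (use b c1 d in \<open>auto simp: diff_diff_left\<close>)
    define z where "z = bracket y u"
    have "y \<in> G (- int c)" using y M_G by blast
    then have "z \<in> G (- int (c + 2 - d))"
      using G_bracket[OF _ u, of y "- int c"] c by (simp add: z_def algebra_simps)
    then have z: "z \<in> M (c + 2 - d)" using M_eq[of "c + 2 - d"] c by simp
    have "J (n - c + (c + 2 - d)) (a * \<rho> z)" by (rule J_step[OF a z]) (use c in simp)
    then have "J (Suc n) (a * \<rho> z * \<rho> x)" by (rule J_rho[OF _ x d]) (use c in simp)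
    then have 3: "L n d N (a * \<rho> z * \<rho> x)" by (rule L_J)
    have "a * \<rho> y * gen u * \<rho> x = a * (gen u * \<rho> y + gen z) * \<rho> x"
      by (simp add: rho_gen z_def mult.assoc)
    also have "\<dots> = b * (\<rho> y * \<rho> x) + a * \<rho> z * \<rho> x"
      using chi by (simp add: b_def z_def gen_rho[of "bracket y u"] distrib_left distrib_right mult.assoc)
    also have "\<dots> = b * \<rho> x * \<rho> y + b * \<rho> (bracket y x) + a * \<rho> z * \<rho> x"
      by (simp add: rho_rho_M[OF y x c1 d] distrib_left mult.assoc)
    finally show ?thesis using L_add[OF L_add[OF 1 2] 3] by simp
  qed
  show ?thesis using a
  proof (induction rule: L.induct)
    case (L_J a)
    have "J (Suc n - d) (a * gen u)" using J_gen_shift[OF L_J u] by simp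
    then have "J (Suc n) (a * gen u * \<rho> x)" by (rule J_rho[OF _ x d]) simp
    then show ?case by (rule L.L_J)
  next
    case (L_deep c a y)
    have y: "y \<in> G (- int c)" using L_deep M_G by blast
    have "\<chi> (bracket y u) = 0" by (rule chi_G[OF G_bracket[OF y u]]) (use L_deep in simp)
    then show ?case using L_deep by (intro main[of c]) (auto intro: L.L_deep)
  next
    case (L_top a y)
    then show ?case using N by (intro main[of d]) (auto intro: L.L_top)
  next
    case (L_add a b)
    then show ?case by (simp add: distrib_right L.L_add)
  qed
qed

text \<open>The product \<open>(r - t) (r + 1 - t) \<cdots> (r + k - 1 - t)\<close>.\<close>

primrec eprod :: "'g uea \<Rightarrow> nat \<Rightarrow> nat \<Rightarrow> 'g uea" where
  "eprod t r 0 = 1"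
| "eprod t r (Suc k) = (of_nat r - t) * eprod t (Suc r) k"

lemma eprod_const:
  assumes "x \<in> M d" "1 \<le> d" "1 \<le> r"
  shows "\<exists>c. c \<noteq> 0 \<and> J 1 (eprod (gen u * \<rho> x) r k - uea_const c)"
  using assms(3)
proof (induction k arbitrary: r)
  case 0
  show ?case by (rule exI[of _ 1]) (simp add: J_zero)
next
  case (Suc k)
  then obtain c where c: "c \<noteq> 0" "J 1 (eprod (gen u * \<rho> x) (Suc r) k - uea_const c)"
    using Suc.IH[of "Suc r"] by auto
  let ?q = "of_nat r - gen u * \<rho> x"
  have "J 1 (gen u * \<rho> x)" by (rule J_rho[OF J_all assms(1,2)]) (use assms in simp)
  then have "J 1 (?q * (eprod (gen u * \<rho> x) (Suc r) k - uea_const c) - gen u * \<rho> x * uea_const c)"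
    by (intro J_diff J_left[OF c(2)] J_const)
  also have "?q * (eprod (gen u * \<rho> x) (Suc r) k - uea_const c) - gen u * \<rho> x * uea_const c
      = eprod (gen u * \<rho> x) r (Suc k) - uea_const (of_nat r * c)"
    unfolding uea_const_mult uea_const_of_nat by (simp add: algebra_simps)
  finally have "J 1 (eprod (gen u * \<rho> x) r (Suc k) - uea_const (of_nat r * c))" .
  moreover have "of_nat r * c \<noteq> 0" using c Suc.prems by simp
  ultimately show ?case by blast
qed

text \<open>Since \<open>[x, u]\<close> is \<open>1\<close> up to an element of depth \<open>2\<close>, the commutator of \<open>(\<rho> x)\<^sup>r\<close> and \<open>u\<close> is
  \<open>r (\<rho> x)\<^sup>r\<^sup>-\<^sup>1\<close> up to terms of greater depth.\<close>

lemma commutator_power: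
  assumes x: "x \<in> M d" "1 \<le> d" and u: "u \<in> G (int d - 2)" and xu: "\<chi> (bracket x u) = 1"
  shows "J j a \<Longrightarrow> J (j + r * d + 2) (a * (\<rho> x ^ r * gen u - gen u * \<rho> x ^ r - of_nat r * \<rho> x ^ (r - 1)) * \<rho> x)"
proof (induction r arbitrary: j a)
  case 0
  then show ?case by (simp add: J_zero)
next
  case (Suc r)
  define z where "z = bracket x u"
  have "x \<in> G (- int d)" using x M_G by blast
  then have "z \<in> G (- int 2)" using G_bracket[OF _ u] by (fastforce simp: z_def)
  then have z: "z \<in> M 2" using M_eq[of 2] by simp
  have gz: "gen z = \<rho> z + 1" using xu by (simp add: gen_rho z_def)
  define Er where "Er = \<rho> x ^ r * gen u - gen u * \<rho> x ^ r - of_nat r * \<rho> x ^ (r - 1)"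
  have "\<rho> x * (of_nat r * \<rho> x ^ (r - 1)) = of_nat r * (\<rho> x * \<rho> x ^ (r - 1))"
    using mult_of_nat_commute[of r "\<rho> x"] by (metis mult.assoc)
  also have "\<dots> = of_nat r * \<rho> x ^ r" by (cases r) simp_all
  finally have xr: "\<rho> x * (of_nat r * \<rho> x ^ (r - 1)) = of_nat r * \<rho> x ^ r" .
  have e: "\<rho> x ^ Suc r * gen u - gen u * \<rho> x ^ Suc r - of_nat (Suc r) * \<rho> x ^ (Suc r - 1)
     = \<rho> x * Er + (\<rho> x * gen u - gen u * \<rho> x - 1) * \<rho> x ^ r"
    using xr by (simp add: Er_def algebra_simps)
  also have "\<rho> x * gen u - gen u * \<rho> x - 1 = \<rho> z"
    using rho_gen[of x u] gz by (simp add: z_def)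
  finally have eq: "a * (\<rho> x ^ Suc r * gen u - gen u * \<rho> x ^ Suc r - of_nat (Suc r) * \<rho> x ^ (Suc r - 1)) * \<rho> x
     = a * \<rho> x * Er * \<rho> x + a * \<rho> z * \<rho> x ^ Suc r"
    by (simp add: distrib_left distrib_right mult.assoc power_commutes)
  have "J (j + d + r * d + 2) (a * \<rho> x * Er * \<rho> x)"
    unfolding Er_def by (rule Suc.IH) (rule J_step[OF Suc.prems x])
  moreover have "J (j + 2 + Suc r * d) (a * \<rho> z * \<rho> x ^ Suc r)"
    by (rule J_rho_power[OF J_step[OF Suc.prems z] x]) simp
  ultimately show ?case unfolding eq by (intro J_add) (simp_all add: algebra_simps)
qed

lemma L_right_eprod:
  assumes N: "N \<subseteq> M d" "\<And>y. y \<in> N \<Longrightarrow> \<chi> (bracket y u) = 0" and d: "1 \<le> d"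
    and x: "x \<in> M d" and u: "u \<in> G (int d - 2)"
  shows "L n d N b \<Longrightarrow> L n d N (b * eprod (gen u * \<rho> x) s m)"
proof (induction m arbitrary: b s)
  case (Suc m)
  have "L n d N (b * uea_const (of_nat s) - b * gen u * \<rho> x)"
    by (intro L_diff L_const Suc.prems L_right_euler[OF N d x u])
  then have "L n d N ((b * (of_nat s - gen u * \<rho> x)) * eprod (gen u * \<rho> x) (Suc s) m)"
    by (intro Suc.IH) (simp add: uea_const_of_nat algebra_simps)
  then show ?case by (simp add: mult.assoc)
qed simp

text \<open>Kashiwara's computation: modulo \<open>L\<close> one has \<open>(\<rho> x)\<^sup>r (r - u (\<rho> x)) = - u (\<rho> x)\<^sup>r\<^sup>+\<^sup>1\<close>.  So every
  factor of the product raises the power of \<open>\<rho> x\<close>, until it exceeds \<open>n\<close> and lies in \<open>J (n + 1)\<close>.\<close>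

lemma L_eprod_chain:
  assumes N: "N \<subseteq> M d" "\<And>y. y \<in> N \<Longrightarrow> \<chi> (bracket y u) = 0" and d: "1 \<le> d"
    and x: "x \<in> M d" and u: "u \<in> G (int d - 2)" and xu: "\<chi> (bracket x u) = 1"
  shows "J j a \<Longrightarrow> n \<le> j + r * d \<Longrightarrow> 1 \<le> r \<Longrightarrow> r + k = Suc n \<Longrightarrow> L n d N (a * \<rho> x ^ r * eprod (gen u * \<rho> x) r k)"
proof (induction k arbitrary: r j a)
  case 0
  have "J (j + r * d) (a * \<rho> x ^ r)" by (rule J_rho_power[OF 0(1) x d])
  moreover have "r * 1 \<le> r * d" using d by (intro mult_le_mono2)
  then have "Suc n \<le> j + r * d" using 0(4) by linarith
  ultimately show ?case using J_antimono by (auto intro: L_J)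
next
  case (Suc k)
  let ?P = "eprod (gen u * \<rho> x) (Suc r) k"
  define Er where "Er = \<rho> x ^ r * gen u - gen u * \<rho> x ^ r - of_nat r * \<rho> x ^ (r - 1)"
  have stable: "L n d N (b * eprod (gen u * \<rho> x) s m)" if "L n d N b" for b s m
    by (rule L_right_eprod[OF N d x u that])
  have "J (j + r * d + 2) (a * Er * \<rho> x)" unfolding Er_def by (rule commutator_power[OF x d u xu Suc.prems(1)])
  then have "J (Suc n) (a * Er * \<rho> x)" by (rule J_antimono) (use Suc.prems in simp)
  then have "L n d N (a * Er * \<rho> x)" by (rule L_J)
  then have 1: "L n d N (a * Er * \<rho> x * ?P)" by (rule stable)
  have "J (j - d) (a * gen u)" using J_gen_shift[OF Suc.prems(1) u] by simp
  then have 2: "L n d N (a * gen u * \<rho> x ^ Suc r * ?P)"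
    by (rule Suc.IH) (use Suc.prems in auto)
  have rr: "\<rho> x ^ (r - 1) * \<rho> x = \<rho> x ^ r" using Suc.prems(3) by (cases r) (auto simp: power_commutes)
  have "Er * \<rho> x = \<rho> x ^ r * gen u * \<rho> x - gen u * \<rho> x ^ Suc r - of_nat r * \<rho> x ^ r"
    by (simp add: Er_def left_diff_distrib mult.assoc rr[unfolded One_nat_def] power_Suc2 del: power_Suc)
  then have "\<rho> x ^ r * (of_nat r - gen u * \<rho> x) = - (Er * \<rho> x) - gen u * \<rho> x ^ Suc r"
    by (simp add: right_diff_distrib mult.assoc mult_of_nat_commute)
  then have "a * (\<rho> x ^ r * (of_nat r - gen u * \<rho> x)) * ?P = - (a * Er * \<rho> x * ?P) - a * gen u * \<rho> x ^ Suc r * ?P"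
    by (simp add: right_diff_distrib left_diff_distrib mult.assoc)
  then show ?case using L_diff[OF L_minus[OF 1] 2] by (simp add: mult.assoc)
qed

text \<open>Induction on the depth, downwards, and on the dimension of \<open>N\<close>.  For \<open>N = 0\<close> pass to the next
  depth.  Otherwise take \<open>x \<in> N\<close> and \<open>u\<close> with \<open>\<chi> [x, u] = 1\<close>.  The normalised Euler product for \<open>u\<close>
  and \<open>x\<close> multiplies \<open>L\<close> for \<open>N\<close> into \<open>L\<close> for the kernel of \<open>\<chi> [_, u]\<close> in \<open>N\<close>.\<close>

lemma ex_projector_step:
  assumes "1 \<le> d" "subspace N" "N \<subseteq> M d"
  shows "\<exists>R. J 1 (R - 1) \<and> (\<forall>a. L n d N a \<longrightarrow> J (Suc n) (a * R))"
  using assms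
proof (induction "Suc D - d" arbitrary: d N rule: less_induct)
  case (less d)
  note outer = less.hyps
  from less.prems show ?case
  proof (induction "dim N" arbitrary: N rule: less_induct)
    case (less N)
    show ?case
    proof (cases "N = {0}")
      case N0: True
      show ?thesis
      proof (cases "D < d")
        case True
        have "J (Suc n) a" if "L n d N a" for a
          using that by (induction rule: L.induct) (use True N0 M_bound in \<open>auto intro: J_zero J_add\<close>)
        then show ?thesis by (intro exI[of _ 1]) (auto simp: J_zero)
      next
        case False
        have "\<exists>R. J 1 (R - 1) \<and> (\<forall>a. L n (Suc d) (M (Suc d)) a \<longrightarrow> J (Suc n) (a * R))"
          by (rule outer) (use False M_subspace in auto)
        moreover have "L n (Suc d) (M (Suc d)) a" if "L n d N a" for a
          using that
        proof (induction rule: L.induct)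
          case (L_deep c a x)
          then show ?case by (cases "c = Suc d") (auto intro: L.intros)
        qed (use N0 in \<open>auto intro: L.intros J_zero\<close>)
        ultimately show ?thesis by blast
      qed
    next
      case False
      have "0 \<in> N" using less.prems subspace_0 by blast
      with False obtain x where x: "x \<in> N" "x \<noteq> 0" by blast
      then have xM: "x \<in> M d" using less.prems by blast
      obtain u' where u': "u' \<in> G (int d - 2)" "\<chi> (bracket x u') \<noteq> 0"
        using nondeg[OF less.prems(1) xM x(2)] by blast
      define u where "u = (1 / \<chi> (bracket x u')) *\<^sub>C u'"
      have u: "u \<in> G (int d - 2)" unfolding u_def using subspace_scale[OF G_subspace u'(1)] .
      have xu: "\<chi> (bracket x u) = 1" using u'(2) by (simp add: u_def bracket_cscale_right chi_scale)
      define N1 where "N1 = {y\<in>N. \<chi> (bracket y u) = 0}"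
      have sN1: "subspace N1"
        using less.prems(2) by (auto simp: N1_def subspace_def bracket_add_left bracket_cscale_left chi_add chi_scale)
      have N1: "N1 \<subseteq> M d" "\<And>y. y \<in> N1 \<Longrightarrow> \<chi> (bracket y u) = 0" using less.prems by (auto simp: N1_def)
      have "x \<notin> N1" using xu by (simp add: N1_def)
      then have "span N1 \<subset> span N" using x sN1 less.prems(2) by (metis N1_def psubsetI span_eq_iff mem_Collect_eq subsetI)
      then have "dim N1 < dim N" by (rule dim_psubset)
      then obtain R where R: "J 1 (R - 1)" "\<And>a. L n d N1 a \<Longrightarrow> J (Suc n) (a * R)"
        using less.hyps[OF _ less.prems(1) sN1 N1(1)] by blast
      let ?P = "eprod (gen u * \<rho> x) 1 n"
      obtain c where c: "c \<noteq> 0" "J 1 (?P - uea_const c)" using eprod_const[OF xM less.prems(1)] by blast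
      have P: "L n d N1 (a * ?P)" if "L n d N a" for a
      proof -
        have stable: "L n d N1 (b * eprod (gen u * \<rho> x) s m)" if "L n d N1 b" for b s m
          by (rule L_right_eprod[OF N1 less.prems(1) xM u that])
        show ?thesis using that
        proof (induction rule: L.induct)
          case (L_top a y)
          define t where "t = \<chi> (bracket y u)"
          have "\<chi> (bracket (y - t *\<^sub>C x) u) = 0"
            by (simp add: bracket_diff_left bracket_cscale_left chi_diff chi_scale xu t_def)
          moreover have "y - t *\<^sub>C x \<in> N" using less.prems(2) L_top x subspace_diff subspace_scale by blast
          ultimately have "y - t *\<^sub>C x \<in> N1" by (simp add: N1_def)
          then have "L n d N1 (a * \<rho> (y - t *\<^sub>C x))" using L_top(1) by (rule L.L_top[rotated])
          then have 1: "L n d N1 (a * \<rho> (y - t *\<^sub>C x) * ?P)" by (rule stable)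
          have "L n d N1 (a * uea_const t * \<rho> x ^ 1 * ?P)"
            by (rule L_eprod_chain[OF N1 less.prems(1) xM u xu J_const[OF L_top(1)]]) auto
          then have 2: "L n d N1 (a * \<rho> (t *\<^sub>C x) * ?P)" by (simp add: rho_scale mult.assoc)
          have "\<rho> y = \<rho> (y - t *\<^sub>C x) + \<rho> (t *\<^sub>C x)" by (simp add: rho_add[symmetric])
          then show ?case using L_add[OF 1 2] by (simp add: distrib_left distrib_right)
        next
          case (L_add a b)
          then show ?case by (simp add: distrib_right L.L_add)
        qed (auto intro!: stable intro: L.intros)
      qed
      \<comment> \<open>The constant makes the Euler product congruent to \<open>1\<close> modulo \<open>I\<close>.\<close>
      let ?R = "uea_const (1 / c) * ?P * R"
      have "J 1 (uea_const (1 / c) * ?P * (R - 1) + uea_const (1 / c) * (?P - uea_const c))"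
        by (intro J_add J_left R c)
      then have "J 1 (?R - 1)" using c(1)
        by (simp add: right_diff_distrib uea_const_mult[symmetric] mult.assoc)
      moreover have "J (Suc n) (a * ?R)" if "L n d N a" for a
      proof -
        have "J (Suc n) (a * uea_const (1 / c) * ?P * R)" by (intro R P L_const that)
        then show ?thesis by (simp add: mult.assoc)
      qed
      ultimately show ?thesis by blast
    qed
  qed
qed

lemma J_imp_L: "J m a \<Longrightarrow> n \<le> m \<Longrightarrow> 1 \<le> n \<Longrightarrow> L n 1 (M 1) a"
proof (induction rule: J.induct)
  case (J_step m a x d)
  have "J (n - d) a" by (rule J_antimono[OF J_step.hyps(1)]) (use J_step in simp)
  then show ?case using J_step by (cases "d = 1") (auto intro: L.intros)
qed (auto intro: L.intros J.intros)

text \<open>The element \<open>\<pi>\<close> is a product \<open>R\<^sub>1 R\<^sub>2 \<cdots> R\<^sub>n\<close> of elements of \<open>1 + I\<close> with \<open>J k R\<^sub>k\<close> contained in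
  \<open>J (k + 1)\<close>.\<close>

theorem ex_whittaker_projector: "\<exists>\<pi>. \<pi> - 1 \<in> I \<and> (\<forall>a\<in>I. J n (a * \<pi>))"
proof -
  have "\<exists>\<pi>. J 1 (\<pi> - 1) \<and> (\<forall>a. J 1 a \<longrightarrow> J (Suc n) (a * \<pi>))"
  proof (induction n)
    case 0
    show ?case by (intro exI[of _ 1]) (simp add: J_zero)
  next
    case (Suc n)
    then obtain \<pi> where \<pi>: "J 1 (\<pi> - 1)" "\<And>a. J 1 a \<Longrightarrow> J (Suc n) (a * \<pi>)" by blast
    obtain R where R: "J 1 (R - 1)" "\<And>a. L (Suc n) 1 (M 1) a \<Longrightarrow> J (Suc (Suc n)) (a * R)"
      using ex_projector_step[of 1 "M 1" "Suc n"] M_subspace by auto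
    have "J 1 (\<pi> * (R - 1) + (\<pi> - 1))" by (intro J_add J_left R \<pi>)
    then have "J 1 (\<pi> * R - 1)" by (simp add: algebra_simps)
    moreover have "J (Suc (Suc n)) (a * (\<pi> * R))" if "J 1 a" for a
      using R(2)[OF J_imp_L[OF \<pi>(2)[OF that]]] by (simp add: mult.assoc)
    ultimately show ?case by blast
  qed
  then obtain \<pi> where "J 1 (\<pi> - 1)" "\<And>a. J 1 a \<Longrightarrow> J (Suc n) (a * \<pi>)" by blast
  then show ?thesis by (intro exI[of _ \<pi>]) (auto simp: I_iff_J intro: J_Suc)
qed

text \<open>The number \<open>k\<close> bounds the Kazhdan degree of \<open>u\<close>.  In particular \<open>u\<close> times a vector killed by
  some \<open>J n\<close> is again such a vector.\<close>

lemma J_absorb: "\<exists>k. \<forall>n a. J (n + k) a \<longrightarrow> J n (a * u)"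
proof (induction u rule: uea_induct)
  case (const c)
  show ?case by (rule exI[of _ 0]) (simp add: J_const)
next
  case (add u v)
  then obtain k l where "\<And>n a. J (n + k) a \<Longrightarrow> J n (a * u)" "\<And>n a. J (n + l) a \<Longrightarrow> J n (a * v)" by blast
  then have "\<forall>n a. J (n + max k l) a \<longrightarrow> J n (a * (u + v))"
    by (metis (no_types) J_add J_antimono add_left_mono distrib_left max.cobounded1 max.cobounded2)
  then show ?case by blast
next
  case (gen x u)
  then obtain k where k: "\<And>n a. J (n + k) a \<Longrightarrow> J n (a * u)" by blast
  have "x \<in> span (\<Union>k. G k)" using G_span by simp
  then have "\<exists>l. \<forall>n a. J (n + l) a \<longrightarrow> J n (a * gen x)"
  proof (induction rule: span_induct_alt)
    case base
    show ?case by (simp add: J_zero)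
  next
    case (step c x y)
    then obtain i l where i: "x \<in> G i" and l: "\<And>n a. J (n + l) a \<Longrightarrow> J n (a * gen y)" by blast
    have 1: "J n (a * gen (c *\<^sub>C x))" if "J (n + nat (i + 2)) a" for n a
    proof -
      have "J (nat (int (n + nat (i + 2)) - i - 2)) (a * uea_const c * gen x)"
        by (rule J_gen[OF J_const[OF that] i])
      then have "J n (a * uea_const c * gen x)" by (rule J_antimono) linarith
      then show ?thesis by (simp add: uea_gen_scale mult.assoc)
    qed
    have "J n (a * gen (c *\<^sub>C x + y))" if "J (n + max l (nat (i + 2))) a" for n a
      unfolding uea_gen_add distrib_left
      by (intro J_add 1 l) (rule J_antimono[OF that], simp)+
    then show ?case by blast
  qed
  then obtain l where l: "\<And>n a. J (n + l) a \<Longrightarrow> J n (a * gen x)" by blast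
  have "J n (a * (gen x * u))" if "J (n + (k + l)) a" for n a
    using k[OF l[of "n + k" a]] that by (simp add: mult.assoc add.assoc)
  then show ?case by blast
qed

end

section \<open>Additive cosets\<close>

text \<open>The elements of \<open>Q\<close> and of \<open>H\<close>, and those of a tensor product, are cosets of this kind.\<close>

definition acoset :: "'a::ab_group_add set \<Rightarrow> 'a \<Rightarrow> 'a set" where
  "acoset K c = {h + c | h. h \<in> K}"

definition add_subgroup :: "'a::ab_group_add set \<Rightarrow> bool" where
  "add_subgroup K \<longleftrightarrow> 0 \<in> K \<and> (\<forall>a\<in>K. \<forall>b\<in>K. a - b \<in> K)"

lemma add_subgroupD:
  assumes "add_subgroup K"
  shows "0 \<in> K" "a \<in> K \<Longrightarrow> b \<in> K \<Longrightarrow> a - b \<in> K" "a \<in> K \<Longrightarrow> - a \<in> K" "a \<in> K \<Longrightarrow> b \<in> K \<Longrightarrow> a + b \<in> K"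
proof -
  show 0: "0 \<in> K" and d: "a \<in> K \<Longrightarrow> b \<in> K \<Longrightarrow> a - b \<in> K" for a b using assms by (auto simp: add_subgroup_def)
  show m: "a \<in> K \<Longrightarrow> - a \<in> K" for a using d[OF 0, of a] by simp
  show "a \<in> K \<Longrightarrow> b \<in> K \<Longrightarrow> a + b \<in> K" using d[OF _ m, of a b] by simp
qed

lemma mem_acoset: "x \<in> acoset K c \<longleftrightarrow> x - c \<in> K"
  unfolding acoset_def by (auto intro!: exI[of _ "x - c"])

lemma acoset_eq_iff:
  assumes K: "add_subgroup K" shows "acoset K c = acoset K d \<longleftrightarrow> c - d \<in> K"
proof
  assume "acoset K c = acoset K d"
  then show "c - d \<in> K" using add_subgroupD[OF K] mem_acoset[of c K c] mem_acoset[of c K d] by simp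
next
  assume cd: "c - d \<in> K"
  have "x - c \<in> K \<longleftrightarrow> x - d \<in> K" for x
    using add_subgroupD(4)[OF K _ cd, of "x - c"] add_subgroupD(2)[OF K _ cd, of "x - d"] by auto
  then show "acoset K c = acoset K d" by (auto simp: mem_acoset)
qed

lemma acoset_zero: "acoset K 0 = K" by (auto simp: acoset_def)

lemma acoset_plus:
  assumes K: "add_subgroup K"
  shows "(\<Union>a\<in>acoset K c. \<Union>b\<in>acoset K d. {a + b}) = acoset K (c + d)"
proof (intro equalityI subsetI)
  fix x assume "x \<in> (\<Union>a\<in>acoset K c. \<Union>b\<in>acoset K d. {a + b})"
  then obtain a b where ab: "a - c \<in> K" "b - d \<in> K" "x = a + b" by (auto simp: mem_acoset)
  then have "(a - c) + (b - d) \<in> K" using add_subgroupD(4)[OF K] by blast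
  then show "x \<in> acoset K (c + d)" by (simp add: ab mem_acoset algebra_simps)
next
  fix x assume "x \<in> acoset K (c + d)"
  then have "x - d \<in> acoset K c" "d \<in> acoset K d" "x = (x - d) + d"
    using add_subgroupD(1)[OF K] by (auto simp: mem_acoset algebra_simps)
  then show "x \<in> (\<Union>a\<in>acoset K c. \<Union>b\<in>acoset K d. {a + b})" by blast
qed

lemma acoset_map:
  assumes K: "add_subgroup K" and K': "add_subgroup K'"
    and \<psi>: "\<And>a b. a \<in> acoset K c \<Longrightarrow> \<psi> a - \<psi> c \<in> K'"
  shows "(\<Union>a\<in>acoset K c. acoset K' (\<psi> a)) = acoset K' (\<psi> c)"
proof -
  have "acoset K' (\<psi> a) = acoset K' (\<psi> c)" if "a \<in> acoset K c" for a
    using \<psi>[OF that] by (simp add: acoset_eq_iff[OF K'])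
  moreover have "c \<in> acoset K c" using add_subgroupD(1)[OF K] by (simp add: mem_acoset)
  ultimately show ?thesis by blast
qed

section \<open>Left modules\<close>

context left_module
begin

lemma smult_l_null: "x \<in> carrier M \<Longrightarrow> \<zero>\<^bsub>R\<^esub> \<odot> x = \<zero>"
  using smult_l_distr[of "\<zero>\<^bsub>R\<^esub>" "\<zero>\<^bsub>R\<^esub>" x] M.add.l_cancel_one[of "\<zero>\<^bsub>R\<^esub> \<odot> x" "\<zero>\<^bsub>R\<^esub> \<odot> x"] smult_closed[of "\<zero>\<^bsub>R\<^esub>" x]
  by simp

lemma smult_r_null: "a \<in> carrier R \<Longrightarrow> a \<odot> \<zero> = \<zero>"
  using smult_r_distr[of a \<zero> \<zero>] M.add.l_cancel_one[of "a \<odot> \<zero>" "a \<odot> \<zero>"] smult_closed[of a \<zero>]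
  by simp

lemma smult_l_minus: "a \<in> carrier R \<Longrightarrow> x \<in> carrier M \<Longrightarrow> (\<ominus>\<^bsub>R\<^esub> a) \<odot> x = \<ominus> (a \<odot> x)"
  by (rule M.minus_equality[symmetric])
    (simp_all add: smult_l_distr[symmetric] R.l_neg smult_l_null smult_closed)

lemma smult_r_minus: "a \<in> carrier R \<Longrightarrow> x \<in> carrier M \<Longrightarrow> a \<odot> (\<ominus> x) = \<ominus> (a \<odot> x)"
  by (rule M.minus_equality[symmetric])
    (simp_all add: smult_r_distr[symmetric] M.l_neg smult_r_null smult_closed)

lemma minus_smult: "x \<in> carrier M \<Longrightarrow> \<ominus> x = (\<ominus>\<^bsub>R\<^esub> \<one>\<^bsub>R\<^esub>) \<odot> x"
  by (simp add: smult_l_minus smult_one)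

definition submod :: "'u set \<Rightarrow> bool" where
  "submod W \<longleftrightarrow> W \<subseteq> carrier M \<and> \<zero> \<in> W \<and> (\<forall>x\<in>W. \<forall>y\<in>W. x \<oplus> y \<in> W) \<and>
     (\<forall>a\<in>carrier R. \<forall>x\<in>W. a \<odot> x \<in> W)"

lemma submod_carrier: "submod (carrier M)"
  by (auto simp: submod_def smult_closed)

lemma submod_minus: "submod W \<Longrightarrow> x \<in> W \<Longrightarrow> y \<in> W \<Longrightarrow> x \<ominus> y \<in> W"
  unfolding submod_def a_minus_def by (metis minus_smult R.a_inv_closed R.one_closed subsetD)

lemma finsum_submod:
  assumes "submod W" "finite S" "S \<subseteq> W" "c \<in> S \<rightarrow> carrier R"
  shows "(\<Oplus>s\<in>S. c s \<odot> s) \<in> W"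
  using assms(2-)
proof (induction S rule: finite_induct)
  case empty
  then show ?case using assms(1) by (simp add: submod_def)
next
  case (insert s S)
  have W: "W \<subseteq> carrier M" "\<And>a x. a \<in> carrier R \<Longrightarrow> x \<in> W \<Longrightarrow> a \<odot> x \<in> W" "\<And>x y. x \<in> W \<Longrightarrow> y \<in> W \<Longrightarrow> x \<oplus> y \<in> W"
    using assms(1) by (auto simp: submod_def)
  have "(\<Oplus>s\<in>insert s S. c s \<odot> s) = c s \<odot> s \<oplus> (\<Oplus>s\<in>S. c s \<odot> s)"
    by (rule M.finsum_insert) (use insert W(1) in \<open>auto intro!: smult_closed simp: Pi_iff subset_iff\<close>)
  then show ?case using insert by (auto intro!: W simp: Pi_iff)
qed

lemma finsum_smult:
  assumes "finite S" "S \<subseteq> carrier M" "c \<in> S \<rightarrow> carrier R" "a \<in> carrier R"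
  shows "a \<odot> (\<Oplus>s\<in>S. c s \<odot> s) = (\<Oplus>s\<in>S. (a \<otimes>\<^bsub>R\<^esub> c s) \<odot> s)"
  using assms(1-3)
proof (induction S rule: finite_induct)
  case empty
  then show ?case using assms(4) by (simp add: smult_r_null)
next
  case (insert s S)
  then have s: "s \<in> carrier M" "c s \<in> carrier R" "\<And>t. t \<in> S \<Longrightarrow> t \<in> carrier M \<and> c t \<in> carrier R" by auto
  have fs: "(\<Oplus>s\<in>S. c s \<odot> s) \<in> carrier M"
    by (rule M.finsum_closed) (use s in \<open>auto intro: smult_closed\<close>)
  have "(\<Oplus>s\<in>insert s S. c s \<odot> s) = c s \<odot> s \<oplus> (\<Oplus>s\<in>S. c s \<odot> s)"
    by (rule M.finsum_insert) (use insert s in \<open>auto intro!: smult_closed\<close>)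
  moreover have "(\<Oplus>s\<in>insert s S. (a \<otimes>\<^bsub>R\<^esub> c s) \<odot> s) = (a \<otimes>\<^bsub>R\<^esub> c s) \<odot> s \<oplus> (\<Oplus>s\<in>S. (a \<otimes>\<^bsub>R\<^esub> c s) \<odot> s)"
    by (rule M.finsum_insert) (use insert s assms(4) in \<open>auto intro!: smult_closed\<close>)
  ultimately show ?case using insert s assms(4) fs
    by (simp add: smult_r_distr smult_assoc1 smult_closed)
qed

text \<open>A criterion in terms of submodules, which spares the later arguments all computations with
  linear combinations.\<close>

lemma finitely_generated_iff:
  "finitely_generated R M \<longleftrightarrow>
     (\<exists>S. finite S \<and> S \<subseteq> carrier M \<and> (\<forall>W. submod W \<longrightarrow> S \<subseteq> W \<longrightarrow> W = carrier M))"
proof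
  assume "finitely_generated R M"
  then obtain S where S: "finite S" "S \<subseteq> carrier M"
    "\<And>x. x \<in> carrier M \<Longrightarrow> \<exists>c\<in>S \<rightarrow> carrier R. x = (\<Oplus>s\<in>S. c s \<odot> s)"
    unfolding finitely_generated_def by blast
  have "W = carrier M" if "submod W" "S \<subseteq> W" for W
  proof
    show "W \<subseteq> carrier M" using that by (simp add: submod_def)
    show "carrier M \<subseteq> W" using S finsum_submod[OF that(1) S(1) that(2)] by blast
  qed
  with S show "\<exists>S. finite S \<and> S \<subseteq> carrier M \<and> (\<forall>W. submod W \<longrightarrow> S \<subseteq> W \<longrightarrow> W = carrier M)" by blast
next
  assume "\<exists>S. finite S \<and> S \<subseteq> carrier M \<and> (\<forall>W. submod W \<longrightarrow> S \<subseteq> W \<longrightarrow> W = carrier M)"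
  then obtain S where S: "finite S" "S \<subseteq> carrier M" "\<And>W. submod W \<Longrightarrow> S \<subseteq> W \<Longrightarrow> W = carrier M" by blast
  define W where "W = {(\<Oplus>s\<in>S. c s \<odot> s) | c. c \<in> S \<rightarrow> carrier R}"
  have cl: "c \<in> S \<rightarrow> carrier R \<Longrightarrow> (\<lambda>s. c s \<odot> s) \<in> S \<rightarrow> carrier M" for c
    using S(2) by (auto intro!: smult_closed)
  have "submod W"
    unfolding submod_def
  proof (intro conjI ballI)
    show "W \<subseteq> carrier M" unfolding W_def using cl by (auto intro: M.finsum_closed)
    have "(\<Oplus>s\<in>S. \<zero>\<^bsub>R\<^esub> \<odot> s) = (\<Oplus>s\<in>S. \<zero>)"
      by (rule M.finsum_cong') (use S(2) in \<open>auto simp: smult_l_null subset_iff\<close>)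
    then have "\<zero> = (\<Oplus>s\<in>S. \<zero>\<^bsub>R\<^esub> \<odot> s)" by simp
    then show "\<zero> \<in> W" unfolding W_def by (intro CollectI exI[of _ "\<lambda>_. \<zero>\<^bsub>R\<^esub>"]) auto
  next
    fix x y assume "x \<in> W" "y \<in> W"
    then obtain c d where cd: "c \<in> S \<rightarrow> carrier R" "d \<in> S \<rightarrow> carrier R" "x = (\<Oplus>s\<in>S. c s \<odot> s)" "y = (\<Oplus>s\<in>S. d s \<odot> s)"
      unfolding W_def by blast
    have "x \<oplus> y = (\<Oplus>s\<in>S. c s \<odot> s \<oplus> d s \<odot> s)" unfolding cd(3,4)
      by (rule M.finsum_addf[symmetric]) (use cl cd in auto)
    also have "\<dots> = (\<Oplus>s\<in>S. (c s \<oplus>\<^bsub>R\<^esub> d s) \<odot> s)"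
      by (rule M.finsum_cong') (use S(2) cd in \<open>auto simp: smult_l_distr subset_iff Pi_iff intro!: smult_closed\<close>)
    finally show "x \<oplus> y \<in> W" unfolding W_def using cd by (intro CollectI exI[of _ "\<lambda>s. c s \<oplus>\<^bsub>R\<^esub> d s"]) auto
  next
    fix a x assume "a \<in> carrier R" "x \<in> W"
    then obtain c where c: "c \<in> S \<rightarrow> carrier R" "x = (\<Oplus>s\<in>S. c s \<odot> s)" unfolding W_def by blast
    then have "a \<odot> x = (\<Oplus>s\<in>S. (a \<otimes>\<^bsub>R\<^esub> c s) \<odot> s)" using finsum_smult[OF S(1,2)] \<open>a \<in> carrier R\<close> by simp
    then show "a \<odot> x \<in> W" unfolding W_def
      using c \<open>a \<in> carrier R\<close> by (intro CollectI exI[of _ "\<lambda>s. a \<otimes>\<^bsub>R\<^esub> c s"]) auto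
  qed
  moreover have "S \<subseteq> W"
  proof
    fix s assume s: "s \<in> S"
    let ?c = "\<lambda>t. if s = t then \<one>\<^bsub>R\<^esub> else \<zero>\<^bsub>R\<^esub>"
    have "(\<Oplus>t\<in>S. ?c t \<odot> t) = (\<Oplus>t\<in>S. if s = t then t else \<zero>)"
      by (rule M.finsum_cong') (use S(2) in \<open>auto simp: smult_l_null smult_one subset_iff\<close>)
    also have "\<dots> = s" using M.finsum_singleton[OF s S(1), of "\<lambda>t. t"] S(2) by auto
    finally show "s \<in> W" unfolding W_def by (intro CollectI exI[of _ ?c]) auto
  qed
  ultimately have "W = carrier M" by (rule S(3))
  then show "finitely_generated R M" unfolding finitely_generated_def using S(1,2)
    by (intro exI[of _ S]) (auto simp: W_def)
qed

end

lemma module_homsD: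
  assumes "\<phi> \<in> module_homs R M N"
  shows "x \<in> carrier M \<Longrightarrow> \<phi> x \<in> carrier N" "x \<notin> carrier M \<Longrightarrow> \<phi> x = undefined"
    "x \<in> carrier M \<Longrightarrow> y \<in> carrier M \<Longrightarrow> \<phi> (x \<oplus>\<^bsub>M\<^esub> y) = \<phi> x \<oplus>\<^bsub>N\<^esub> \<phi> y"
    "a \<in> carrier R \<Longrightarrow> x \<in> carrier M \<Longrightarrow> \<phi> (a \<odot>\<^bsub>M\<^esub> x) = a \<odot>\<^bsub>N\<^esub> \<phi> x"
  using assms by (auto simp: module_homs_def PiE_def extensional_def)

lemma module_homs_zero:
  assumes "left_module R M" "left_module R N" "\<phi> \<in> module_homs R M N"
  shows "\<phi> \<zero>\<^bsub>M\<^esub> = \<zero>\<^bsub>N\<^esub>"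
proof -
  interpret M: left_module R M by fact
  interpret N: left_module R N by fact
  have "\<phi> \<zero>\<^bsub>M\<^esub> = \<phi> (\<zero>\<^bsub>R\<^esub> \<odot>\<^bsub>M\<^esub> \<zero>\<^bsub>M\<^esub>)" by (simp add: M.smult_l_null)
  also have "\<dots> = \<zero>\<^bsub>N\<^esub>" using module_homsD[OF assms(3)] by (simp add: N.smult_l_null)
  finally show ?thesis .
qed

section \<open>Categories of modules\<close>

lemma module_homs_compose:
  assumes f: "f \<in> module_homs R L M" and g: "g \<in> module_homs R M N" and L: "left_module R L"
  shows "compose (carrier L) g f \<in> module_homs R L N"
proof -
  interpret L: left_module R L by fact
  show ?thesis
    using module_homsD[OF f] module_homsD[OF g]
    by (auto simp: module_homs_def compose_def L.smult_closed)
qed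

lemma module_homs_ident:
  assumes L: "left_module R L" shows "(\<lambda>x\<in>carrier L. x) \<in> module_homs R L L"
proof -
  interpret L: left_module R L by fact
  show ?thesis by (auto simp: module_homs_def L.smult_closed)
qed

lemma module_homs_ext:
  assumes "f \<in> module_homs R M N" "g \<in> module_homs R M' N'" "carrier M = carrier M'"
    "\<And>x. x \<in> carrier M \<Longrightarrow> f x = g x"
  shows "f = g"
proof
  fix x show "f x = g x" using assms module_homsD(2)[OF assms(1), of x] module_homsD(2)[OF assms(2), of x]
    by (cases "x \<in> carrier M") auto
qed

lemma module_cat_simps [simp]:
  "Obj (module_cat R P) = {M. left_module R M \<and> P M}" "Hom (module_cat R P) = module_homs R"
  "Ident (module_cat R P) M = (\<lambda>x\<in>carrier M. x)" "Comp (module_cat R P) X Y Z g f = compose (carrier X) g f"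
  by (simp_all add: module_cat_def)

lemma module_cat_is_category: "is_category (module_cat R P)"
  unfolding is_category_def module_cat_simps
proof (intro conjI ballI)
  fix W X Y Z f g k
  assume f: "f \<in> module_homs R W X" and W: "W \<in> {M. left_module R M \<and> P M}"
  show "compose (carrier W) (compose (carrier X) k g) f = compose (carrier W) k (compose (carrier W) g f)"
    using module_homsD[OF f] by (auto simp: compose_def)
next
  fix X Y f
  assume f: "f \<in> module_homs R X Y"
  show "compose (carrier X) f (\<lambda>x\<in>carrier X. x) = f" "compose (carrier X) (\<lambda>x\<in>carrier Y. x) f = f"
    using module_homsD[OF f] by (auto simp: compose_def)
qed (auto intro: module_homs_ident module_homs_compose)

lemma module_homs_inverse:
  assumes f: "f \<in> module_homs R M N" and bij: "bij_betw f (carrier M) (carrier N)"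
    and M: "left_module R M" and N: "left_module R N"
  defines "g \<equiv> \<lambda>y\<in>carrier N. inv_into (carrier M) f y"
  shows "g \<in> module_homs R N M" "bij_betw g (carrier N) (carrier M)"
    "x \<in> carrier M \<Longrightarrow> g (f x) = x" "y \<in> carrier N \<Longrightarrow> f (g y) = y"
proof -
  interpret M: left_module R M by fact
  interpret N: left_module R N by fact
  have inj: "inj_on f (carrier M)" and im: "f ` carrier M = carrier N" using bij by (auto simp: bij_betw_def)
  note fD = module_homsD[OF f]
  have gM: "inv_into (carrier M) f y \<in> carrier M" if "y \<in> carrier N" for y
    using that im inv_into_into by metis
  have fg: "f (inv_into (carrier M) f y) = y" if "y \<in> carrier N" for y
    using that im f_inv_into_f by metis
  have gf: "inv_into (carrier M) f (f x) = x" if "x \<in> carrier M" for x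
    using that inj by simp
  show "g \<in> module_homs R N M"
    unfolding module_homs_def
  proof (intro CollectI conjI ballI)
    show "g \<in> carrier N \<rightarrow>\<^sub>E carrier M" using gM by (auto simp: g_def)
    fix x y assume xy: "x \<in> carrier N" "y \<in> carrier N"
    have "f (g x \<oplus>\<^bsub>M\<^esub> g y) = x \<oplus>\<^bsub>N\<^esub> y" using xy gM fg fD by (simp add: g_def)
    then show "g (x \<oplus>\<^bsub>N\<^esub> y) = g x \<oplus>\<^bsub>M\<^esub> g y"
      using xy gM gf[of "g x \<oplus>\<^bsub>M\<^esub> g y"] by (simp add: g_def)
  next
    fix a x assume ax: "a \<in> carrier R" "x \<in> carrier N"
    have "f (a \<odot>\<^bsub>M\<^esub> g x) = a \<odot>\<^bsub>N\<^esub> x" using ax gM fg fD by (simp add: g_def)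
    then show "g (a \<odot>\<^bsub>N\<^esub> x) = a \<odot>\<^bsub>M\<^esub> g x"
      using ax gM gf[of "a \<odot>\<^bsub>M\<^esub> g x"] by (simp add: g_def M.smult_closed N.smult_closed)
  qed
  show "bij_betw g (carrier N) (carrier M)"
    using bij_betw_inv_into[OF bij] by (auto simp: g_def bij_betw_def inj_on_def)
  show "x \<in> carrier M \<Longrightarrow> g (f x) = x" "y \<in> carrier N \<Longrightarrow> f (g y) = y"
    using gf fg fD(1) by (simp_all add: g_def)
qed

lemma bij_module_hom_is_isomorphism:
  assumes f: "f \<in> module_homs R M N" and bij: "bij_betw f (carrier M) (carrier N)"
    and M: "left_module R M" and N: "left_module R N"
  shows "is_isomorphism (module_cat R P) M N f"
proof -
  let ?g = "\<lambda>y\<in>carrier N. inv_into (carrier M) f y"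
  note g = module_homs_inverse[OF assms]
  have "compose (carrier M) ?g f = (\<lambda>x\<in>carrier M. x)" "compose (carrier N) f ?g = (\<lambda>x\<in>carrier N. x)"
    unfolding compose_def by (rule restrict_ext, erule g)+
  then show ?thesis using f g(1) unfolding is_isomorphism_def module_cat_simps by blast
qed

text \<open>Both natural transformations of the equivalence have this shape.\<close>

lemma module_cat_identity_naturally_isomorphic:
  assumes F: "is_functor (module_cat R P) (module_cat R P) F"
    and hom: "\<And>X. left_module R X \<Longrightarrow> P X \<Longrightarrow> \<eta> X \<in> module_homs R (omap F X) X"
    and bij: "\<And>X. left_module R X \<Longrightarrow> P X \<Longrightarrow> bij_betw (\<eta> X) (carrier (omap F X)) (carrier X)"
    and nat: "\<And>X Y f x. left_module R X \<Longrightarrow> P X \<Longrightarrow> left_module R Y \<Longrightarrow> P Y \<Longrightarrow> f \<in> module_homs R X Y \<Longrightarrow>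
      x \<in> carrier (omap F X) \<Longrightarrow> f (\<eta> X x) = \<eta> Y (amap F X Y f x)"
  shows "naturally_isomorphic (module_cat R P) (module_cat R P) F identity_functor"
proof -
  have FX: "left_module R (omap F X)" if "left_module R X" "P X" for X
    using F that by (simp add: is_functor_def)
  have "is_functor (module_cat R P) (module_cat R P) identity_functor"
    using module_cat_is_category[of R P] by (simp add: is_functor_def identity_functor_def)
  with F show ?thesis
    unfolding naturally_isomorphic_def identity_functor_def
    by (intro conjI exI[of _ \<eta>])
      (auto simp: hom bij FX nat compose_def fun_eq_iff intro!: bij_module_hom_is_isomorphism)
qed

lemma is_functor_comp:
  "is_functor B C G \<Longrightarrow> is_functor A B F \<Longrightarrow> is_functor A C (functor_comp G F)"
  unfolding is_functor_def functor_comp_def by simp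

lemma (in abelian_group) eq_if_diff_zero:
  "x \<in> carrier G \<Longrightarrow> y \<in> carrier G \<Longrightarrow> x \<ominus> y = \<zero> \<Longrightarrow> x = y"
  by (metis a_assoc a_inv_closed a_minus_def l_neg l_zero r_zero)

lemma (in abelian_group) add_diff_self:
  "x \<in> carrier G \<Longrightarrow> y \<in> carrier G \<Longrightarrow> x \<oplus> y \<ominus> x \<ominus> y = \<zero>"
  by (simp add: a_minus_def a_comm[of "x \<oplus> y" "\<ominus> x"] r_neg1 r_neg)

section \<open>Tensor products\<close>

text \<open>The bimodule laws of \<open>Q\<close> on which the module structure of the tensor product rests.\<close>

locale balanced_pair = S: ring S + V: left_module R V
  for S :: "'s ring" and R :: "'r ring" and V :: "('r, 'v) module" +
  fixes Q :: "('s, 'q, 'r) bimodule"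
  assumes Q_add: "p \<in> carrier Q \<Longrightarrow> q \<in> carrier Q \<Longrightarrow> p \<oplus>\<^bsub>Q\<^esub> q \<in> carrier Q"
    and Q_smult: "s \<in> carrier S \<Longrightarrow> q \<in> carrier Q \<Longrightarrow> s \<odot>\<^bsub>Q\<^esub> q \<in> carrier Q"
    and Q_rsmult: "q \<in> carrier Q \<Longrightarrow> r \<in> carrier R \<Longrightarrow> rsmult Q q r \<in> carrier Q"
    and Q_smult_add: "s \<in> carrier S \<Longrightarrow> p \<in> carrier Q \<Longrightarrow> q \<in> carrier Q \<Longrightarrow> s \<odot>\<^bsub>Q\<^esub> (p \<oplus>\<^bsub>Q\<^esub> q) = s \<odot>\<^bsub>Q\<^esub> p \<oplus>\<^bsub>Q\<^esub> s \<odot>\<^bsub>Q\<^esub> q"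
    and Q_add_smult: "s \<in> carrier S \<Longrightarrow> t \<in> carrier S \<Longrightarrow> q \<in> carrier Q \<Longrightarrow> (s \<oplus>\<^bsub>S\<^esub> t) \<odot>\<^bsub>Q\<^esub> q = s \<odot>\<^bsub>Q\<^esub> q \<oplus>\<^bsub>Q\<^esub> t \<odot>\<^bsub>Q\<^esub> q"
    and Q_assoc: "s \<in> carrier S \<Longrightarrow> t \<in> carrier S \<Longrightarrow> q \<in> carrier Q \<Longrightarrow> (s \<otimes>\<^bsub>S\<^esub> t) \<odot>\<^bsub>Q\<^esub> q = s \<odot>\<^bsub>Q\<^esub> (t \<odot>\<^bsub>Q\<^esub> q)"
    and Q_one: "q \<in> carrier Q \<Longrightarrow> \<one>\<^bsub>S\<^esub> \<odot>\<^bsub>Q\<^esub> q = q"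
    and Q_bimodule: "s \<in> carrier S \<Longrightarrow> q \<in> carrier Q \<Longrightarrow> r \<in> carrier R \<Longrightarrow> s \<odot>\<^bsub>Q\<^esub> rsmult Q q r = rsmult Q (s \<odot>\<^bsub>Q\<^esub> q) r"
begin

abbreviation "K \<equiv> tensor_kernel R Q V"
abbreviation "T \<equiv> tensor_product R Q V"
abbreviation supported :: "('q \<times> 'v \<Rightarrow>\<^sub>0 int) \<Rightarrow> bool" where
  "supported c \<equiv> Poly_Mapping.keys c \<subseteq> carrier Q \<times> carrier V"

definition pure_tensor :: "'q \<Rightarrow> 'v \<Rightarrow> ('q \<times> 'v \<Rightarrow>\<^sub>0 int) set" where
  "pure_tensor q v = acoset K (frag_of (q, v))"

lemma supported_of: "q \<in> carrier Q \<Longrightarrow> v \<in> carrier V \<Longrightarrow> supported (frag_of (q, v))"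
  by simp

lemma supported_diff: "supported a \<Longrightarrow> supported b \<Longrightarrow> supported (a - b)"
  using keys_diff[of a b] by blast

lemma supported_add: "supported a \<Longrightarrow> supported b \<Longrightarrow> supported (a + b)"
  using keys_add[of a b] by blast

lemma relations_supported: "r \<in> tensor_relations R Q V \<Longrightarrow> supported r"
  by (erule tensor_relations.cases; hypsubst;
      intro supported_diff supported_of Q_add Q_rsmult V.smult_closed V.a_closed; assumption)

lemma kernel_induct [consumes 1, case_names zero rel minus add]:
  assumes "z \<in> K" "P 0" "\<And>r. r \<in> tensor_relations R Q V \<Longrightarrow> P r"
    "\<And>r. r \<in> tensor_relations R Q V \<Longrightarrow> P (- r)" "\<And>a b. a \<in> K \<Longrightarrow> b \<in> K \<Longrightarrow> P a \<Longrightarrow> P b \<Longrightarrow> P (a + b)"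
  shows "P z"
  using assms(1) unfolding tensor_kernel_def
proof (induction rule: generate.induct)
  case (inv r)
  then show ?case using assms(4) relations_supported by simp
qed (use assms in \<open>auto simp: tensor_kernel_def\<close>)

lemma kernel_rel: "r \<in> tensor_relations R Q V \<Longrightarrow> r \<in> K"
  unfolding tensor_kernel_def by (rule generate.incl)

lemma kernel_add: "a \<in> K \<Longrightarrow> b \<in> K \<Longrightarrow> a + b \<in> K"
  unfolding tensor_kernel_def using generate.eng[of a "tensor_gens Q V" _ b] by simp

lemma kernel_zero: "0 \<in> K"
  unfolding tensor_kernel_def using generate.one[of "tensor_gens Q V"] by simp

lemma kernel_minus: "a \<in> K \<Longrightarrow> - a \<in> K"
proof (induction rule: kernel_induct)
  case (minus r)
  then show ?case by (simp add: kernel_rel)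
next
  case (rel r)
  then show ?case using generate.inv[of r "tensor_relations R Q V" "tensor_gens Q V"] relations_supported
    by (simp add: tensor_kernel_def)
next
  case (add a b)
  then show ?case using kernel_add[of "- a" "- b"] by simp
qed (simp add: kernel_zero)

lemma kernel_subgroup: "add_subgroup K"
  unfolding add_subgroup_def
  using kernel_zero kernel_add[OF _ kernel_minus] by fastforce

lemma kernel_supported: "a \<in> K \<Longrightarrow> supported a"
proof (induction rule: kernel_induct)
  case (minus r)
  then show ?case using relations_supported[of r] by simp
next
  case (rel r)
  then show ?case by (rule relations_supported)
next
  case (add a b)
  from add(3,4) show ?case by (rule supported_add)
qed simp

lemma r_coset_eq: "K #>\<^bsub>tensor_gens Q V\<^esub> c = acoset K c"
  by (auto simp: r_coset_def acoset_def)

lemma T_carrier: "carrier T = {acoset K c | c. supported c}"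
  by (auto simp: tensor_product_def FactGroup_def RCOSETS_def r_coset_eq)

lemma T_carrierI: "supported c \<Longrightarrow> acoset K c \<in> carrier T"
  unfolding T_carrier by blast

lemma T_carrierE:
  assumes "x \<in> carrier T" obtains c where "supported c" "x = acoset K c"
  using assms unfolding T_carrier by blast

lemma T_zero: "\<zero>\<^bsub>T\<^esub> = acoset K 0"
  by (simp add: tensor_product_def FactGroup_def acoset_zero)

lemma T_add: "acoset K c \<oplus>\<^bsub>T\<^esub> acoset K d = acoset K (c + d)"
  using acoset_plus[OF kernel_subgroup] by (simp add: tensor_product_def FactGroup_def set_mult_def)

definition act :: "'s \<Rightarrow> ('q \<times> 'v \<Rightarrow>\<^sub>0 int) \<Rightarrow> ('q \<times> 'v \<Rightarrow>\<^sub>0 int)" where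
  "act s = frag_extend (\<lambda>(q, v). frag_of (s \<odot>\<^bsub>Q\<^esub> q, v))"

lemma act_simps: "act s (frag_of (q, v)) = frag_of (s \<odot>\<^bsub>Q\<^esub> q, v)" "act s (a + b) = act s a + act s b"
  "act s (a - b) = act s a - act s b" "act s (- a) = - act s a" "act s 0 = 0"
  by (simp_all add: act_def frag_extend_add frag_extend_diff frag_extend_minus)

lemma act_supported:
  assumes s: "s \<in> carrier S" and c: "supported c" shows "supported (act s c)"
  using c
proof (induction rule: frag_induction)
  case (one x)
  then show ?case using Q_smult[OF s] by (cases x) (auto simp: act_simps)
qed (auto simp: act_simps intro: supported_diff dest!: subsetD[OF supported_diff, rotated -1])

lemma act_kernel:
  assumes s: "s \<in> carrier S" and "z \<in> K" shows "act s z \<in> K"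
  using assms(2)
proof (induction rule: kernel_induct)
  case (rel r)
  then have "act s r \<in> tensor_relations R Q V"
    by cases (auto simp: act_simps Q_smult_add[OF s] Q_bimodule[OF s] intro: tensor_relations.intros Q_smult[OF s])
  then show ?case by (rule kernel_rel)
next
  case (minus r)
  then have "act s r \<in> tensor_relations R Q V"
    by cases (auto simp: act_simps Q_smult_add[OF s] Q_bimodule[OF s] intro: tensor_relations.intros Q_smult[OF s])
  then show ?case using kernel_rel kernel_minus by (simp add: act_simps)
qed (auto simp: act_simps kernel_zero intro: kernel_add)

lemma T_smult:
  assumes s: "s \<in> carrier S" shows "s \<odot>\<^bsub>T\<^esub> acoset K c = acoset K (act s c)"
proof -
  have "s \<odot>\<^bsub>T\<^esub> acoset K c = (\<Union>d\<in>acoset K c. acoset K (act s d))"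
    by (simp add: tensor_product_def r_coset_eq act_def)
  also have "\<dots> = acoset K (act s c)"
    by (rule acoset_map[OF kernel_subgroup kernel_subgroup])
      (simp add: mem_acoset act_simps(3)[symmetric] act_kernel[OF s])
  finally show ?thesis .
qed

lemma act_relation:
  assumes "supported c" "\<And>q v. q \<in> carrier Q \<Longrightarrow> v \<in> carrier V \<Longrightarrow> F (frag_of (q, v)) \<in> K"
    "\<And>a b. F (a - b) = F a - F b" "F 0 = 0"
  shows "F c \<in> K"
  using assms(1)
proof (induction rule: frag_induction)
  case (diff a b)
  from add_subgroupD(2)[OF kernel_subgroup diff] show ?case unfolding assms(3) .
next
  case (one x)
  then obtain q v where "x = (q, v)" "q \<in> carrier Q" "v \<in> carrier V" by blast
  then show ?case using assms(2) by metis
next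
  case zero
  show ?case unfolding assms(4) by (rule kernel_zero)
qed

lemma T_module: "left_module S T"
proof -
  note eq = acoset_eq_iff[OF kernel_subgroup]
  have ab: "abelian_group T"
  proof (rule abelian_groupI)
    fix x y assume "x \<in> carrier T" "y \<in> carrier T"
    then show "x \<oplus>\<^bsub>T\<^esub> y \<in> carrier T"
      by (elim T_carrierE) (simp only: T_add T_carrierI supported_add)
  next
    show "\<zero>\<^bsub>T\<^esub> \<in> carrier T" unfolding T_zero by (rule T_carrierI) simp
  next
    fix x y z assume "x \<in> carrier T" "y \<in> carrier T" "z \<in> carrier T"
    then show "x \<oplus>\<^bsub>T\<^esub> y \<oplus>\<^bsub>T\<^esub> z = x \<oplus>\<^bsub>T\<^esub> (y \<oplus>\<^bsub>T\<^esub> z)"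
      by (elim T_carrierE) (simp only: T_add add.assoc)
  next
    fix x y assume "x \<in> carrier T" "y \<in> carrier T"
    then show "x \<oplus>\<^bsub>T\<^esub> y = y \<oplus>\<^bsub>T\<^esub> x" by (elim T_carrierE) (simp only: T_add add.commute)
  next
    fix x assume "x \<in> carrier T"
    then show "\<zero>\<^bsub>T\<^esub> \<oplus>\<^bsub>T\<^esub> x = x" unfolding T_zero by (elim T_carrierE) (simp only: T_add add_0)
  next
    fix x assume "x \<in> carrier T"
    then obtain c where c: "supported c" "x = acoset K c" by (elim T_carrierE)
    then have "acoset K (- c) \<in> carrier T" by (intro T_carrierI) simp
    moreover have "acoset K (- c) \<oplus>\<^bsub>T\<^esub> x = \<zero>\<^bsub>T\<^esub>" by (simp add: c T_add T_zero)
    ultimately show "\<exists>y\<in>carrier T. y \<oplus>\<^bsub>T\<^esub> x = \<zero>\<^bsub>T\<^esub>" by blast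
  qed
  show ?thesis
  proof (intro left_module.intro left_module_axioms.intro S.ring_axioms ab)
    fix a x assume a: "a \<in> carrier S" and "x \<in> carrier T"
    then obtain c where c: "supported c" "x = acoset K c" by (elim T_carrierE)
    then show "a \<odot>\<^bsub>T\<^esub> x \<in> carrier T"
      using T_carrierI[OF act_supported[OF a c(1)]] by (simp only: c T_smult[OF a])
  next
    fix a b x assume a: "a \<in> carrier S" and b: "b \<in> carrier S" and "x \<in> carrier T"
    then obtain c where c: "supported c" "x = acoset K c" by (elim T_carrierE)
    have "act (a \<oplus>\<^bsub>S\<^esub> b) c - (act a c + act b c) \<in> K"
    proof (rule act_relation[OF c(1), of "\<lambda>c. act (a \<oplus>\<^bsub>S\<^esub> b) c - (act a c + act b c)"])
      fix q v assume qv: "q \<in> carrier Q" "v \<in> carrier V"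
      show "act (a \<oplus>\<^bsub>S\<^esub> b) (frag_of (q, v)) - (act a (frag_of (q, v)) + act b (frag_of (q, v))) \<in> K"
        using kernel_rel[OF tensor_relations.intros(1)[OF Q_smult[OF a qv(1)] Q_smult[OF b qv(1)] qv(2)]]
        by (simp add: act_simps Q_add_smult a b qv diff_diff_add)
    qed (simp_all add: act_simps)
    then show "(a \<oplus>\<^bsub>S\<^esub> b) \<odot>\<^bsub>T\<^esub> x = a \<odot>\<^bsub>T\<^esub> x \<oplus>\<^bsub>T\<^esub> b \<odot>\<^bsub>T\<^esub> x"
      unfolding c(2) T_smult[OF a] T_smult[OF b] T_smult[OF S.a_closed[OF a b]] T_add eq .
  next
    fix a x y assume a: "a \<in> carrier S" and "x \<in> carrier T" "y \<in> carrier T"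
    then show "a \<odot>\<^bsub>T\<^esub> (x \<oplus>\<^bsub>T\<^esub> y) = a \<odot>\<^bsub>T\<^esub> x \<oplus>\<^bsub>T\<^esub> a \<odot>\<^bsub>T\<^esub> y"
      by (elim T_carrierE) (simp only: T_smult[OF a] T_add act_simps)
  next
    fix a b x assume a: "a \<in> carrier S" and b: "b \<in> carrier S" and "x \<in> carrier T"
    then obtain c where c: "supported c" "x = acoset K c" by (elim T_carrierE)
    have "act (a \<otimes>\<^bsub>S\<^esub> b) c - act a (act b c) \<in> K"
      by (rule act_relation[OF c(1), of "\<lambda>c. act (a \<otimes>\<^bsub>S\<^esub> b) c - act a (act b c)"])
        (simp_all add: act_simps Q_assoc a b kernel_zero)
    then show "(a \<otimes>\<^bsub>S\<^esub> b) \<odot>\<^bsub>T\<^esub> x = a \<odot>\<^bsub>T\<^esub> (b \<odot>\<^bsub>T\<^esub> x)"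
      unfolding c(2) T_smult[OF a] T_smult[OF b] T_smult[OF S.m_closed[OF a b]] eq .
  next
    fix x assume "x \<in> carrier T"
    then obtain c where c: "supported c" "x = acoset K c" by (elim T_carrierE)
    have "act \<one>\<^bsub>S\<^esub> c - c \<in> K"
      by (rule act_relation[OF c(1), of "\<lambda>c. act \<one>\<^bsub>S\<^esub> c - c"]) (simp_all add: act_simps Q_one kernel_zero)
    then show "\<one>\<^bsub>S\<^esub> \<odot>\<^bsub>T\<^esub> x = x" unfolding c(2) T_smult[OF S.one_closed] eq .
  qed
qed

lemma pure_tensor_closed: "q \<in> carrier Q \<Longrightarrow> v \<in> carrier V \<Longrightarrow> pure_tensor q v \<in> carrier T"
  unfolding pure_tensor_def by (intro T_carrierI supported_of)

lemma pure_tensor_add_right: "q \<in> carrier Q \<Longrightarrow> v \<in> carrier V \<Longrightarrow> w \<in> carrier V \<Longrightarrow> pure_tensor q (v \<oplus>\<^bsub>V\<^esub> w) = pure_tensor q v \<oplus>\<^bsub>T\<^esub> pure_tensor q w"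
  unfolding pure_tensor_def T_add acoset_eq_iff[OF kernel_subgroup]
  using kernel_rel[OF tensor_relations.intros(2)] by (simp add: diff_diff_add)

lemma pure_tensor_balanced: "q \<in> carrier Q \<Longrightarrow> r \<in> carrier R \<Longrightarrow> v \<in> carrier V \<Longrightarrow> pure_tensor (rsmult Q q r) v = pure_tensor q (r \<odot>\<^bsub>V\<^esub> v)"
  unfolding pure_tensor_def acoset_eq_iff[OF kernel_subgroup]
  using kernel_rel[OF tensor_relations.intros(3)] by simp

lemma pure_tensor_smult: "s \<in> carrier S \<Longrightarrow> s \<odot>\<^bsub>T\<^esub> pure_tensor q v = pure_tensor (s \<odot>\<^bsub>Q\<^esub> q) v"
  unfolding pure_tensor_def by (simp add: T_smult act_simps)

lemma T_induct [consumes 1, case_names zero pure_tensor diff]: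
  assumes "t \<in> carrier T" and "P \<zero>\<^bsub>T\<^esub>" and "\<And>q v. q \<in> carrier Q \<Longrightarrow> v \<in> carrier V \<Longrightarrow> P (pure_tensor q v)"
    and "\<And>a b. a \<in> carrier T \<Longrightarrow> b \<in> carrier T \<Longrightarrow> P a \<Longrightarrow> P b \<Longrightarrow> P (a \<ominus>\<^bsub>T\<^esub> b)"
  shows "P t"
proof -
  interpret T: left_module S T by (rule T_module)
  obtain c where c: "supported c" "t = acoset K c" using assms(1) unfolding T_carrier by blast
  have "supported c \<and> P (acoset K c)" using c(1)
  proof (induction rule: frag_induction)
    case zero
    then show ?case using assms(2) by (simp add: T_zero)
  next
    case (one x)
    then show ?case using assms(3) by (cases x) (auto simp: pure_tensor_def)
  next
    case (diff a b)
    have ab: "acoset K a \<in> carrier T" "acoset K b \<in> carrier T" "acoset K (a - b) \<in> carrier T"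
      using diff supported_diff unfolding T_carrier by blast+
    have "acoset K a = acoset K (a - b) \<oplus>\<^bsub>T\<^esub> acoset K b" by (simp add: T_add)
    then have "acoset K (a - b) = acoset K a \<ominus>\<^bsub>T\<^esub> acoset K b"
      using ab by (simp add: a_minus_def T.M.add.m_assoc T.M.r_neg)
    then show ?case using diff assms(4)[OF ab(1,2)] supported_diff by auto
  qed
  then show ?thesis by (simp add: c)
qed

text \<open>An element of the kernel involves finitely many relations.  So to show that an element does not
  lie in the kernel, a sequence of maps will do each of which respects any given relation only from
  some index on.\<close>

lemma kernel_eventually:
  assumes A: "abelian_group A" and h: "\<And>k::nat. h k \<in> hom (tensor_gens Q V) (add_monoid A)"
    and rel: "\<And>r. r \<in> tensor_relations R Q V \<Longrightarrow> \<exists>n. \<forall>k\<ge>n. h k r = \<zero>\<^bsub>A\<^esub>"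
    and z: "z \<in> K"
  shows "\<exists>n. \<forall>k\<ge>n. h k z = \<zero>\<^bsub>A\<^esub>"
proof -
  interpret A: abelian_group A by fact
  interpret h: group_hom "tensor_gens Q V" "add_monoid A" "h k" for k
    by (rule group_hom.intro) (auto simp: group_hom_axioms_def h intro: A.a_group)
  have hz: "h k 0 = \<zero>\<^bsub>A\<^esub>" for k using h.hom_one[of k] by simp
  show ?thesis using z
  proof (induction rule: kernel_induct)
    case (minus r)
    then obtain n where n: "\<And>k. n \<le> k \<Longrightarrow> h k r = \<zero>\<^bsub>A\<^esub>" using rel by blast
    have "h k (- r) = \<ominus>\<^bsub>A\<^esub> h k r" for k
      using h.hom_inv[of r k] relations_supported[OF minus] by (simp add: a_inv_def)
    then show ?case using n by (intro exI[of _ n]) simp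
  next
    case (add a b)
    then obtain n m where "\<And>k. n \<le> k \<Longrightarrow> h k a = \<zero>\<^bsub>A\<^esub>" "\<And>k. m \<le> k \<Longrightarrow> h k b = \<zero>\<^bsub>A\<^esub>" by blast
    moreover have "h k (a + b) = h k a \<oplus>\<^bsub>A\<^esub> h k b" for k
      using h.hom_mult[of a b k] kernel_supported add by simp
    ultimately show ?case by (intro exI[of _ "max n m"]) auto
  qed (use hz rel in auto)
qed

lemma ex_free_hom:
  assumes A: "abelian_group A" and \<beta>: "\<And>q v. q \<in> carrier Q \<Longrightarrow> v \<in> carrier V \<Longrightarrow> \<beta> q v \<in> carrier A"
  shows "\<exists>h. h \<in> hom (tensor_gens Q V) (add_monoid A) \<and>
     (\<forall>q\<in>carrier Q. \<forall>v\<in>carrier V. h (frag_of (q, v)) = \<beta> q v)"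
proof -
  interpret A: abelian_group A by fact
  have "(\<lambda>(q, v). \<beta> q v) ` (carrier Q \<times> carrier V) \<subseteq> carrier (add_monoid A)" using \<beta> by auto
  from comm_group.free_Abelian_group_universal[OF A.a_comm_group this] obtain h where
    "h \<in> hom (tensor_gens Q V) (add_monoid A)"
    "\<And>x. x \<in> carrier Q \<times> carrier V \<Longrightarrow> h (frag_of x) = (\<lambda>(q, v). \<beta> q v) x" by blast
  then show ?thesis by (intro exI[of _ h]) auto
qed

lemma free_hom_diff:
  assumes A: "abelian_group A" and h: "h \<in> hom (tensor_gens Q V) (add_monoid A)" and ab: "supported a" "supported b"
  shows "h (a - b) = h a \<ominus>\<^bsub>A\<^esub> h b"
proof -
  interpret A: abelian_group A by fact
  interpret h: group_hom "tensor_gens Q V" "add_monoid A" h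
    by (rule group_hom.intro) (auto simp: group_hom_axioms_def h intro: A.a_group)
  have "h (a + (- b)) = h a \<oplus>\<^bsub>A\<^esub> h (- b)" using h.hom_mult[of a "- b"] ab by simp
  moreover have "h (- b) = \<ominus>\<^bsub>A\<^esub> h b" using h.hom_inv[of b] ab by (simp add: a_inv_def)
  ultimately show ?thesis by (simp add: a_minus_def)
qed

lemma T_universal:
  assumes A: "abelian_group A"
    and \<beta>: "\<And>q v. q \<in> carrier Q \<Longrightarrow> v \<in> carrier V \<Longrightarrow> \<beta> q v \<in> carrier A"
    and \<beta>1: "\<And>p q v. p \<in> carrier Q \<Longrightarrow> q \<in> carrier Q \<Longrightarrow> v \<in> carrier V \<Longrightarrow> \<beta> (p \<oplus>\<^bsub>Q\<^esub> q) v = \<beta> p v \<oplus>\<^bsub>A\<^esub> \<beta> q v"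
    and \<beta>2: "\<And>q v w. q \<in> carrier Q \<Longrightarrow> v \<in> carrier V \<Longrightarrow> w \<in> carrier V \<Longrightarrow> \<beta> q (v \<oplus>\<^bsub>V\<^esub> w) = \<beta> q v \<oplus>\<^bsub>A\<^esub> \<beta> q w"
    and \<beta>3: "\<And>q r v. q \<in> carrier Q \<Longrightarrow> r \<in> carrier R \<Longrightarrow> v \<in> carrier V \<Longrightarrow> \<beta> (rsmult Q q r) v = \<beta> q (r \<odot>\<^bsub>V\<^esub> v)"
  shows "\<exists>g. (\<forall>t\<in>carrier T. g t \<in> carrier A) \<and>
     (\<forall>s\<in>carrier T. \<forall>t\<in>carrier T. g (s \<oplus>\<^bsub>T\<^esub> t) = g s \<oplus>\<^bsub>A\<^esub> g t) \<and>
     (\<forall>q\<in>carrier Q. \<forall>v\<in>carrier V. g (pure_tensor q v) = \<beta> q v)"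
proof -
  interpret A: abelian_group A by fact
  obtain h where h: "h \<in> hom (tensor_gens Q V) (add_monoid A)"
    and h\<beta>: "\<And>q v. q \<in> carrier Q \<Longrightarrow> v \<in> carrier V \<Longrightarrow> h (frag_of (q, v)) = \<beta> q v"
    using ex_free_hom[of A \<beta>, OF A \<beta>] by blast
  have hcl: "supported c \<Longrightarrow> h c \<in> carrier A" for c using h by (auto simp: hom_def)
  have hadd: "supported c \<Longrightarrow> supported d \<Longrightarrow> h (c + d) = h c \<oplus>\<^bsub>A\<^esub> h d" for c d using h by (auto simp: hom_def)
  note hdiff = free_hom_diff[OF A h]
  have rel: "h r = \<zero>\<^bsub>A\<^esub>" if "r \<in> tensor_relations R Q V" for r
    using that
  proof cases
    case (1 p q v)
    then have "h r = (\<beta> p v \<oplus>\<^bsub>A\<^esub> \<beta> q v) \<ominus>\<^bsub>A\<^esub> \<beta> p v \<ominus>\<^bsub>A\<^esub> \<beta> q v"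
      by (simp add: hdiff supported_diff supported_of Q_add h\<beta> \<beta>1)
    then show ?thesis using \<beta> 1 A.add_diff_self by simp
  next
    case (2 q v w)
    then have "h r = (\<beta> q v \<oplus>\<^bsub>A\<^esub> \<beta> q w) \<ominus>\<^bsub>A\<^esub> \<beta> q v \<ominus>\<^bsub>A\<^esub> \<beta> q w"
      by (simp add: hdiff supported_diff supported_of h\<beta> \<beta>2)
    then show ?thesis using \<beta> 2 A.add_diff_self by simp
  next
    case (3 q r' v)
    then have "h r = \<beta> q (r' \<odot>\<^bsub>V\<^esub> v) \<ominus>\<^bsub>A\<^esub> \<beta> q (r' \<odot>\<^bsub>V\<^esub> v)"
      by (simp add: hdiff supported_diff supported_of Q_rsmult V.smult_closed h\<beta> \<beta>3)
    then show ?thesis using \<beta> 3 by (simp add: a_minus_def A.r_neg V.smult_closed)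
  qed
  have hK: "h z = \<zero>\<^bsub>A\<^esub>" if "z \<in> K" for z
    using kernel_eventually[OF A, of "\<lambda>_. h" z] h rel that by blast
  define g where "g t = h (SOME c. supported c \<and> t = acoset K c)" for t
  have g: "g (acoset K c) = h c" if c: "supported c" for c
  proof -
    define d where "d = (SOME d. supported d \<and> acoset K c = acoset K d)"
    have d: "supported d" "acoset K c = acoset K d"
      unfolding d_def by (rule someI2[of _ c]; use c in simp)+
    then have "c - d \<in> K" by (simp add: acoset_eq_iff[OF kernel_subgroup])
    then have "h c \<ominus>\<^bsub>A\<^esub> h d = \<zero>\<^bsub>A\<^esub>" using hK hdiff c d by metis
    then have "h c = h d" using hcl c d by (metis A.eq_if_diff_zero)
    then show ?thesis by (simp add: g_def d_def)
  qed
  show ?thesis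
  proof (intro exI[of _ g] conjI ballI)
    fix t assume "t \<in> carrier T"
    then show "g t \<in> carrier A" unfolding T_carrier using g hcl by auto
  next
    fix s t assume "s \<in> carrier T" "t \<in> carrier T"
    then show "g (s \<oplus>\<^bsub>T\<^esub> t) = g s \<oplus>\<^bsub>A\<^esub> g t"
      unfolding T_carrier using g hadd supported_add by (auto simp: T_add)
  next
    fix q v assume "q \<in> carrier Q" "v \<in> carrier V"
    then show "g (pure_tensor q v) = \<beta> q v" unfolding pure_tensor_def using g[OF supported_of] h\<beta> by simp
  qed
qed

end

section \<open>Transport along a relabelling\<close>

lemma relabel_simps:
  assumes inj: "inj_on (relabelling M :: 'v \<Rightarrow> 'u) (carrier M)"
  defines "i \<equiv> relabelling M :: 'v \<Rightarrow> 'u"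
  shows "carrier (relabel M) = i ` carrier M" "\<zero>\<^bsub>relabel M\<^esub> = i \<zero>\<^bsub>M\<^esub>"
    "x \<in> carrier M \<Longrightarrow> y \<in> carrier M \<Longrightarrow> i x \<oplus>\<^bsub>relabel M\<^esub> i y = i (x \<oplus>\<^bsub>M\<^esub> y)"
    "x \<in> carrier M \<Longrightarrow> a \<odot>\<^bsub>relabel M\<^esub> i x = i (a \<odot>\<^bsub>M\<^esub> x)"
  using inj by (simp_all add: relabel_def Let_def i_def)

lemma relabel_module:
  assumes M: "left_module R M" and inj: "inj_on (relabelling M :: 'v \<Rightarrow> 'u) (carrier M)"
  shows "left_module R (relabel M :: ('r, 'u) module)"
proof -
  interpret M: left_module R M by fact
  note simps = relabel_simps[OF inj]
  have ab: "abelian_group (relabel M :: ('r, 'u) module)"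
    by (rule abelian_groupI)
      (auto simp: simps M.a_ac M.r_neg intro!: bexI[of _ "\<ominus>\<^bsub>M\<^esub> _"] arg_cong[of _ _ "relabelling M"])
  show ?thesis
    by (intro left_module.intro left_module_axioms.intro M.R.ring_axioms ab)
      (auto simp: simps M.smult_closed M.smult_l_distr M.smult_r_distr M.smult_assoc1 M.smult_one)
qed

section \<open>Cardinality of finitely generated modules\<close>

lemma ex_surj_complex_pairs: "\<exists>f :: complex \<Rightarrow> complex \<times> complex. surj f"
proof -
  have "infinite (UNIV :: complex set)" by (rule infinite_UNIV_char_0)
  from card_of_Times_same_infinite[OF this]
  have "|UNIV :: (complex \<times> complex) set| \<le>o |UNIV :: complex set|"
    using ordIso_iff_ordLeq by (metis UNIV_Times_UNIV)
  then obtain g :: "complex \<times> complex \<Rightarrow> complex" where "inj g"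
    using card_of_ordLeq[of "UNIV :: (complex \<times> complex) set" "UNIV :: complex set"] by blast
  then show ?thesis using inj_imp_surj_inv by blast
qed

text \<open>Iterated unpairing; a surjection from \<open>'a\<close> onto the lists of length \<open>n\<close> if \<open>f\<close> is onto.\<close>

primrec decode_list :: "('a \<Rightarrow> 'a \<times> 'a) \<Rightarrow> nat \<Rightarrow> 'a \<Rightarrow> 'a list" where
  "decode_list f 0 z = []"
| "decode_list f (Suc n) z = fst (f z) # decode_list f n (snd (f z))"

lemma ex_surj_complex_list: "\<exists>f :: complex \<Rightarrow> complex list. surj f"
proof -
  obtain f :: "complex \<Rightarrow> complex \<times> complex" where f: "surj f" using ex_surj_complex_pairs by blast
  have dec: "\<exists>z. decode_list f (length xs) z = xs" for xs
  proof (induction xs)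
    case (Cons x xs)
    then obtain z where "decode_list f (length xs) z = xs" by blast
    moreover obtain y where "f y = (x, z)" using f by (metis surjD)
    ultimately show ?case by (intro exI[of _ y]) simp
  qed simp
  \<comment> \<open>The first component encodes the length of the list.\<close>
  define k where "k z = decode_list f (nat \<lfloor>Re (fst (f z))\<rfloor>) (snd (f z))" for z
  have "\<exists>z. xs = k z" for xs
  proof -
    obtain z where z: "decode_list f (length xs) z = xs" using dec by blast
    obtain y where "f y = (of_nat (length xs), z)" using f by (metis surjD)
    then show ?thesis using z by (intro exI[of _ y]) (simp add: k_def)
  qed
  then show ?thesis by (intro exI[of _ k]) (simp add: surj_def)
qed

lemma ex_surj_lists:
  fixes f :: "complex \<Rightarrow> 'a" assumes "surj f" shows "\<exists>g :: complex \<Rightarrow> 'a list. surj g"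
proof -
  obtain k :: "complex \<Rightarrow> complex list" where k: "surj k" using ex_surj_complex_list by blast
  have "surj (map f)"
    by (rule surjI[of _ "map (inv_into UNIV f)"]) (simp add: o_def surj_f_inv_f[OF assms] map_idI)
  then have "surj (map f \<circ> k)" using k by (intro comp_surj)
  then show ?thesis by blast
qed

text \<open>Elements of the Lie algebra are lists of coordinates, and elements of the free algebra are lists
  of words with coefficients.  Lists of complex numbers in turn are parametrized by the complex
  numbers.\<close>

lemma (in fd_lie) ex_surj_uea: "\<exists>f :: complex \<Rightarrow> 'g uea. surj f"
proof -
  obtain k :: "complex \<Rightarrow> complex list" where k: "surj k" using ex_surj_complex_list by blast
  obtain bs where bs: "set bs = Basis" "distinct bs" using finite_distinct_list[OF finite_Basis] by blast
  define comb :: "complex list \<Rightarrow> 'g" where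
    "comb cs = (\<Sum>i<length bs. (cs ! i) *\<^sub>C (bs ! i))" for cs
  have "\<exists>cs. x = comb cs" for x
  proof -
    have "x = (\<Sum>b\<in>Basis. representation Basis x b *\<^sub>C b)"
      using representation_sum_basis[OF independent_Basis span_Basis] by simp
    also have "\<dots> = (\<Sum>i<length bs. representation Basis x (bs ! i) *\<^sub>C (bs ! i))"
      using bij_betw_nth[OF bs(2) refl bs(1)[symmetric]] by (rule sum.reindex_bij_betw[symmetric])
    also have "\<dots> = comb (map (representation Basis x) bs)" by (simp add: comb_def)
    finally show ?thesis by blast
  qed
  then have "surj comb" unfolding surj_def by blast
  then have g: "surj (comb \<circ> k)" using k by (intro comp_surj)
  obtain w :: "complex \<Rightarrow> 'g list" where w: "surj w" using ex_surj_lists[OF g] by blast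
  obtain f :: "complex \<Rightarrow> complex \<times> complex" where f: "surj f" using ex_surj_complex_pairs by blast
  define t where "t z = Poly_Mapping.single (Word (w (fst (f z)))) (snd (f z))" for z
  have tsurj: "\<exists>z. Poly_Mapping.single v c = t z" for v c
  proof -
    obtain a where "w a = letters v" using w by (metis surjD)
    moreover obtain z where "f z = (a, c)" using f by (metis surjD)
    ultimately show ?thesis by (intro exI[of _ z]) (simp add: t_def)
  qed
  obtain l :: "complex \<Rightarrow> complex list" where l: "surj l" using ex_surj_complex_list by blast
  define p where "p z = sum_list (map t (l z))" for z
  have "\<exists>z. a = p z" for a
  proof -
    obtain ws where ws: "set ws = Poly_Mapping.keys a" "distinct ws" using finite_distinct_list[OF finite_keys] by metis
    have "\<forall>v. \<exists>z. Poly_Mapping.single v (Poly_Mapping.lookup a v) = t z" using tsurj by blast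
    from choice[OF this] obtain z where z: "\<And>v. Poly_Mapping.single v (Poly_Mapping.lookup a v) = t (z v)" by blast
    obtain y where y: "l y = map z ws" using l by (metis surjD)
    have "a = sum_list (map (\<lambda>v. Poly_Mapping.single v (Poly_Mapping.lookup a v)) ws)"
      using free_algebra_sum_words[of a] ws by (simp add: sum_list_distinct_conv_sum_set)
    also have "\<dots> = p y" by (simp add: p_def y z o_def)
    finally show ?thesis by blast
  qed
  then have "surj p" unfolding surj_def by blast
  moreover have "surj (abs_uea :: 'g free_algebra \<Rightarrow> 'g uea)"
    unfolding surj_def by (metis Quotient_uea Quotient_abs_rep)
  ultimately have "surj (abs_uea \<circ> p)" by (intro comp_surj)
  then show ?thesis by blast
qed

lemma finitely_generated_relabelling:
  fixes M :: "('s, 'v) module" and \<iota> :: "complex \<Rightarrow> 'u" and f :: "complex \<Rightarrow> 's"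
  assumes \<iota>: "inj \<iota>" and f: "surj f" and M: "left_module R M" and fg: "finitely_generated R M"
  shows "inj_on (relabelling M :: 'v \<Rightarrow> 'u) (carrier M)"
proof -
  interpret M: left_module R M by fact
  obtain S where S: "finite S" "S \<subseteq> carrier M"
    "\<And>x. x \<in> carrier M \<Longrightarrow> \<exists>c\<in>S \<rightarrow> carrier R. x = (\<Oplus>\<^bsub>M\<^esub>s\<in>S. c s \<odot>\<^bsub>M\<^esub> s)"
    using fg unfolding finitely_generated_def by blast
  obtain g :: "complex \<Rightarrow> 's list" where g: "surj g" using ex_surj_lists[OF f] by blast
  obtain xs where xs: "set xs = S" "distinct xs" using finite_distinct_list[OF S(1)] by blast
  define ix where "ix s = (SOME i. i < length xs \<and> xs ! i = s)" for s
  have ix: "ix s < length xs \<and> xs ! ix s = s" if "s \<in> S" for s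
    unfolding ix_def by (rule someI_ex) (use that xs in \<open>metis in_set_conv_nth\<close>)
  define dec where "dec z = (\<Oplus>\<^bsub>M\<^esub>s\<in>S. (g z ! ix s) \<odot>\<^bsub>M\<^esub> s)" for z
  have dec: "\<exists>z. dec z = x" if x: "x \<in> carrier M" for x
  proof -
    obtain c where c: "c \<in> S \<rightarrow> carrier R" "x = (\<Oplus>\<^bsub>M\<^esub>s\<in>S. c s \<odot>\<^bsub>M\<^esub> s)" using S(3)[OF x] by blast
    obtain z where z: "g z = map c xs" using g by (metis surjD)
    have "dec z = x" unfolding dec_def c(2)
      by (rule M.finsum_cong') (use ix c(1) S(2) in \<open>auto simp: z subset_iff intro!: M.smult_closed\<close>)
    then show ?thesis by blast
  qed
  define i where "i x = \<iota> (SOME z. dec z = x)" for x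
  have "inj_on i (carrier M)"
  proof (rule inj_onI)
    fix x y assume xy: "x \<in> carrier M" "y \<in> carrier M" "i x = i y"
    have "dec (SOME z. dec z = x) = x" "dec (SOME z. dec z = y) = y"
      using dec xy by (auto intro: someI_ex)
    moreover have "(SOME z. dec z = x) = (SOME z. dec z = y)" using xy(3) \<iota> by (simp add: i_def inj_def)
    ultimately show "x = y" by metis
  qed
  then show ?thesis unfolding relabelling_def by (rule someI[of "\<lambda>i. inj_on i (carrier M)"])
qed

section \<open>The tensor functor\<close>

context balanced_pair
begin

lemma tensor_map_acoset:
  assumes W: "balanced_pair S R W Q" and \<phi>: "\<phi> \<in> module_homs R V W"
  defines "\<psi> \<equiv> frag_extend (\<lambda>(q, v). frag_of (q, \<phi> v))"
  shows "tensor_map R Q W \<phi> (acoset K c) = acoset (tensor_kernel R Q W) (\<psi> c)"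
proof -
  interpret W: balanced_pair S R W Q by fact
  note \<phi>D = module_homsD[OF \<phi>]
  have \<psi>: "\<psi> (frag_of (q, v)) = frag_of (q, \<phi> v)" "\<psi> (a + b) = \<psi> a + \<psi> b" "\<psi> (a - b) = \<psi> a - \<psi> b" "\<psi> (- a) = - \<psi> a" "\<psi> 0 = 0"
    for q v a b by (simp_all add: \<psi>_def frag_extend_add frag_extend_diff frag_extend_minus)
  have rel: "\<psi> r \<in> W.K" if "r \<in> tensor_relations R Q V" for r
  proof -
    have "\<psi> r \<in> tensor_relations R Q W"
      using that by cases (simp_all add: \<psi> \<phi>D tensor_relations.intros)
    then show ?thesis by (rule W.kernel_rel)
  qed
  have \<psi>K: "\<psi> z \<in> W.K" if "z \<in> K" for z
    using that
  proof (induction rule: kernel_induct)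
    case (minus r)
    then show ?case using rel W.kernel_minus by (simp add: \<psi>)
  next
    case (add a b)
    then show ?case using W.kernel_add by (simp add: \<psi>)
  qed (use rel W.kernel_zero in \<open>simp_all add: \<psi>\<close>)
  have "tensor_map R Q W \<phi> (acoset K c) = (\<Union>d\<in>acoset K c. acoset W.K (\<psi> d))"
    by (simp add: tensor_map_def W.r_coset_eq \<psi>_def)
  also have "\<dots> = acoset W.K (\<psi> c)"
    by (rule acoset_map[OF kernel_subgroup W.kernel_subgroup])
      (simp add: mem_acoset \<psi>(3)[symmetric] \<psi>K)
  finally show ?thesis .
qed

lemma tensor_map_props:
  fixes W :: "('r, 'w) module"
  assumes W: "balanced_pair S R W Q" and \<phi>: "\<phi> \<in> module_homs R V W"
  shows "t \<in> carrier T \<Longrightarrow> tensor_map R Q W \<phi> t \<in> carrier (tensor_product R Q W)"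
    and "t \<in> carrier T \<Longrightarrow> u \<in> carrier T \<Longrightarrow>
      tensor_map R Q W \<phi> (t \<oplus>\<^bsub>T\<^esub> u) = tensor_map R Q W \<phi> t \<oplus>\<^bsub>tensor_product R Q W\<^esub> tensor_map R Q W \<phi> u"
    and "s \<in> carrier S \<Longrightarrow> t \<in> carrier T \<Longrightarrow>
      tensor_map R Q W \<phi> (s \<odot>\<^bsub>T\<^esub> t) = s \<odot>\<^bsub>tensor_product R Q W\<^esub> tensor_map R Q W \<phi> t"
    and "tensor_map R Q W \<phi> (pure_tensor q v) = balanced_pair.pure_tensor R W Q q (\<phi> v)"
proof -
  interpret W: balanced_pair S R W Q by fact
  note \<phi>D = module_homsD[OF \<phi>]
  define \<psi> where "\<psi> = frag_extend (\<lambda>(q, v). frag_of (q, \<phi> v) :: 'q \<times> 'w \<Rightarrow>\<^sub>0 int)"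
  have \<psi>: "\<psi> (frag_of (q, v)) = frag_of (q, \<phi> v)" "\<psi> (a + b) = \<psi> a + \<psi> b" "\<psi> (a - b) = \<psi> a - \<psi> b" "\<psi> 0 = 0"
    for q v a b by (simp_all add: \<psi>_def frag_extend_add frag_extend_diff)
  have map: "tensor_map R Q W \<phi> (acoset K c) = acoset W.K (\<psi> c)" for c
    unfolding \<psi>_def by (rule tensor_map_acoset[OF W \<phi>])
  have supp: "W.supported (\<psi> c)" if "supported c" for c
    using that
  proof (induction rule: frag_induction)
    case (one x)
    then obtain q v where "x = (q, v)" "q \<in> carrier Q" "v \<in> carrier V" by blast
    then show ?case using \<phi>D(1) by (simp add: \<psi>)
  next
    case (diff a b)
    then show ?case unfolding \<psi> by (rule W.supported_diff)
  qed (simp add: \<psi>)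
  show "tensor_map R Q W \<phi> t \<in> carrier (tensor_product R Q W)" if "t \<in> carrier T"
    using that by (elim T_carrierE) (simp only: map W.T_carrierI supp)
  show "tensor_map R Q W \<phi> (t \<oplus>\<^bsub>T\<^esub> u) = tensor_map R Q W \<phi> t \<oplus>\<^bsub>W.T\<^esub> tensor_map R Q W \<phi> u"
    if "t \<in> carrier T" "u \<in> carrier T"
    using that by (elim T_carrierE) (simp only: map T_add W.T_add \<psi>)
  show "tensor_map R Q W \<phi> (pure_tensor q v) = W.pure_tensor q (\<phi> v)"
    unfolding pure_tensor_def W.pure_tensor_def map \<psi> ..
  show "tensor_map R Q W \<phi> (s \<odot>\<^bsub>T\<^esub> t) = s \<odot>\<^bsub>W.T\<^esub> tensor_map R Q W \<phi> t" if s: "s \<in> carrier S" and t: "t \<in> carrier T"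
  proof -
    obtain c where c: "supported c" "t = acoset K c" using t by (elim T_carrierE)
    have "\<psi> (act s c) = W.act s (\<psi> c)" using c(1)
    proof (induction rule: frag_induction)
      case (one x)
      then show ?case by (cases x) (simp add: \<psi> act_simps W.act_simps)
    qed (simp_all add: \<psi> act_simps W.act_simps)
    then show ?thesis by (simp only: c T_smult[OF s] W.T_smult[OF s] map)
  qed
qed

end

text \<open>The tensor product transported into the type of \<open>V\<close>.  Below \<open>TV\<close> is this module and \<open>tp q v\<close> is
  the element of it that corresponds to \<open>q \<otimes> v\<close>.\<close>

locale relabelled_pair = balanced_pair S R V Q
  for S :: "'s ring" and R :: "'r ring" and V :: "('r, 'u) module" and Q :: "('s, 'q, 'r) bimodule" +
  assumes inj: "inj_on (relabelling (tensor_product R Q V) :: ('q \<times> 'u \<Rightarrow>\<^sub>0 int) set \<Rightarrow> 'u) (carrier (tensor_product R Q V))"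
begin

definition TV :: "('s, 'u) module" where "TV = relabel T"

abbreviation "lab \<equiv> relabelling T :: ('q \<times> 'u \<Rightarrow>\<^sub>0 int) set \<Rightarrow> 'u"

definition tp :: "'q \<Rightarrow> 'u \<Rightarrow> 'u" where "tp q v = lab (pure_tensor q v)"

lemma TV_simps:
  "carrier TV = lab ` carrier T" "\<zero>\<^bsub>TV\<^esub> = lab \<zero>\<^bsub>T\<^esub>"
  "x \<in> carrier T \<Longrightarrow> y \<in> carrier T \<Longrightarrow> lab x \<oplus>\<^bsub>TV\<^esub> lab y = lab (x \<oplus>\<^bsub>T\<^esub> y)"
  "x \<in> carrier T \<Longrightarrow> a \<odot>\<^bsub>TV\<^esub> lab x = lab (a \<odot>\<^bsub>T\<^esub> x)"
  unfolding TV_def using relabel_simps[OF inj] by blast+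

lemma TV_module: "left_module S TV"
  unfolding TV_def by (rule relabel_module[OF T_module inj])

lemma tp_closed: "q \<in> carrier Q \<Longrightarrow> v \<in> carrier V \<Longrightarrow> tp q v \<in> carrier TV"
  unfolding tp_def TV_simps using pure_tensor_closed by blast

lemma tp_add_right: "q \<in> carrier Q \<Longrightarrow> v \<in> carrier V \<Longrightarrow> w \<in> carrier V \<Longrightarrow> tp q (v \<oplus>\<^bsub>V\<^esub> w) = tp q v \<oplus>\<^bsub>TV\<^esub> tp q w"
  unfolding tp_def by (simp add: TV_simps pure_tensor_closed pure_tensor_add_right)

lemma tp_balanced: "q \<in> carrier Q \<Longrightarrow> r \<in> carrier R \<Longrightarrow> v \<in> carrier V \<Longrightarrow> tp (rsmult Q q r) v = tp q (r \<odot>\<^bsub>V\<^esub> v)"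
  unfolding tp_def by (simp add: pure_tensor_balanced)

lemma tp_smult: "s \<in> carrier S \<Longrightarrow> q \<in> carrier Q \<Longrightarrow> v \<in> carrier V \<Longrightarrow> s \<odot>\<^bsub>TV\<^esub> tp q v = tp (s \<odot>\<^bsub>Q\<^esub> q) v"
  unfolding tp_def by (simp add: TV_simps pure_tensor_closed pure_tensor_smult)

lemma TV_induct [consumes 1, case_names zero tp diff]:
  assumes "t \<in> carrier TV" and "P \<zero>\<^bsub>TV\<^esub>" and "\<And>q v. q \<in> carrier Q \<Longrightarrow> v \<in> carrier V \<Longrightarrow> P (tp q v)"
    and "\<And>a b. a \<in> carrier TV \<Longrightarrow> b \<in> carrier TV \<Longrightarrow> P a \<Longrightarrow> P b \<Longrightarrow> P (a \<ominus>\<^bsub>TV\<^esub> b)"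
  shows "P t"
proof -
  interpret T: left_module S T by (rule T_module)
  interpret TV: left_module S TV by (rule TV_module)
  obtain x where x: "x \<in> carrier T" "t = lab x" using assms(1) by (auto simp: TV_simps)
  have "P (lab x)" using x(1)
  proof (induction rule: T_induct)
    case zero
    then show ?case using assms(2) by (simp add: TV_simps)
  next
    case (pure_tensor q v)
    then show ?case using assms(3) by (simp add: tp_def)
  next
    case (diff a b)
    have ab: "a \<ominus>\<^bsub>T\<^esub> b \<in> carrier T" using diff by simp
    have "lab (a \<ominus>\<^bsub>T\<^esub> b) \<oplus>\<^bsub>TV\<^esub> lab b = lab a"
      using diff ab by (simp add: TV_simps) (simp add: a_minus_def T.M.a_assoc T.M.l_neg)
    moreover have "lab (a \<ominus>\<^bsub>T\<^esub> b) \<in> carrier TV" "lab b \<in> carrier TV" "lab a \<in> carrier TV"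
      using diff ab by (auto simp: TV_simps)
    ultimately have "lab (a \<ominus>\<^bsub>T\<^esub> b) = lab a \<ominus>\<^bsub>TV\<^esub> lab b"
      by (metis TV.M.a_assoc TV.M.a_inv_closed TV.M.r_neg TV.M.r_zero a_minus_def)
    then show ?case using assms(4)[of "lab a" "lab b"] diff by (auto simp: TV_simps)
  qed
  then show ?thesis by (simp add: x)
qed

lemma tp_eqD:
  assumes "q \<in> carrier Q" "v \<in> carrier V" "p \<in> carrier Q" "w \<in> carrier V" "tp q v = tp p w"
  shows "frag_of (q, v) - frag_of (p, w) \<in> K"
proof -
  have "pure_tensor q v = pure_tensor p w"
    using assms inj_onD[OF inj] pure_tensor_closed unfolding tp_def by metis
  then show ?thesis unfolding pure_tensor_def acoset_eq_iff[OF kernel_subgroup] .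
qed

lemma TV_universal:
  assumes A: "abelian_group A"
    and \<beta>: "\<And>q v. q \<in> carrier Q \<Longrightarrow> v \<in> carrier V \<Longrightarrow> \<beta> q v \<in> carrier A"
    and \<beta>1: "\<And>p q v. p \<in> carrier Q \<Longrightarrow> q \<in> carrier Q \<Longrightarrow> v \<in> carrier V \<Longrightarrow> \<beta> (p \<oplus>\<^bsub>Q\<^esub> q) v = \<beta> p v \<oplus>\<^bsub>A\<^esub> \<beta> q v"
    and \<beta>2: "\<And>q v w. q \<in> carrier Q \<Longrightarrow> v \<in> carrier V \<Longrightarrow> w \<in> carrier V \<Longrightarrow> \<beta> q (v \<oplus>\<^bsub>V\<^esub> w) = \<beta> q v \<oplus>\<^bsub>A\<^esub> \<beta> q w"
    and \<beta>3: "\<And>q r v. q \<in> carrier Q \<Longrightarrow> r \<in> carrier R \<Longrightarrow> v \<in> carrier V \<Longrightarrow> \<beta> (rsmult Q q r) v = \<beta> q (r \<odot>\<^bsub>V\<^esub> v)"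
  shows "\<exists>g. (\<forall>t\<in>carrier TV. g t \<in> carrier A) \<and>
     (\<forall>s\<in>carrier TV. \<forall>t\<in>carrier TV. g (s \<oplus>\<^bsub>TV\<^esub> t) = g s \<oplus>\<^bsub>A\<^esub> g t) \<and>
     (\<forall>q\<in>carrier Q. \<forall>v\<in>carrier V. g (tp q v) = \<beta> q v)"
proof -
  interpret T: left_module S T by (rule T_module)
  obtain g where g: "\<And>t. t \<in> carrier T \<Longrightarrow> g t \<in> carrier A"
    "\<And>s t. s \<in> carrier T \<Longrightarrow> t \<in> carrier T \<Longrightarrow> g (s \<oplus>\<^bsub>T\<^esub> t) = g s \<oplus>\<^bsub>A\<^esub> g t"
    "\<And>q v. q \<in> carrier Q \<Longrightarrow> v \<in> carrier V \<Longrightarrow> g (pure_tensor q v) = \<beta> q v"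
    using T_universal[OF A \<beta> \<beta>1 \<beta>2 \<beta>3] by blast
  let ?g = "\<lambda>x. g (inv_into (carrier T) lab x)"
  show ?thesis
    by (rule exI[of _ ?g]) (auto simp: TV_simps g tp_def pure_tensor_closed inj)
qed

text \<open>Homomorphisms out of a tensor product are determined by their values on pure tensors.\<close>

lemma TV_hom_ext:
  assumes N: "left_module S N" and f: "f \<in> module_homs S TV N" and g: "g \<in> module_homs S TV N"
    and eq: "\<And>q v. q \<in> carrier Q \<Longrightarrow> v \<in> carrier V \<Longrightarrow> f (tp q v) = g (tp q v)"
  shows "f = g"
proof (rule module_homs_ext[OF f g refl])
  interpret N: left_module S N by fact
  interpret TV: left_module S TV by (rule TV_module)
  note fD = module_homsD[OF f] and gD = module_homsD[OF g]
  fix t assume "t \<in> carrier TV"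
  then show "f t = g t"
  proof (induction rule: TV_induct)
    case zero
    show ?case using module_homs_zero[OF TV_module N f] module_homs_zero[OF TV_module N g] by simp
  next
    case (tp q v)
    then show ?case by (rule eq)
  next
    case (diff a b)
    have "a \<ominus>\<^bsub>TV\<^esub> b = a \<oplus>\<^bsub>TV\<^esub> (\<ominus>\<^bsub>S\<^esub> \<one>\<^bsub>S\<^esub>) \<odot>\<^bsub>TV\<^esub> b"
      using diff TV.minus_smult by (simp add: a_minus_def)
    then show ?case using diff fD gD by (simp add: TV.smult_closed)
  qed
qed

lemma tensor_functor_omap: "omap (tensor_functor R Q) V = TV"
  by (simp add: tensor_functor_def TV_def)

lemma tensor_functor_amap:
  assumes W: "relabelled_pair S R W Q" and \<phi>: "\<phi> \<in> module_homs R V W"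
  shows "amap (tensor_functor R Q) V W \<phi> \<in> module_homs S TV (relabelled_pair.TV R W Q)"
    and "q \<in> carrier Q \<Longrightarrow> v \<in> carrier V \<Longrightarrow>
      amap (tensor_functor R Q) V W \<phi> (tp q v) = relabelled_pair.tp R W Q q (\<phi> v)"
proof -
  interpret W: relabelled_pair S R W Q by fact
  interpret T: left_module S T by (rule T_module)
  note props = tensor_map_props[OF W.balanced_pair_axioms \<phi>]
  let ?F = "amap (tensor_functor R Q) V W \<phi>"
  have F: "?F (lab x) = W.lab (tensor_map R Q W \<phi> x)" if "x \<in> carrier T" for x
    using that inj TV_simps(1) unfolding tensor_functor_def TV_def by simp
  show "?F \<in> module_homs S TV W.TV"
    unfolding module_homs_def
  proof (intro CollectI conjI ballI PiE_I)
    fix x assume "x \<in> carrier TV"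
    then obtain t where "t \<in> carrier T" "x = lab t" by (auto simp: TV_simps)
    then show "?F x \<in> carrier W.TV" using props(1) by (simp add: F W.TV_simps)
  next
    fix x assume "x \<notin> carrier TV"
    then show "?F x = undefined" by (simp add: tensor_functor_def TV_def)
  next
    fix x y assume "x \<in> carrier TV" "y \<in> carrier TV"
    then obtain t u where "t \<in> carrier T" "x = lab t" "u \<in> carrier T" "y = lab u" by (auto simp: TV_simps)
    then show "?F (x \<oplus>\<^bsub>TV\<^esub> y) = ?F x \<oplus>\<^bsub>W.TV\<^esub> ?F y" using props(1,2) by (simp add: TV_simps F W.TV_simps)
  next
    fix s x assume "s \<in> carrier S" "x \<in> carrier TV"
    then obtain t where "s \<in> carrier S" "t \<in> carrier T" "x = lab t" by (auto simp: TV_simps)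
    then show "?F (s \<odot>\<^bsub>TV\<^esub> x) = s \<odot>\<^bsub>W.TV\<^esub> ?F x"
      using props(1,3) by (simp add: TV_simps F W.TV_simps T.smult_closed)
  qed
  show "?F (tp q v) = W.tp q (\<phi> v)" if "q \<in> carrier Q" "v \<in> carrier V"
    using that pure_tensor_closed props(4) by (simp add: tp_def W.tp_def F)
qed

end

lemma tensor_functor_is_functor:
  assumes pair: "\<And>V. left_module R V \<Longrightarrow> P V \<Longrightarrow> relabelled_pair S R V Q"
    and obj: "\<And>V. left_module R V \<Longrightarrow> P V \<Longrightarrow> P' (omap (tensor_functor R Q) V)"
  shows "is_functor (module_cat R P) (module_cat S P') (tensor_functor R Q)"
  unfolding is_functor_def module_cat_simps
proof (intro conjI ballI)
  fix X assume X: "X \<in> {M. left_module R M \<and> P M}"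
  then interpret X: relabelled_pair S R X Q using pair by simp
  show "omap (tensor_functor R Q) X \<in> {M. left_module S M \<and> P' M}"
    using X obj[of X] X.TV_module by (simp add: X.tensor_functor_omap)
  have id: "(\<lambda>x\<in>carrier X. x) \<in> module_homs R X X" using X by (intro module_homs_ident) simp
  have "amap (tensor_functor R Q) X X (\<lambda>x\<in>carrier X. x) = (\<lambda>x\<in>carrier X.TV. x)"
    by (rule X.TV_hom_ext[OF X.TV_module X.tensor_functor_amap(1)[OF X.relabelled_pair_axioms id] module_homs_ident[OF X.TV_module]])
      (simp add: X.tensor_functor_amap(2)[OF X.relabelled_pair_axioms id] X.tp_closed)
  then show "amap (tensor_functor R Q) X X (\<lambda>x\<in>carrier X. x) = (\<lambda>x\<in>carrier (omap (tensor_functor R Q) X). x)"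
    by (simp add: X.tensor_functor_omap)
next
  fix X Y f assume X: "X \<in> {M. left_module R M \<and> P M}" and Y: "Y \<in> {M. left_module R M \<and> P M}"
    and f: "f \<in> module_homs R X Y"
  interpret X: relabelled_pair S R X Q using pair X by simp
  interpret Y: relabelled_pair S R Y Q using pair Y by simp
  show "amap (tensor_functor R Q) X Y f \<in> module_homs S (omap (tensor_functor R Q) X) (omap (tensor_functor R Q) Y)"
    unfolding X.tensor_functor_omap Y.tensor_functor_omap
    by (rule X.tensor_functor_amap(1)[OF Y.relabelled_pair_axioms f])
next
  fix X Y Z f g
  assume X: "X \<in> {M. left_module R M \<and> P M}" and Y: "Y \<in> {M. left_module R M \<and> P M}" and Z: "Z \<in> {M. left_module R M \<and> P M}"
    and f: "f \<in> module_homs R X Y" and g: "g \<in> module_homs R Y Z"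
  interpret X: relabelled_pair S R X Q using pair X by simp
  interpret Y: relabelled_pair S R Y Q using pair Y by simp
  interpret Z: relabelled_pair S R Z Q using pair Z by simp
  have gf: "compose (carrier X) g f \<in> module_homs R X Z" using X by (intro module_homs_compose[OF f g]) simp
  note Ff = X.tensor_functor_amap[OF Y.relabelled_pair_axioms f]
  note Fg = Y.tensor_functor_amap[OF Z.relabelled_pair_axioms g]
  note Fgf = X.tensor_functor_amap[OF Z.relabelled_pair_axioms gf]
  have "amap (tensor_functor R Q) X Z (compose (carrier X) g f)
    = compose (carrier X.TV) (amap (tensor_functor R Q) Y Z g) (amap (tensor_functor R Q) X Y f)"
  proof (rule X.TV_hom_ext[OF Z.TV_module Fgf(1) module_homs_compose[OF Ff(1) Fg(1) X.TV_module]])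
    fix q v assume qv: "q \<in> carrier Q" "v \<in> carrier X"
    then have "f v \<in> carrier Y" using module_homsD[OF f] by simp
    then show "amap (tensor_functor R Q) X Z (compose (carrier X) g f) (X.tp q v)
      = compose (carrier X.TV) (amap (tensor_functor R Q) Y Z g) (amap (tensor_functor R Q) X Y f) (X.tp q v)"
      using qv by (simp add: Fgf Ff Fg compose_eq X.tp_closed)
  qed
  then show "amap (tensor_functor R Q) X Z (compose (carrier X) g f)
    = compose (carrier (omap (tensor_functor R Q) X)) (amap (tensor_functor R Q) Y Z g) (amap (tensor_functor R Q) X Y f)"
    by (simp add: X.tensor_functor_omap)
qed (rule module_cat_is_category)+

section \<open>Modules over the enveloping algebra\<close>

lemma uea_ring_simps [simp]: "carrier uea_ring = UNIV" "a \<otimes>\<^bsub>uea_ring\<^esub> b = a * b" "\<one>\<^bsub>uea_ring\<^esub> = 1"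
  "\<zero>\<^bsub>uea_ring\<^esub> = 0" "a \<oplus>\<^bsub>uea_ring\<^esub> b = a + b"
  by (simp_all add: uea_ring_def)

lemma ring_uea_ring: "ring (uea_ring :: 'g::complex_lie_algebra uea ring)"
proof (rule ringI)
  show "abelian_group (uea_ring :: 'g uea ring)"
    by (rule abelian_groupI) (auto simp: algebra_simps intro: exI[of _ "- _"])
  show "monoid (uea_ring :: 'g uea ring)" by (rule monoidI) (auto simp: mult.assoc)
qed (auto simp: algebra_simps)

locale uea_mod = left_module uea_ring E for E :: "('g::complex_lie_algebra uea, 'v) module" (structure)
begin

lemma act_closed: "x \<in> carrier E \<Longrightarrow> a \<odot> x \<in> carrier E"
  using smult_closed[of a x] by simp

lemma act_add: "x \<in> carrier E \<Longrightarrow> (a + b) \<odot> x = a \<odot> x \<oplus> b \<odot> x"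
  using smult_l_distr[of a b x] by simp

lemma act_mult: "x \<in> carrier E \<Longrightarrow> (a * b) \<odot> x = a \<odot> (b \<odot> x)"
  using smult_assoc1[of a b x] by simp

lemma act_one: "x \<in> carrier E \<Longrightarrow> 1 \<odot> x = x"
  using smult_one[of x] by simp

lemma act_zero: "x \<in> carrier E \<Longrightarrow> 0 \<odot> x = \<zero>"
  using smult_l_null[of x] by simp

lemma act_null: "a \<odot> \<zero> = \<zero>"
  using smult_r_null[of a] by simp

lemma act_distr: "x \<in> carrier E \<Longrightarrow> y \<in> carrier E \<Longrightarrow> a \<odot> (x \<oplus> y) = a \<odot> x \<oplus> a \<odot> y"
  using smult_r_distr[of a x y] by simp

lemma act_diff: assumes x: "x \<in> carrier E" shows "(a - b) \<odot> x = a \<odot> x \<ominus> b \<odot> x"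
proof -
  have "a \<odot> x = (a - b) \<odot> x \<oplus> b \<odot> x" using act_add[OF x, of "a - b" b] by simp
  then show ?thesis using x act_closed by (simp add: a_minus_def M.a_assoc M.r_neg)
qed

lemma act_rdiff: "x \<in> carrier E \<Longrightarrow> y \<in> carrier E \<Longrightarrow> a \<odot> (x \<ominus> y) = a \<odot> x \<ominus> a \<odot> y"
  using smult_r_minus[of a y] by (simp add: a_minus_def act_distr)

lemma submodD:
  assumes "submod W"
  shows "W \<subseteq> carrier E" "\<zero> \<in> W" "x \<in> W \<Longrightarrow> y \<in> W \<Longrightarrow> x \<oplus> y \<in> W" "x \<in> W \<Longrightarrow> a \<odot> x \<in> W"
  using assms by (auto simp: submod_def)

lemma submodI:
  assumes "W \<subseteq> carrier E" "\<zero> \<in> W" "\<And>x y. x \<in> W \<Longrightarrow> y \<in> W \<Longrightarrow> x \<oplus> y \<in> W" "\<And>a x. x \<in> W \<Longrightarrow> a \<odot> x \<in> W"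
  shows "submod W"
  using assms by (auto simp: submod_def)

end

context whittaker_pair
begin

section \<open>Whittaker modules\<close>

lemma chi_bracket_m: assumes "x \<in> \<mm>" "y \<in> \<mm>" shows "\<chi> (bracket x y) = 0"
proof -
  have *: "\<chi> (bracket x y) = 0" if x: "x \<in> M d" "1 \<le> d" for x d
    using assms(2) unfolding \<mm>_def
  proof (induction rule: span_induct_alt)
    case (step c y z)
    then show ?case using M_bracket(2)[OF x(1) _ x(2)]
      by (auto simp: bracket_add_right bracket_cscale_right chi_add chi_scale)
  qed simp
  show ?thesis using assms(1) unfolding \<mm>_def
  proof (induction rule: span_induct_alt)
    case (step c x z)
    then show ?case using * by (auto simp: bracket_add_left bracket_cscale_left chi_add chi_scale)
  qed simp
qed

lemma bracket_deeper:
  assumes x: "x \<in> \<mm>" and y: "y \<in> span (\<Union>d\<in>{k..}. M d)" and k: "1 \<le> k"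
  shows "bracket x y \<in> span (\<Union>d\<in>{Suc k..}. M d)"
proof -
  have *: "bracket x y \<in> span (\<Union>d\<in>{Suc k..}. M d)" if xc: "x \<in> M c" "1 \<le> c" for x c
    using y
  proof (induction rule: span_induct_alt)
    case base
    then show ?case by (simp add: span_zero)
  next
    case (step a y z)
    then obtain d where d: "k \<le> d" "y \<in> M d" by auto
    then have "bracket x y \<in> M (c + d)" using M_bracket(1)[OF xc(1) d(2) xc(2)] k by simp
    moreover have "c + d \<in> {Suc k..}" using d xc by simp
    ultimately have "bracket x y \<in> span (\<Union>d\<in>{Suc k..}. M d)" by (intro span_base) blast
    then show ?case using step by (simp add: bracket_add_right bracket_cscale_right span_add span_scale)
  qed
  show ?thesis using x unfolding \<mm>_def
  proof (induction rule: span_induct_alt)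
    case base
    then show ?case by (simp add: span_zero)
  next
    case (step a x z)
    then show ?case using * by (auto simp: bracket_add_left bracket_cscale_left intro!: span_add span_scale)
  qed
qed

lemma m_subalg: "subalg \<mm>"
proof -
  have "bracket x y \<in> \<mm>" if "x \<in> \<mm>" "y \<in> \<mm>" for x y
  proof -
    have "bracket x y \<in> span (\<Union>d\<in>{Suc 1..}. M d)"
      using that by (intro bracket_deeper) (auto simp: \<mm>_def)
    also have "\<dots> \<subseteq> \<mm>" unfolding \<mm>_def by (intro span_mono UN_mono) auto
    finally show ?thesis .
  qed
  then show ?thesis by (auto simp: subalg_def \<mm>_def)
qed

lemma m_ad_nilpotent: assumes "x \<in> \<mm>" "y \<in> \<mm>" shows "\<exists>n. (bracket x ^^ n) y = 0"
proof -
  have "(bracket x ^^ n) y \<in> span (\<Union>d\<in>{Suc n..}. M d)" for n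
  proof (induction n)
    case 0
    then show ?case using assms(2) by (simp add: \<mm>_def)
  next
    case (Suc n)
    then show ?case using bracket_deeper[OF assms(1), of _ "Suc n"] by simp
  qed
  from this[of D] have "(bracket x ^^ D) y \<in> span (\<Union>d\<in>{Suc D..}. M d)" .
  also have "\<dots> \<subseteq> span {0}" by (rule span_mono) (use M_bound in auto)
  finally show ?thesis by auto
qed

text \<open>Engel's theorem for the action of \<open>\<mm>\<close> on \<open>W / W'\<close> by the operators \<open>\<rho> x\<close>.  These form a
  representation because \<open>\<chi>\<close> vanishes on the commutators of elements of \<open>\<mm>\<close>.\<close>

lemma whittaker_engel:
  assumes E: "left_module uea_ring E" and lw: "locally_whittaker \<chi> \<mm> E"
    and W: "left_module.submod uea_ring E W" "left_module.submod uea_ring E W'" "W' \<subset> W"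
  shows "\<exists>v\<in>W - W'. \<forall>x\<in>\<mm>. \<rho> x \<odot>\<^bsub>E\<^esub> v \<in> W'"
proof -
  interpret E: uea_mod E using E by (simp add: uea_mod_def)
  note WD = E.submodD[OF W(1)] and WD' = E.submodD[OF W(2)]
  show ?thesis
  proof (rule engel_pair[where \<rho> = "\<lambda>x v. \<rho> x \<odot>\<^bsub>E\<^esub> v", OF m_subalg])
    show "\<exists>w\<in>\<mm> - K. \<forall>k\<in>K. bracket k w \<in> K" if "subalg K" "K \<subset> \<mm>" for K
      using engel_normalizer[OF m_subalg m_ad_nilpotent that] .
    show "\<exists>n. ((\<lambda>v. \<rho> x \<odot>\<^bsub>E\<^esub> v) ^^ n) v \<in> W'" if x: "x \<in> \<mm>" and v: "v \<in> W" for x v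
    proof -
      have vE: "v \<in> carrier E" using v WD by blast
      have pow: "((\<lambda>v. \<rho> x \<odot>\<^bsub>E\<^esub> v) ^^ n) v = (\<rho> x ^ n) \<odot>\<^bsub>E\<^esub> v" for n
        by (induction n) (simp_all add: E.act_one E.act_mult vE)
      obtain n where "(\<rho> x ^ n) \<odot>\<^bsub>E\<^esub> v = \<zero>\<^bsub>E\<^esub>" using lw x vE by (auto simp: locally_whittaker_def)
      then show ?thesis using WD'(2) pow by metis
    qed
    show "\<rho> x \<odot>\<^bsub>E\<^esub> (\<rho> y \<odot>\<^bsub>E\<^esub> v) \<in> W'"
      if xy: "x \<in> \<mm>" "y \<in> \<mm>" "v \<in> W" and W': "\<rho> y \<odot>\<^bsub>E\<^esub> (\<rho> x \<odot>\<^bsub>E\<^esub> v) \<in> W'" "\<rho> (bracket x y) \<odot>\<^bsub>E\<^esub> v \<in> W'" for x y v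
    proof -
      have vE: "v \<in> carrier E" using xy WD by blast
      have "\<rho> x * \<rho> y = \<rho> y * \<rho> x + \<rho> (bracket x y)"
        using rho_rho[of x y] chi_bracket_m[OF xy(1,2)] by (simp add: whit_shift_def)
      then have "\<rho> x \<odot>\<^bsub>E\<^esub> (\<rho> y \<odot>\<^bsub>E\<^esub> v) = \<rho> y \<odot>\<^bsub>E\<^esub> (\<rho> x \<odot>\<^bsub>E\<^esub> v) \<oplus>\<^bsub>E\<^esub> \<rho> (bracket x y) \<odot>\<^bsub>E\<^esub> v"
        using vE by (metis E.act_mult E.act_add)
      then show ?thesis using W' WD'(3) by simp
    qed
    show "\<rho> (x + c *\<^sub>C y) \<odot>\<^bsub>E\<^esub> v \<in> W'" if "v \<in> W" "\<rho> x \<odot>\<^bsub>E\<^esub> v \<in> W'" "\<rho> y \<odot>\<^bsub>E\<^esub> v \<in> W'" for x y c v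
      using that WD WD' by (simp add: rho_add rho_scale E.act_add E.act_mult subset_iff)
    show "\<rho> 0 \<odot>\<^bsub>E\<^esub> v \<in> W'" if "v \<in> W" for v
      using that WD WD' by (simp add: E.act_zero subset_iff)
  qed (use W(3) WD WD' in auto)
qed

definition kills :: "('g uea, 'v) module \<Rightarrow> nat \<Rightarrow> 'v \<Rightarrow> bool" where
  "kills E n v \<longleftrightarrow> (\<forall>a. J n a \<longrightarrow> a \<odot>\<^bsub>E\<^esub> v = \<zero>\<^bsub>E\<^esub>)"

lemma kills_mono: "kills E n v \<Longrightarrow> n \<le> m \<Longrightarrow> kills E m v"
  using J_antimono by (auto simp: kills_def)

text \<open>The vectors killed by some \<open>J n\<close> form a submodule.  If it were proper, Engel's theorem would yield
  a vector \<open>v\<close> outside with all \<open>\<rho> x v\<close> inside.  As \<open>\<mm>\<close> is finite-dimensional, one \<open>J N\<close> kills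
  all of these.  But then \<open>J (N + D + 1)\<close> kills \<open>v\<close>, since the last factor of a product has depth at
  most \<open>D\<close>.\<close>

lemma whittaker_killed:
  assumes E: "left_module uea_ring E" and lw: "locally_whittaker \<chi> \<mm> E" and u: "u \<in> carrier E"
  shows "\<exists>n. kills E n u"
proof -
  interpret E: uea_mod E using E by (simp add: uea_mod_def)
  define W where "W = {v \<in> carrier E. \<exists>n. kills E n v}"
  have kadd: "kills E n (v \<oplus>\<^bsub>E\<^esub> w)" if "v \<in> carrier E" "w \<in> carrier E" "kills E n v" "kills E n w" for n v w
    using that by (simp add: kills_def E.act_distr)
  have W: "E.submod W"
  proof (rule E.submodI)
    show "\<zero>\<^bsub>E\<^esub> \<in> W" by (simp add: W_def kills_def E.act_null)
  next
    fix x y assume "x \<in> W" "y \<in> W"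
    then obtain n m where *: "x \<in> carrier E" "y \<in> carrier E" "kills E n x" "kills E m y" by (auto simp: W_def)
    then have "kills E (max n m) (x \<oplus>\<^bsub>E\<^esub> y)" by (intro kadd) (auto intro: kills_mono)
    then show "x \<oplus>\<^bsub>E\<^esub> y \<in> W" using * by (auto simp: W_def)
  next
    fix a x assume "x \<in> W"
    then obtain n where n: "x \<in> carrier E" "kills E n x" by (auto simp: W_def)
    obtain k where "\<And>n b. J (n + k) b \<Longrightarrow> J n (b * a)" using J_absorb[of a] by blast
    then have "kills E (n + k) (a \<odot>\<^bsub>E\<^esub> x)" using n by (simp add: kills_def E.act_mult[symmetric])
    then show "a \<odot>\<^bsub>E\<^esub> x \<in> W" using n E.act_closed by (auto simp: W_def)
  qed (simp add: W_def)
  have "W = carrier E"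
  proof (rule ccontr)
    assume "W \<noteq> carrier E"
    then have "W \<subset> carrier E" by (auto simp: W_def)
    from whittaker_engel[OF E lw E.submod_carrier W this]
    obtain v where v: "v \<in> carrier E" "v \<notin> W" "\<And>x. x \<in> \<mm> \<Longrightarrow> \<rho> x \<odot>\<^bsub>E\<^esub> v \<in> W" by blast
    obtain C where C: "C \<subseteq> \<mm>" "independent C" "\<mm> \<subseteq> span C" using basis_exists[of \<mm>] by metis
    have "finite C" using finiteI_independent[OF C(2)] .
    have "\<forall>c\<in>C. \<exists>n. kills E n (\<rho> c \<odot>\<^bsub>E\<^esub> v)" using v(3) C(1) by (auto simp: W_def)
    from bchoice[OF this] obtain n where n: "\<And>c. c \<in> C \<Longrightarrow> kills E (n c) (\<rho> c \<odot>\<^bsub>E\<^esub> v)" by blast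
    define N where "N = Max (insert 0 (n ` C))"
    have nN: "n c \<le> N" if "c \<in> C" for c unfolding N_def using that \<open>finite C\<close> by (intro Max_ge) auto
    have N: "kills E N (\<rho> x \<odot>\<^bsub>E\<^esub> v)" if "x \<in> span C" for x
      using that
    proof (induction rule: span_induct_alt)
      case base
      show ?case by (simp add: kills_def E.act_zero v E.act_null)
    next
      case (step c x y)
      have "kills E N (\<rho> x \<odot>\<^bsub>E\<^esub> v)" using n[OF step(1)] nN[OF step(1)] by (rule kills_mono)
      then have "kills E N (uea_const c \<odot>\<^bsub>E\<^esub> (\<rho> x \<odot>\<^bsub>E\<^esub> v))"
        using J_const by (simp add: kills_def E.act_mult[symmetric] v E.act_closed) (simp add: E.act_mult mult.assoc[symmetric] v)
      then show ?case using step v by (simp add: rho_add rho_scale E.act_add E.act_mult kadd E.act_closed)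
    qed
    have "J m a \<Longrightarrow> N + D < m \<Longrightarrow> a \<odot>\<^bsub>E\<^esub> v = \<zero>\<^bsub>E\<^esub>" for m a
    proof (induction rule: J.induct)
      case (J_step k a x d)
      show ?case
      proof (cases "D < d")
        case True
        then show ?thesis using J_step M_bound by (simp add: E.act_zero v)
      next
        case False
        have "J N a" by (rule J_antimono[OF J_step(1)]) (use J_step False in simp)
        moreover have "x \<in> span C" using M_subset_m[OF J_step(2,3)] C by blast
        ultimately show ?thesis using N v by (simp add: kills_def E.act_mult)
      qed
    qed (simp_all add: E.act_zero E.act_add v)
    then have "kills E (N + D + 1) v" by (simp add: kills_def)
    then show False using v by (auto simp: W_def)
  qed
  then show ?thesis using u by (auto simp: W_def)
qed

lemma killed_locally_whittaker:
  assumes E: "left_module uea_ring E" and k: "\<And>v. v \<in> carrier E \<Longrightarrow> \<exists>n. kills E n v"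
  shows "locally_whittaker \<chi> \<mm> E"
  unfolding locally_whittaker_def
proof (intro ballI)
  fix m v assume m: "m \<in> \<mm>" and v: "v \<in> carrier E"
  have "J n (\<rho> m ^ n)" for n
  proof (induction n)
    case (Suc n)
    then show ?case using J_rho_m[OF _ m] by (simp add: power_Suc2 del: power_Suc)
  qed (simp add: J_all)
  then show "\<exists>n. (\<rho> m ^ n) \<odot>\<^bsub>E\<^esub> v = \<zero>\<^bsub>E\<^esub>" using k[OF v] by (auto simp: kills_def)
qed

section \<open>Whittaker vectors\<close>

lemma Wh_rho:
  assumes E: "left_module uea_ring E"
  shows "x \<in> carrier (Wh \<chi> \<mm> E) \<longleftrightarrow> x \<in> carrier E \<and> (\<forall>m\<in>\<mm>. \<rho> m \<odot>\<^bsub>E\<^esub> x = \<zero>\<^bsub>E\<^esub>)"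
proof -
  interpret E: uea_mod E using E by (simp add: uea_mod_def)
  have "gen m \<odot>\<^bsub>E\<^esub> x = uea_const (\<chi> m) \<odot>\<^bsub>E\<^esub> x \<longleftrightarrow> \<rho> m \<odot>\<^bsub>E\<^esub> x = \<zero>\<^bsub>E\<^esub>" if "x \<in> carrier E" for m
    unfolding whit_shift_def E.act_diff[OF that]
    using that E.eq_if_diff_zero E.act_closed by (auto simp: a_minus_def E.M.r_neg)
  then show ?thesis by (auto simp: Wh_def)
qed

lemma Wh_iff:
  assumes E: "left_module uea_ring E"
  shows "x \<in> carrier (Wh \<chi> \<mm> E) \<longleftrightarrow> x \<in> carrier E \<and> (\<forall>a\<in>I. a \<odot>\<^bsub>E\<^esub> x = \<zero>\<^bsub>E\<^esub>)"
proof -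
  interpret E: uea_mod E using E by (simp add: uea_mod_def)
  have "a \<odot>\<^bsub>E\<^esub> x = \<zero>\<^bsub>E\<^esub>" if x: "x \<in> carrier E" "\<And>m. m \<in> \<mm> \<Longrightarrow> \<rho> m \<odot>\<^bsub>E\<^esub> x = \<zero>\<^bsub>E\<^esub>" and "a \<in> I" for a
    using that(3) by (induction rule: whit_ideal.induct) (simp_all add: x E.act_zero E.act_mult E.act_null E.act_add)
  moreover have "\<rho> m \<in> I" if "m \<in> \<mm>" for m using whit_ideal_gen[OF that, of 1] by simp
  ultimately show ?thesis unfolding Wh_rho[OF E] by blast
qed

text \<open>On the vectors killed by \<open>J n\<close> such an element acts as a projection onto the Whittaker vectors.\<close>

definition projector :: "nat \<Rightarrow> 'g uea \<Rightarrow> bool" where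
  "projector n \<pi> \<longleftrightarrow> \<pi> - 1 \<in> I \<and> (\<forall>a\<in>I. J n (a * \<pi>))"

lemma ex_projector: "\<exists>\<pi>. projector n \<pi>"
  using ex_whittaker_projector by (simp add: projector_def)

lemma projector_antimono: "projector n \<pi> \<Longrightarrow> m \<le> n \<Longrightarrow> projector m \<pi>"
  using J_antimono by (auto simp: projector_def)

lemma projector_Wh:
  assumes E: "left_module uea_ring E" and v: "v \<in> carrier E" "kills E n v" and \<pi>: "projector n \<pi>"
  shows "\<pi> \<odot>\<^bsub>E\<^esub> v \<in> carrier (Wh \<chi> \<mm> E)"
proof -
  interpret E: uea_mod E using E by (simp add: uea_mod_def)
  show ?thesis unfolding Wh_iff[OF E] using v \<pi>
    by (auto simp: E.act_closed E.act_mult[symmetric] kills_def projector_def)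
qed

lemma projector_id:
  assumes E: "left_module uea_ring E" and v: "v \<in> carrier (Wh \<chi> \<mm> E)" and \<pi>: "projector n \<pi>"
  shows "\<pi> \<odot>\<^bsub>E\<^esub> v = v"
proof -
  interpret E: uea_mod E using E by (simp add: uea_mod_def)
  have vE: "v \<in> carrier E" "\<And>a. a \<in> I \<Longrightarrow> a \<odot>\<^bsub>E\<^esub> v = \<zero>\<^bsub>E\<^esub>" using v Wh_iff[OF E] by auto
  have "((\<pi> - 1) + 1) \<odot>\<^bsub>E\<^esub> v = v" unfolding E.act_add[OF vE(1)]
    using \<pi> vE by (simp add: projector_def E.act_one)
  then show ?thesis by simp
qed

text \<open>If \<open>W\<close> were proper, Engel's theorem would give a vector \<open>v\<close> outside \<open>W\<close> with \<open>I v\<close> inside.  But the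
  Whittaker vector \<open>\<pi> v\<close> is inside too, and \<open>(1 - \<pi>) v\<close> belongs to \<open>I v\<close>.\<close>

lemma Wh_generates:
  assumes E: "left_module uea_ring E" and lw: "locally_whittaker \<chi> \<mm> E"
    and W: "left_module.submod uea_ring E W" and Wh: "carrier (Wh \<chi> \<mm> E) \<subseteq> W"
  shows "W = carrier E"
proof (rule ccontr)
  interpret E: uea_mod E using E by (simp add: uea_mod_def)
  note WD = E.submodD[OF W]
  assume "W \<noteq> carrier E"
  then have "W \<subset> carrier E" using WD(1) by blast
  from whittaker_engel[OF E lw E.submod_carrier W this]
  obtain v where v: "v \<in> carrier E" "v \<notin> W" "\<And>x. x \<in> \<mm> \<Longrightarrow> \<rho> x \<odot>\<^bsub>E\<^esub> v \<in> W" by blast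
  obtain n where n: "kills E n v" using whittaker_killed[OF E lw v(1)] by blast
  obtain \<pi> where \<pi>: "projector n \<pi>" using ex_projector by blast
  have I: "a \<odot>\<^bsub>E\<^esub> v \<in> W" if "a \<in> I" for a
    using that
    by (induction rule: whit_ideal.induct) (simp_all add: v E.act_zero E.act_mult E.act_add WD)
  have "\<pi> \<odot>\<^bsub>E\<^esub> v \<in> W" using projector_Wh[OF E v(1) n \<pi>] Wh by blast
  moreover have "(1 - \<pi>) \<odot>\<^bsub>E\<^esub> v \<in> W"
    using \<pi> whit_ideal_minus[of "\<pi> - 1"] by (intro I) (simp add: projector_def)
  ultimately have "\<pi> \<odot>\<^bsub>E\<^esub> v \<oplus>\<^bsub>E\<^esub> (1 - \<pi>) \<odot>\<^bsub>E\<^esub> v \<in> W" by (rule WD(3))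
  moreover have "\<pi> \<odot>\<^bsub>E\<^esub> v \<oplus>\<^bsub>E\<^esub> (1 - \<pi>) \<odot>\<^bsub>E\<^esub> v = v"
    using E.act_add[OF v(1), of \<pi> "1 - \<pi>"] E.act_one[OF v(1)] by simp
  ultimately show False using v(2) by simp
qed

section \<open>The algebra \<open>H\<close> and the bimodule \<open>Q\<close>\<close>

abbreviation "H \<equiv> whit_algebra \<chi> \<mm>"
abbreviation "Q \<equiv> whit_bimodule \<chi> \<mm>"
abbreviation co :: "'g uea \<Rightarrow> 'g uea set" where "co \<equiv> acoset I"

text \<open>Membership in the largest subalgebra in which \<open>I\<close> is a two-sided ideal; \<open>H\<close> is the quotient of
  that subalgebra by \<open>I\<close>.\<close>

definition idealizer :: "'g uea \<Rightarrow> bool" where "idealizer y \<longleftrightarrow> (\<forall>a\<in>I. a * y \<in> I)"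

lemma I_subgroup: "add_subgroup I"
  by (simp add: add_subgroup_def whit_ideal_zero whit_ideal_diff)

lemma co_eq_iff: "co a = co b \<longleftrightarrow> a - b \<in> I"
  by (rule acoset_eq_iff[OF I_subgroup])

lemma mem_co: "a \<in> co a" using whit_ideal_zero by (simp add: mem_acoset)

lemma whit_coset_eq: "whit_coset \<chi> \<mm> u = co u"
  by (auto simp: a_r_coset_def r_coset_def acoset_def)

lemma set_add_co: "set_add uea_ring (co a) (co b) = co (a + b)"
  using acoset_plus[OF I_subgroup] by (simp add: set_add_def set_mult_def)

lemma rcoset_mult_co:
  assumes "idealizer b" shows "rcoset_mult uea_ring I (co a) (co b) = co (a * b)"
proof -
  have "co (x * y) = co (a * b)" if "x \<in> co a" "y \<in> co b" for x y
  proof -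
    have "x * (y - b) + (x - a) * b \<in> I"
      using that assms by (intro whit_ideal_add[OF whit_ideal_left]) (auto simp: mem_acoset idealizer_def)
    then show ?thesis by (simp add: co_eq_iff algebra_simps)
  qed
  then have "(\<Union>x\<in>co a. \<Union>y\<in>co b. co (x * y)) = (\<Union>x\<in>co a. \<Union>y\<in>co b. co (a * b))" by simp
  also have "\<dots> = co (a * b)" using mem_co[of a] mem_co[of b] by blast
  finally show ?thesis by (simp add: rcoset_mult_def whit_coset_eq)
qed

lemma idealizer_simps: "idealizer 1" "idealizer 0" "idealizer a \<Longrightarrow> idealizer b \<Longrightarrow> idealizer (a + b)" "idealizer a \<Longrightarrow> idealizer b \<Longrightarrow> idealizer (a * b)" "idealizer a \<Longrightarrow> idealizer (- a)"
  by (auto simp: idealizer_def whit_ideal_zero distrib_left mult.assoc[symmetric] intro: whit_ideal_add whit_ideal_minus)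

lemma idealizer_iff: "idealizer y \<longleftrightarrow> (\<forall>n\<in>\<mm>. gen n * y - y * gen n \<in> I)"
proof -
  have eq: "gen n * y - y * gen n = \<rho> n * y - y * \<rho> n" for n
    using uea_const_central[of "\<chi> n" y] by (simp add: whit_shift_def algebra_simps)
  have yI: "y * \<rho> n \<in> I" if "n \<in> \<mm>" for n using that by (rule whit_ideal_gen)
  show ?thesis
  proof
    assume "idealizer y"
    then have "\<rho> n * y \<in> I" if "n \<in> \<mm>" for n
      using whit_ideal_gen[OF that, of 1] by (simp add: idealizer_def)
    then show "\<forall>n\<in>\<mm>. gen n * y - y * gen n \<in> I" unfolding eq using yI whit_ideal_diff by blast
  next
    assume *: "\<forall>n\<in>\<mm>. gen n * y - y * gen n \<in> I"
    have \<rho>I: "\<rho> n * y \<in> I" if "n \<in> \<mm>" for n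
      using whit_ideal_add[OF *[unfolded eq, rule_format, OF that] yI[OF that]] by simp
    have "a * y \<in> I" if "a \<in> I" for a
      using that
    proof (induction rule: whit_ideal.induct)
      case (whit_ideal_gen x u)
      then show ?case using whit_ideal_left[OF \<rho>I] by (simp add: mult.assoc)
    qed (simp_all add: whit_ideal_zero distrib_right whit_ideal_add)
    then show "idealizer y" by (simp add: idealizer_def)
  qed
qed

lemma H_simps: "carrier H = {co y | y. idealizer y}" "\<one>\<^bsub>H\<^esub> = co 1" "\<zero>\<^bsub>H\<^esub> = co 0"
  "co a \<oplus>\<^bsub>H\<^esub> co b = co (a + b)" "idealizer b \<Longrightarrow> co a \<otimes>\<^bsub>H\<^esub> co b = co (a * b)"
  by (simp_all add: whit_algebra_def idealizer_iff[symmetric] whit_coset_eq set_add_co rcoset_mult_co acoset_zero)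

lemma H_carrierI: "idealizer y \<Longrightarrow> co y \<in> carrier H" by (auto simp: H_simps)

lemma H_carrierE: assumes "r \<in> carrier H" obtains y where "idealizer y" "r = co y"
  using assms by (auto simp: H_simps)

lemma Q_simps: "carrier Q = range co" "\<zero>\<^bsub>Q\<^esub> = co 0" "co a \<oplus>\<^bsub>Q\<^esub> co b = co (a + b)"
  "u \<odot>\<^bsub>Q\<^esub> co a = co (u * a)" "idealizer b \<Longrightarrow> rsmult Q (co a) (co b) = co (a * b)"
proof -
  show "carrier Q = range co"
    unfolding whit_bimodule_def A_RCOSETS_def RCOSETS_def a_r_coset_def[symmetric] whit_coset_eq
    by (auto simp: uea_ring_def)
  show "u \<odot>\<^bsub>Q\<^esub> co a = co (u * a)"
    unfolding whit_bimodule_def whit_coset_eq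
    by simp (rule acoset_map[OF I_subgroup I_subgroup], simp add: mem_acoset right_diff_distrib[symmetric] whit_ideal_left)
qed (simp_all add: whit_bimodule_def set_add_co rcoset_mult_co acoset_zero)

lemma ring_H: "ring H"
proof (rule ringI)
  show "abelian_group H"
  proof (rule abelian_groupI)
    fix x assume "x \<in> carrier H"
    then obtain a where "idealizer a" "x = co a" by (elim H_carrierE)
    then have "co (- a) \<in> carrier H" "co (- a) \<oplus>\<^bsub>H\<^esub> x = \<zero>\<^bsub>H\<^esub>" by (auto simp: H_simps idealizer_simps)
    then show "\<exists>y\<in>carrier H. y \<oplus>\<^bsub>H\<^esub> x = \<zero>\<^bsub>H\<^esub>" by blast
  next
    fix x y assume "x \<in> carrier H" "y \<in> carrier H"
    then show "x \<oplus>\<^bsub>H\<^esub> y = y \<oplus>\<^bsub>H\<^esub> x" by (elim H_carrierE) (simp add: H_simps(4) add.commute)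
  qed (auto elim!: H_carrierE simp: H_simps(2-) add.assoc intro!: H_carrierI idealizer_simps)
  show "monoid H"
    by (rule monoidI) (auto elim!: H_carrierE simp: H_simps(2-) idealizer_simps mult.assoc intro!: H_carrierI idealizer_simps)
qed (auto elim!: H_carrierE simp: H_simps(2-) idealizer_simps algebra_simps)

lemma balanced_pair_Q: assumes V: "left_module H V" shows "balanced_pair uea_ring H V Q"
proof (intro balanced_pair.intro balanced_pair_axioms.intro V ring_uea_ring)
qed (auto elim!: H_carrierE simp: Q_simps idealizer_simps algebra_simps)

section \<open>The functor of Whittaker vectors\<close>

lemma Wh_simps: "\<zero>\<^bsub>Wh \<chi> \<mm> E\<^esub> = \<zero>\<^bsub>E\<^esub>" "x \<oplus>\<^bsub>Wh \<chi> \<mm> E\<^esub> y = x \<oplus>\<^bsub>E\<^esub> y"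
  by (simp_all add: Wh_def)

lemma Wh_some:
  assumes E: "left_module uea_ring E" and x: "x \<in> carrier (Wh \<chi> \<mm> E)"
  shows "(SOME u. u \<in> co a) \<odot>\<^bsub>E\<^esub> x = a \<odot>\<^bsub>E\<^esub> x"
proof -
  interpret E: uea_mod E using E by (simp add: uea_mod_def)
  define u where "u = (SOME u. u \<in> co a)"
  have "u \<in> co a" unfolding u_def by (rule someI[of _ a]) (rule mem_co)
  then have "(u - a) \<odot>\<^bsub>E\<^esub> x = \<zero>\<^bsub>E\<^esub>" "x \<in> carrier E" using x Wh_iff[OF E] by (auto simp: mem_acoset)
  then show ?thesis using E.eq_if_diff_zero E.act_closed by (simp add: E.act_diff u_def)
qed

lemma Wh_smult:
  assumes "left_module uea_ring E" "x \<in> carrier (Wh \<chi> \<mm> E)"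
  shows "co a \<odot>\<^bsub>Wh \<chi> \<mm> E\<^esub> x = a \<odot>\<^bsub>E\<^esub> x"
  using Wh_some[OF assms] by (simp add: Wh_def)

lemma Wh_module:
  assumes E: "left_module uea_ring E" shows "left_module H (Wh \<chi> \<mm> E)"
proof -
  interpret E: uea_mod E using E by (simp add: uea_mod_def)
  note iff = Wh_iff[OF E] and sm = Wh_smult[OF E]
  have sub: "x \<in> carrier E" if "x \<in> carrier (Wh \<chi> \<mm> E)" for x using that iff by simp
  have cl: "x \<oplus>\<^bsub>E\<^esub> y \<in> carrier (Wh \<chi> \<mm> E)" if "x \<in> carrier (Wh \<chi> \<mm> E)" "y \<in> carrier (Wh \<chi> \<mm> E)" for x y
    using that by (simp add: iff E.act_distr)
  have sc: "a \<odot>\<^bsub>E\<^esub> x \<in> carrier (Wh \<chi> \<mm> E)" if "idealizer a" "x \<in> carrier (Wh \<chi> \<mm> E)" for a x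
    using that by (simp add: iff E.act_mult[symmetric] E.act_closed idealizer_def)
  have ab: "abelian_group (Wh \<chi> \<mm> E)"
  proof (rule abelian_groupI)
    fix x assume x: "x \<in> carrier (Wh \<chi> \<mm> E)"
    have "(- 1) \<odot>\<^bsub>E\<^esub> x \<oplus>\<^bsub>E\<^esub> x = \<zero>\<^bsub>E\<^esub>"
      using E.act_add[OF sub[OF x], of "- 1" 1] E.act_one[OF sub[OF x]] E.act_zero[OF sub[OF x]] by simp
    moreover have "(- 1) \<odot>\<^bsub>E\<^esub> x \<in> carrier (Wh \<chi> \<mm> E)" using x by (intro sc idealizer_simps)
    ultimately show "\<exists>y\<in>carrier (Wh \<chi> \<mm> E). y \<oplus>\<^bsub>Wh \<chi> \<mm> E\<^esub> x = \<zero>\<^bsub>Wh \<chi> \<mm> E\<^esub>" by (auto simp: Wh_simps)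
  next
    show "\<zero>\<^bsub>Wh \<chi> \<mm> E\<^esub> \<in> carrier (Wh \<chi> \<mm> E)" by (simp add: Wh_simps iff E.act_null)
  qed (simp_all add: Wh_simps cl sub E.M.a_ac)
  show ?thesis
  proof (intro left_module.intro left_module_axioms.intro ring_H ab)
  qed (auto elim!: H_carrierE simp: H_simps(2-) sm sc cl Wh_simps sub E.act_add E.act_distr E.act_mult E.act_one)
qed

lemma Wh_hom:
  assumes E: "left_module uea_ring E" and F: "left_module uea_ring F" and \<phi>: "\<phi> \<in> module_homs uea_ring E F"
  shows "restrict \<phi> (carrier (Wh \<chi> \<mm> E)) \<in> module_homs H (Wh \<chi> \<mm> E) (Wh \<chi> \<mm> F)"
proof -
  interpret WE: left_module H "Wh \<chi> \<mm> E" by (rule Wh_module[OF E])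
  note \<phi>D = module_homsD[OF \<phi>]
  have sub: "x \<in> carrier E" if "x \<in> carrier (Wh \<chi> \<mm> E)" for x using that Wh_iff[OF E] by simp
  have lin: "\<phi> (a \<odot>\<^bsub>E\<^esub> x) = a \<odot>\<^bsub>F\<^esub> \<phi> x" if "x \<in> carrier E" for a x using \<phi>D(4) that by simp
  have cl: "\<phi> x \<in> carrier (Wh \<chi> \<mm> F)" if x: "x \<in> carrier (Wh \<chi> \<mm> E)" for x
    unfolding Wh_iff[OF F]
    using x \<phi>D(1) sub[OF x] lin[OF sub[OF x], symmetric] module_homs_zero[OF E F \<phi>] by (auto simp: Wh_iff[OF E])
  show ?thesis
    unfolding module_homs_def
  proof (intro CollectI conjI ballI)
    fix a x assume a: "a \<in> carrier H" and x: "x \<in> carrier (Wh \<chi> \<mm> E)"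
    obtain y where y: "a = co y" using a by (elim H_carrierE)
    have "a \<odot>\<^bsub>Wh \<chi> \<mm> E\<^esub> x \<in> carrier (Wh \<chi> \<mm> E)" using a x by (rule WE.smult_closed)
    then show "restrict \<phi> (carrier (Wh \<chi> \<mm> E)) (a \<odot>\<^bsub>Wh \<chi> \<mm> E\<^esub> x) = a \<odot>\<^bsub>Wh \<chi> \<mm> F\<^esub> restrict \<phi> (carrier (Wh \<chi> \<mm> E)) x"
      using x cl by (simp add: y Wh_smult[OF E] Wh_smult[OF F] lin sub)
  next
    fix x y assume x: "x \<in> carrier (Wh \<chi> \<mm> E)" and y: "y \<in> carrier (Wh \<chi> \<mm> E)"
    have "x \<oplus>\<^bsub>Wh \<chi> \<mm> E\<^esub> y \<in> carrier (Wh \<chi> \<mm> E)" using x y by simp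
    then show "restrict \<phi> (carrier (Wh \<chi> \<mm> E)) (x \<oplus>\<^bsub>Wh \<chi> \<mm> E\<^esub> y)
        = restrict \<phi> (carrier (Wh \<chi> \<mm> E)) x \<oplus>\<^bsub>Wh \<chi> \<mm> F\<^esub> restrict \<phi> (carrier (Wh \<chi> \<mm> E)) y"
      using x y \<phi>D(3) sub by (simp add: Wh_simps)
  qed (use cl in auto)
qed

text \<open>Since Whittaker vectors generate \<open>E\<close>, finitely many of them do.  If \<open>x = \<Sum> a\<^sub>i w\<^sub>i\<close> is a Whittaker
  vector, then \<open>x = \<pi> x = \<Sum> (\<pi> a\<^sub>i) w\<^sub>i\<close>, and for a projector \<open>\<pi>\<close> of large index all \<open>\<pi> a\<^sub>i\<close> belong to the
  idealizer of \<open>I\<close>.  So the \<open>w\<^sub>i\<close> generate \<open>Wh E\<close> over \<open>H\<close>.\<close>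

lemma Wh_finitely_generated:
  assumes E: "left_module uea_ring E" and lw: "locally_whittaker \<chi> \<mm> E" and fg: "finitely_generated uea_ring E"
  shows "finitely_generated H (Wh \<chi> \<mm> E)"
proof -
  interpret E: uea_mod E using E by (simp add: uea_mod_def)
  interpret WE: left_module H "Wh \<chi> \<mm> E" by (rule Wh_module[OF E])
  define gs where "gs S = {x \<in> carrier E. \<forall>W. E.submod W \<longrightarrow> S \<subseteq> W \<longrightarrow> x \<in> W}" for S
  have gs_sub: "E.submod (gs S)" for S
    by (rule E.submodI) (auto simp: gs_def E.act_closed dest: E.submodD)
  have gs_mono: "gs S \<subseteq> gs T" if "S \<subseteq> T" for S T using that by (auto simp: gs_def)
  have gs_base: "S \<subseteq> gs S" if "S \<subseteq> carrier E" for S using that by (auto simp: gs_def)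
  let ?Wh = "carrier (Wh \<chi> \<mm> E)"
  have WhE: "?Wh \<subseteq> carrier E" using Wh_iff[OF E] by auto
  define X where "X = (\<Union>T\<in>{T. finite T \<and> T \<subseteq> ?Wh}. gs T)"
  have "E.submod X"
  proof (rule E.submodI)
    show "X \<subseteq> carrier E" by (auto simp: X_def gs_def)
    show "\<zero>\<^bsub>E\<^esub> \<in> X" using E.submodD(2)[OF gs_sub[of "{}"]] by (auto simp: X_def)
    show "a \<odot>\<^bsub>E\<^esub> x \<in> X" if "x \<in> X" for a x using that E.submodD(4)[OF gs_sub] by (auto simp: X_def)
    fix x y assume "x \<in> X" "y \<in> X"
    then obtain S T where ST: "finite S" "S \<subseteq> ?Wh" "x \<in> gs S" "finite T" "T \<subseteq> ?Wh" "y \<in> gs T" by (auto simp: X_def)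
    then have "x \<in> gs (S \<union> T)" "y \<in> gs (S \<union> T)" using gs_mono[of S "S \<union> T"] gs_mono[of T "S \<union> T"] by auto
    then have "x \<oplus>\<^bsub>E\<^esub> y \<in> gs (S \<union> T)" by (rule E.submodD(3)[OF gs_sub])
    then show "x \<oplus>\<^bsub>E\<^esub> y \<in> X" using ST unfolding X_def by blast
  qed
  moreover have "?Wh \<subseteq> X"
  proof
    fix x assume "x \<in> ?Wh"
    then have "x \<in> gs {x}" "{x} \<subseteq> ?Wh" using gs_base[of "{x}"] WhE by auto
    then show "x \<in> X" unfolding X_def by blast
  qed
  ultimately have X: "X = carrier E" by (rule Wh_generates[OF E lw])
  obtain S where S: "finite S" "S \<subseteq> carrier E" "\<And>W. E.submod W \<Longrightarrow> S \<subseteq> W \<Longrightarrow> W = carrier E"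
    using fg unfolding E.finitely_generated_iff by blast
  have "\<forall>s\<in>S. \<exists>T. finite T \<and> T \<subseteq> ?Wh \<and> s \<in> gs T" using S(2) unfolding X[symmetric] X_def by blast
  from bchoice[OF this] obtain T where T: "\<And>s. s \<in> S \<Longrightarrow> finite (T s) \<and> T s \<subseteq> ?Wh \<and> s \<in> gs (T s)" by blast
  \<comment> \<open>Finitely many Whittaker vectors, whose submodule contains the finitely many generators of \<open>E\<close>.\<close>
  define W0 where "W0 = (\<Union>s\<in>S. T s)"
  have W0: "finite W0" "W0 \<subseteq> ?Wh" using T S(1) by (auto simp: W0_def)
  have "S \<subseteq> gs W0"
  proof
    fix s assume s: "s \<in> S"
    then have "gs (T s) \<subseteq> gs W0" by (intro gs_mono) (auto simp: W0_def)
    then show "s \<in> gs W0" using T[OF s] by blast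
  qed
  then have gW0: "gs W0 = carrier E" by (intro S(3) gs_sub)
  have "V = ?Wh" if V: "WE.submod V" and W0V: "W0 \<subseteq> V" for V
  proof
    show "V \<subseteq> ?Wh" using V by (simp add: WE.submod_def)
    have Vcl: "x \<in> V \<Longrightarrow> y \<in> V \<Longrightarrow> x \<oplus>\<^bsub>E\<^esub> y \<in> V" "\<zero>\<^bsub>E\<^esub> \<in> V" for x y
      using V by (auto simp: WE.submod_def Wh_simps)
    have Vact: "a \<odot>\<^bsub>E\<^esub> x \<in> V" if "idealizer a" "x \<in> V" for a x
    proof -
      have "x \<in> ?Wh" "co a \<odot>\<^bsub>Wh \<chi> \<mm> E\<^esub> x \<in> V"
        using V that H_carrierI[OF that(1)] by (auto simp: WE.submod_def)
      then show ?thesis by (simp add: Wh_smult[OF E])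
    qed
    \<comment> \<open>The quantifier over \<open>b\<close> makes this a submodule for the whole enveloping algebra.\<close>
    define Y where "Y = {x \<in> carrier E. \<forall>b. \<exists>n. \<forall>\<pi>. projector n \<pi> \<longrightarrow> \<pi> \<odot>\<^bsub>E\<^esub> (b \<odot>\<^bsub>E\<^esub> x) \<in> V}"
    have "E.submod Y"
    proof (rule E.submodI)
      show "\<zero>\<^bsub>E\<^esub> \<in> Y" by (simp add: Y_def E.act_null Vcl)
    next
      fix x y assume x: "x \<in> Y" and y: "y \<in> Y"
      have xy: "x \<in> carrier E" "y \<in> carrier E" using x y by (auto simp: Y_def)
      have "\<exists>n. \<forall>\<pi>. projector n \<pi> \<longrightarrow> \<pi> \<odot>\<^bsub>E\<^esub> (b \<odot>\<^bsub>E\<^esub> (x \<oplus>\<^bsub>E\<^esub> y)) \<in> V" for b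
      proof -
        obtain n m where nm: "\<And>\<pi>. projector n \<pi> \<Longrightarrow> \<pi> \<odot>\<^bsub>E\<^esub> (b \<odot>\<^bsub>E\<^esub> x) \<in> V" "\<And>\<pi>. projector m \<pi> \<Longrightarrow> \<pi> \<odot>\<^bsub>E\<^esub> (b \<odot>\<^bsub>E\<^esub> y) \<in> V"
          using x y unfolding Y_def by blast
        have "\<pi> \<odot>\<^bsub>E\<^esub> (b \<odot>\<^bsub>E\<^esub> (x \<oplus>\<^bsub>E\<^esub> y)) \<in> V" if "projector (max n m) \<pi>" for \<pi>
          using Vcl(1)[OF nm(1)[OF projector_antimono[OF that]] nm(2)[OF projector_antimono[OF that]]] xy
          by (simp add: E.act_distr E.act_closed)
        then show ?thesis by blast
      qed
      then show "x \<oplus>\<^bsub>E\<^esub> y \<in> Y" using xy by (simp add: Y_def)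
    next
      fix a x assume "x \<in> Y"
      then show "a \<odot>\<^bsub>E\<^esub> x \<in> Y" by (auto simp: Y_def E.act_closed E.act_mult[symmetric])
    qed (auto simp: Y_def)
    moreover have "W0 \<subseteq> Y"
    proof
      fix w assume w: "w \<in> W0"
      then have wE: "w \<in> carrier E" "w \<in> V" using W0 WhE W0V by auto
      have "\<exists>n. \<forall>\<pi>. projector n \<pi> \<longrightarrow> \<pi> \<odot>\<^bsub>E\<^esub> (b \<odot>\<^bsub>E\<^esub> w) \<in> V" for b
      proof -
        obtain k where k: "\<And>n a. J (n + k) a \<Longrightarrow> J n (a * b)" using J_absorb[of b] by blast
        have "\<pi> \<odot>\<^bsub>E\<^esub> (b \<odot>\<^bsub>E\<^esub> w) \<in> V" if \<pi>: "projector (1 + k) \<pi>" for \<pi>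
        proof -
          have "idealizer (\<pi> * b)" unfolding idealizer_def
            using \<pi> k[of 1] by (auto simp: projector_def I_iff_J mult.assoc[symmetric])
          then show ?thesis using Vact wE by (simp add: E.act_mult[symmetric])
        qed
        then show ?thesis by blast
      qed
      then show "w \<in> Y" using wE by (simp add: Y_def)
    qed
    ultimately have Y: "x \<in> Y" if "x \<in> carrier E" for x using that gW0 by (auto simp: gs_def)
    show "?Wh \<subseteq> V"
    proof
      fix x assume x: "x \<in> ?Wh"
      then have xE: "x \<in> carrier E" using WhE by blast
      obtain n where n: "\<And>\<pi>. projector n \<pi> \<Longrightarrow> \<pi> \<odot>\<^bsub>E\<^esub> (1 \<odot>\<^bsub>E\<^esub> x) \<in> V" using Y[OF xE] unfolding Y_def by blast
      obtain \<pi> where "projector n \<pi>" using ex_projector by blast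
      from n[OF this] show "x \<in> V" using projector_id[OF E x \<open>projector n \<pi>\<close>] by (simp add: E.act_one xE)
    qed
  qed
  then show ?thesis unfolding WE.finitely_generated_iff using W0 by blast
qed

lemma Wh_is_functor:
  "is_functor (whit_category \<chi> \<mm> :: (('g uea, 'u) module, 'u \<Rightarrow> 'u) cat) (fg_module_category H) (Wh_functor \<chi> \<mm>)"
  unfolding is_functor_def whit_category_def fg_module_category_def module_cat_simps
proof (intro conjI ballI module_cat_is_category)
  fix E :: "('g uea, 'u) module" assume "E \<in> {E. left_module uea_ring E \<and> finitely_generated uea_ring E \<and> locally_whittaker \<chi> \<mm> E}"
  then show "omap (Wh_functor \<chi> \<mm>) E \<in> {M. left_module H M \<and> finitely_generated H M}"
    using Wh_module[of E] Wh_finitely_generated[of E] by (simp add: Wh_functor_def)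
  show "amap (Wh_functor \<chi> \<mm>) E E (\<lambda>x\<in>carrier E. x) = (\<lambda>x\<in>carrier (omap (Wh_functor \<chi> \<mm>) E). x)"
    by (auto simp: Wh_functor_def Wh_def fun_eq_iff)
next
  fix E F :: "('g uea, 'u) module" and \<phi>
  assume "E \<in> {E. left_module uea_ring E \<and> finitely_generated uea_ring E \<and> locally_whittaker \<chi> \<mm> E}"
    "F \<in> {E. left_module uea_ring E \<and> finitely_generated uea_ring E \<and> locally_whittaker \<chi> \<mm> E}"
    "\<phi> \<in> module_homs uea_ring E F"
  then show "amap (Wh_functor \<chi> \<mm>) E F \<phi> \<in> module_homs H (omap (Wh_functor \<chi> \<mm>) E) (omap (Wh_functor \<chi> \<mm>) F)"
    using Wh_hom[of E F \<phi>] by (simp add: Wh_functor_def)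
next
  fix E F N :: "('g uea, 'u) module" and \<phi> \<psi>
  assume *: "E \<in> {E. left_module uea_ring E \<and> finitely_generated uea_ring E \<and> locally_whittaker \<chi> \<mm> E}"
    "F \<in> {E. left_module uea_ring E \<and> finitely_generated uea_ring E \<and> locally_whittaker \<chi> \<mm> E}"
    "\<phi> \<in> module_homs uea_ring E F" "\<psi> \<in> module_homs uea_ring F N"
  then have "restrict \<phi> (carrier (Wh \<chi> \<mm> E)) \<in> module_homs H (Wh \<chi> \<mm> E) (Wh \<chi> \<mm> F)" by (intro Wh_hom) auto
  then have "x \<in> carrier (Wh \<chi> \<mm> E) \<Longrightarrow> \<phi> x \<in> carrier (Wh \<chi> \<mm> F)" for x using module_homsD(1) by fastforce
  moreover have "x \<in> carrier (Wh \<chi> \<mm> E) \<Longrightarrow> x \<in> carrier E" for x by (simp add: Wh_def)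
  ultimately show "amap (Wh_functor \<chi> \<mm>) E N (compose (carrier E) \<psi> \<phi>)
     = compose (carrier (omap (Wh_functor \<chi> \<mm>) E)) (amap (Wh_functor \<chi> \<mm>) F N \<psi>) (amap (Wh_functor \<chi> \<mm>) E F \<phi>)"
    by (auto simp: Wh_functor_def compose_def fun_eq_iff)
qed

text \<open>The point is surjectivity: if \<open>\<psi> x\<close> is a Whittaker vector, then \<open>\<psi> (\<pi> x) = \<pi> (\<psi> x) = \<psi> x\<close>, and \<open>\<pi> x\<close> is
  a Whittaker vector.\<close>

theorem Wh_exact:
  "exact_functor (whit_category \<chi> \<mm> :: (('g uea, 'u) module, 'u \<Rightarrow> 'u) cat) (fg_module_category H) (Wh_functor \<chi> \<mm>)"
  unfolding exact_functor_def
proof (intro conjI ballI impI Wh_is_functor)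
  fix A E F :: "('g uea, 'u) module" and \<phi> \<psi>
  assume "A \<in> Obj (whit_category \<chi> \<mm>)" "E \<in> Obj (whit_category \<chi> \<mm>)" "F \<in> Obj (whit_category \<chi> \<mm>)"
    and "\<phi> \<in> Hom (whit_category \<chi> \<mm>) A E" "\<psi> \<in> Hom (whit_category \<chi> \<mm>) E F"
    and ex: "short_exact A E F \<phi> \<psi>"
  then have A: "left_module uea_ring A" and E: "left_module uea_ring E" "locally_whittaker \<chi> \<mm> E" and F: "left_module uea_ring F"
    and \<phi>: "\<phi> \<in> module_homs uea_ring A E" and \<psi>: "\<psi> \<in> module_homs uea_ring E F"
    by (auto simp: whit_category_def)
  interpret A: uea_mod A using A by (simp add: uea_mod_def)
  interpret E: uea_mod E using E by (simp add: uea_mod_def)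
  note \<phi>D = module_homsD[OF \<phi>] and \<psi>D = module_homsD[OF \<psi>]
  have inj: "inj_on \<phi> (carrier A)" and im: "\<phi> ` carrier A = {x \<in> carrier E. \<psi> x = \<zero>\<^bsub>F\<^esub>}" and surj: "\<psi> ` carrier E = carrier F"
    using ex by (auto simp: short_exact_def)
  note WA = Wh_iff[OF A] and WE = Wh_iff[OF E(1)] and WF = Wh_iff[OF F]
  have W\<phi>: "\<phi> x \<in> carrier (Wh \<chi> \<mm> E)" if "x \<in> carrier (Wh \<chi> \<mm> A)" for x
    using module_homsD(1)[OF Wh_hom[OF A E(1) \<phi>] that] that by simp
  have W\<psi>: "\<psi> x \<in> carrier (Wh \<chi> \<mm> F)" if "x \<in> carrier (Wh \<chi> \<mm> E)" for x
    using module_homsD(1)[OF Wh_hom[OF E(1) F \<psi>] that] that by simp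
  have 1: "inj_on \<phi> (carrier (Wh \<chi> \<mm> A))" using inj WA by (auto simp: inj_on_def)
  have 2: "\<phi> ` carrier (Wh \<chi> \<mm> A) = {x \<in> carrier (Wh \<chi> \<mm> E). \<psi> x = \<zero>\<^bsub>F\<^esub>}"
  proof (intro equalityI subsetI)
    fix y assume "y \<in> \<phi> ` carrier (Wh \<chi> \<mm> A)"
    then show "y \<in> {x \<in> carrier (Wh \<chi> \<mm> E). \<psi> x = \<zero>\<^bsub>F\<^esub>}" using W\<phi> im WA by blast
  next
    fix y assume y: "y \<in> {x \<in> carrier (Wh \<chi> \<mm> E). \<psi> x = \<zero>\<^bsub>F\<^esub>}"
    then have "y \<in> \<phi> ` carrier A" using im WE by auto
    then obtain x where x: "x \<in> carrier A" "y = \<phi> x" by blast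
    have "a \<odot>\<^bsub>A\<^esub> x = \<zero>\<^bsub>A\<^esub>" if "a \<in> I" for a
    proof -
      have "\<phi> (a \<odot>\<^bsub>A\<^esub> x) = \<phi> \<zero>\<^bsub>A\<^esub>"
        using y x that WE \<phi>D(4) module_homs_zero[OF A E(1) \<phi>] by auto
      then show ?thesis using inj x A.act_closed by (auto dest: inj_onD)
    qed
    then show "y \<in> \<phi> ` carrier (Wh \<chi> \<mm> A)" using x WA by blast
  qed
  have 3: "\<psi> ` carrier (Wh \<chi> \<mm> E) = carrier (Wh \<chi> \<mm> F)"
  proof (intro equalityI subsetI)
    fix y assume y: "y \<in> carrier (Wh \<chi> \<mm> F)"
    then have "y \<in> \<psi> ` carrier E" using surj WF by auto
    then obtain x where x: "x \<in> carrier E" "y = \<psi> x" by blast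
    obtain n where n: "kills E n x" using whittaker_killed[OF E x(1)] by blast
    obtain \<pi> where \<pi>: "projector n \<pi>" using ex_projector by blast
    have "\<psi> (\<pi> \<odot>\<^bsub>E\<^esub> x) = y" using projector_id[OF F y \<pi>] \<psi>D(4) x by simp
    then show "y \<in> \<psi> ` carrier (Wh \<chi> \<mm> E)" using projector_Wh[OF E(1) x(1) n \<pi>] by blast
  qed (use W\<psi> in auto)
  show "short_exact (omap (Wh_functor \<chi> \<mm>) A) (omap (Wh_functor \<chi> \<mm>) E) (omap (Wh_functor \<chi> \<mm>) F)
      (amap (Wh_functor \<chi> \<mm>) A E \<phi>) (amap (Wh_functor \<chi> \<mm>) E F \<psi>)"
    using 1 2 3 unfolding short_exact_def Wh_functor_def by (auto simp: Wh_simps inj_on_def)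
qed

end

section \<open>Finite generation of tensor products\<close>

text \<open>If \<open>Q\<close> is cyclic over \<open>S\<close> with generator \<open>q\<^sub>0\<close>, the tensors \<open>q\<^sub>0 \<otimes> v\<close> with \<open>v\<close> in a generating set of
  \<open>V\<close> generate.\<close>

lemma (in balanced_pair) finitely_generated_T:
  assumes fg: "finitely_generated R V" and q0: "q0 \<in> carrier Q"
    and cyc: "\<And>q. q \<in> carrier Q \<Longrightarrow> \<exists>s\<in>carrier S. q = s \<odot>\<^bsub>Q\<^esub> q0"
  shows "finitely_generated S T"
proof -
  interpret T: left_module S T by (rule T_module)
  obtain X where X: "finite X" "X \<subseteq> carrier V" "\<And>W. V.submod W \<Longrightarrow> X \<subseteq> W \<Longrightarrow> W = carrier V"
    using fg unfolding V.finitely_generated_iff by blast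
  have gen: "W = carrier T" if W: "T.submod W" and XW: "pure_tensor q0 ` X \<subseteq> W" for W
  proof
    note WD = W[unfolded T.submod_def]
    show "W \<subseteq> carrier T" using WD by blast
    define Y where "Y = {v \<in> carrier V. pure_tensor q0 v \<in> W}"
    have "V.submod Y"
      unfolding V.submod_def
    proof (intro conjI ballI)
      have "pure_tensor q0 \<zero>\<^bsub>V\<^esub> \<oplus>\<^bsub>T\<^esub> pure_tensor q0 \<zero>\<^bsub>V\<^esub> = pure_tensor q0 \<zero>\<^bsub>V\<^esub>"
        using pure_tensor_add_right[of q0 "\<zero>\<^bsub>V\<^esub>" "\<zero>\<^bsub>V\<^esub>"] q0 by simp
      then have "pure_tensor q0 \<zero>\<^bsub>V\<^esub> = \<zero>\<^bsub>T\<^esub>" using pure_tensor_closed[OF q0, of "\<zero>\<^bsub>V\<^esub>"] by simp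
      then show "\<zero>\<^bsub>V\<^esub> \<in> Y" using WD by (simp add: Y_def)
    next
      fix v w assume "v \<in> Y" "w \<in> Y"
      then show "v \<oplus>\<^bsub>V\<^esub> w \<in> Y" using WD q0 by (simp add: Y_def pure_tensor_add_right)
    next
      fix r v assume r: "r \<in> carrier R" and v: "v \<in> Y"
      obtain s where s: "s \<in> carrier S" "rsmult Q q0 r = s \<odot>\<^bsub>Q\<^esub> q0" using cyc[OF Q_rsmult[OF q0 r]] by blast
      have vV: "v \<in> carrier V" "pure_tensor q0 v \<in> W" using v by (auto simp: Y_def)
      have "pure_tensor q0 (r \<odot>\<^bsub>V\<^esub> v) = s \<odot>\<^bsub>T\<^esub> pure_tensor q0 v"
        using pure_tensor_balanced[OF q0 r vV(1)] pure_tensor_smult[OF s(1)] s(2) by simp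
      then show "r \<odot>\<^bsub>V\<^esub> v \<in> Y" using WD s(1) vV r by (simp add: Y_def V.smult_closed)
    qed (auto simp: Y_def)
    moreover have "X \<subseteq> Y" using X(2) XW by (auto simp: Y_def)
    ultimately have Y: "Y = carrier V" by (rule X(3))
    show "carrier T \<subseteq> W"
    proof
      fix t assume "t \<in> carrier T"
      then show "t \<in> W"
      proof (induction rule: T_induct)
        case (pure_tensor q v)
        obtain s where s: "s \<in> carrier S" "q = s \<odot>\<^bsub>Q\<^esub> q0" using cyc pure_tensor by blast
        have "pure_tensor q0 v \<in> W" using pure_tensor(2) Y by (auto simp: Y_def)
        then have "s \<odot>\<^bsub>T\<^esub> pure_tensor q0 v \<in> W" using WD s(1) by blast
        then show ?case by (simp add: pure_tensor_smult[OF s(1)] s(2))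
      next
        case (diff a b)
        then show ?case using T.submod_minus[OF W] by simp
      qed (use WD in simp)
    qed
  qed
  show ?thesis unfolding T.finitely_generated_iff
    by (rule exI[of _ "pure_tensor q0 ` X"]) (use X(1,2) gen pure_tensor_closed[OF q0] in blast)
qed

lemma relabel_finitely_generated:
  assumes M: "left_module R M" and inj: "inj_on (relabelling M :: 'v \<Rightarrow> 'u) (carrier M)" and fg: "finitely_generated R M"
  shows "finitely_generated R (relabel M :: ('r, 'u) module)"
proof -
  interpret M: left_module R M by fact
  interpret N: left_module R "relabel M :: ('r, 'u) module" by (rule relabel_module[OF M inj])
  note simps = relabel_simps[OF inj]
  let ?i = "relabelling M :: 'v \<Rightarrow> 'u"
  obtain X where X: "finite X" "X \<subseteq> carrier M" "\<And>W. M.submod W \<Longrightarrow> X \<subseteq> W \<Longrightarrow> W = carrier M"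
    using fg unfolding M.finitely_generated_iff by blast
  have "W = carrier (relabel M)" if W: "N.submod W" and XW: "?i ` X \<subseteq> W" for W
  proof -
    define Y where "Y = {x \<in> carrier M. ?i x \<in> W}"
    have "M.submod Y"
      using W unfolding M.submod_def N.submod_def Y_def
      by (auto simp: simps M.smult_closed simp flip: simps(2)) (metis simps(3), metis simps(4))
    moreover have "X \<subseteq> Y" using X XW by (auto simp: Y_def)
    ultimately have "Y = carrier M" by (rule X(3))
    then show ?thesis using W by (auto simp: N.submod_def Y_def simps)
  qed
  then show ?thesis unfolding N.finitely_generated_iff
    by (intro exI[of _ "?i ` X"]) (use X in \<open>auto simp: simps\<close>)
qed

context whittaker_pair
begin

text \<open>The tensor product is finitely generated over an algebra of the cardinality of the continuum,
  and so it embeds into the type \<open>'u\<close>.\<close>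

lemma fg_relabelled_pair:
  fixes V :: "('g uea set, 'u) module" and \<iota> :: "complex \<Rightarrow> 'u"
  assumes \<iota>: "inj \<iota>" and V: "left_module H V" "finitely_generated H V"
  shows "relabelled_pair uea_ring H V Q"
    and "finitely_generated uea_ring (relabelled_pair.TV H V Q)"
proof -
  interpret balanced_pair uea_ring H V Q by (rule balanced_pair_Q[OF V(1)])
  have fg: "finitely_generated uea_ring T"
  proof (rule finitely_generated_T[OF V(2)])
    show "co 1 \<in> carrier Q" by (simp add: Q_simps)
    fix q assume "q \<in> carrier Q"
    then obtain u where "q = co u" by (auto simp: Q_simps)
    then show "\<exists>s\<in>carrier uea_ring. q = s \<odot>\<^bsub>Q\<^esub> co 1" by (intro bexI[of _ u]) (simp_all add: Q_simps)
  qed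
  obtain f :: "complex \<Rightarrow> 'g uea" where f: "surj f" using ex_surj_uea by blast
  have inj: "inj_on (relabelling T :: _ \<Rightarrow> 'u) (carrier T)"
    by (rule finitely_generated_relabelling[OF \<iota> f T_module fg])
  then show P: "relabelled_pair uea_ring H V Q"
    by (simp add: relabelled_pair_def relabelled_pair_axioms_def balanced_pair_axioms)
  show "finitely_generated uea_ring (relabelled_pair.TV H V Q)"
    unfolding relabelled_pair.TV_def[OF P] by (rule relabel_finitely_generated[OF T_module inj fg])
qed

end

section \<open>Unit and counit\<close>

locale whittaker_induced = whittaker_pair Basis \<chi> G M D + relabelled_pair uea_ring "whit_algebra \<chi> (whittaker_pair.\<mm> M)" V "whit_bimodule \<chi> (whittaker_pair.\<mm> M)"
  for Basis :: "'g::complex_lie_algebra set" and \<chi> G M D and V :: "('g uea set, 'u) module"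
begin

sublocale TV: uea_mod TV
  using TV_module by (simp add: uea_mod_def)

lemma tp_zero: "v \<in> carrier V \<Longrightarrow> tp (co 0) v = \<zero>\<^bsub>TV\<^esub>"
  using tp_smult[of 0 "co 0" v] TV.act_zero[OF tp_closed[of "co 0" v]] by (simp add: Q_simps)

lemma act_tp: "v \<in> carrier V \<Longrightarrow> a \<odot>\<^bsub>TV\<^esub> tp (co b) v = tp (co (a * b)) v"
  using tp_smult[of a "co b" v] by (simp add: Q_simps)

lemma tp_killed: assumes v: "v \<in> carrier V" shows "\<exists>n. kills TV n (tp (co u) v)"
proof -
  obtain k where k: "\<And>n a. J (n + k) a \<Longrightarrow> J n (a * u)" using J_absorb[of u] by blast
  have "kills TV (1 + k) (tp (co u) v)"
    unfolding kills_def
  proof (intro allI impI)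
    fix a assume "J (1 + k) a"
    then have "a * u \<in> I" using k I_iff_J by blast
    then have "co (a * u) = co 0" by (simp add: co_eq_iff)
    then show "a \<odot>\<^bsub>TV\<^esub> tp (co u) v = \<zero>\<^bsub>TV\<^esub>" using v by (simp add: act_tp tp_zero)
  qed
  then show ?thesis by blast
qed

lemma TV_locally_whittaker: "locally_whittaker \<chi> \<mm> TV"
proof (rule killed_locally_whittaker[OF TV_module])
  fix t assume "t \<in> carrier TV"
  then show "\<exists>n. kills TV n t"
  proof (induction rule: TV_induct)
    case zero
    show ?case by (simp add: kills_def TV.act_null)
  next
    case (tp q v)
    then show ?case using tp_killed by (auto simp: Q_simps)
  next
    case (diff a b)
    then obtain n m where "kills TV n a" "kills TV m b" by blast
    then have "kills TV (max n m) a" "kills TV (max n m) b" by (auto intro: kills_mono)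
    moreover have "\<zero>\<^bsub>TV\<^esub> \<ominus>\<^bsub>TV\<^esub> \<zero>\<^bsub>TV\<^esub> = \<zero>\<^bsub>TV\<^esub>" by (simp add: a_minus_def)
    ultimately have "kills TV (max n m) (a \<ominus>\<^bsub>TV\<^esub> b)"
      using diff by (simp add: kills_def TV.act_rdiff)
    then show ?case by blast
  qed
qed

abbreviation unit :: "'u \<Rightarrow> 'u" where "unit v \<equiv> tp (co 1) v"

lemma co_Q: "co a \<in> carrier Q" by (simp add: Q_simps)

lemma tp_idealizer: "idealizer y \<Longrightarrow> v \<in> carrier V \<Longrightarrow> tp (co y) v = unit (co y \<odot>\<^bsub>V\<^esub> v)"
  using tp_balanced[of "co 1" "co y" v] H_carrierI[of y] by (simp add: Q_simps)

lemma unit_Wh: "v \<in> carrier V \<Longrightarrow> unit v \<in> carrier (Wh \<chi> \<mm> TV)"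
proof -
  assume v: "v \<in> carrier V"
  have "a \<odot>\<^bsub>TV\<^esub> unit v = \<zero>\<^bsub>TV\<^esub>" if "a \<in> I" for a
  proof -
    have "co a = co 0" using that by (simp add: co_eq_iff)
    then show ?thesis using v by (simp add: act_tp tp_zero)
  qed
  then show ?thesis using v tp_closed[OF co_Q] by (simp add: Wh_iff[OF TV_module])
qed

lemma unit_smult:
  assumes "r \<in> carrier H" "v \<in> carrier V"
  shows "unit (r \<odot>\<^bsub>V\<^esub> v) = r \<odot>\<^bsub>Wh \<chi> \<mm> TV\<^esub> unit v"
proof -
  obtain y where y: "idealizer y" "r = co y" using assms(1) by (elim H_carrierE)
  show ?thesis using assms(2) y by (simp add: Wh_smult[OF TV_module unit_Wh] act_tp tp_idealizer)
qed

lemma unit_hom: "restrict (tp (co 1)) (carrier V) \<in> module_homs H V (Wh \<chi> \<mm> TV)"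
  unfolding module_homs_def
  by (auto simp: unit_Wh Wh_simps tp_add_right co_Q unit_smult V.smult_closed)

lemma unit_zero: "unit \<zero>\<^bsub>V\<^esub> = \<zero>\<^bsub>TV\<^esub>"
  using module_homs_zero[OF V.left_module_axioms Wh_module[OF TV_module] unit_hom] by (simp add: Wh_simps)

lemma unit_diff: assumes "v \<in> carrier V" "w \<in> carrier V" shows "unit (v \<ominus>\<^bsub>V\<^esub> w) = unit v \<ominus>\<^bsub>TV\<^esub> unit w"
proof -
  have "unit v = unit (v \<ominus>\<^bsub>V\<^esub> w) \<oplus>\<^bsub>TV\<^esub> unit w"
    using assms by (simp add: tp_add_right[symmetric] co_Q a_minus_def V.M.a_assoc V.M.l_neg)
  then show ?thesis using assms tp_closed[OF co_Q] by (simp add: a_minus_def TV.M.a_assoc TV.M.r_neg)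
qed

text \<open>For a pure tensor, \<open>\<pi> (q \<otimes> v) = (\<pi> q) \<otimes> v\<close> with \<open>\<pi> q\<close> in \<open>H\<close> as soon as the index of \<open>\<pi>\<close> is large
  enough.  For a sum of tensors take the largest index.\<close>

lemma unit_surj:
  assumes t: "t \<in> carrier (Wh \<chi> \<mm> TV)" shows "\<exists>v\<in>carrier V. t = unit v"
proof -
  have "\<exists>n. \<forall>\<pi>. projector n \<pi> \<longrightarrow> (\<exists>v\<in>carrier V. \<pi> \<odot>\<^bsub>TV\<^esub> t = unit v)" if "t \<in> carrier TV" for t
    using that
  proof (induction rule: TV_induct)
    case zero
    show ?case using unit_zero V.zero_closed by (metis TV.act_null)
  next
    case (tp q v)
    then obtain u where u: "q = co u" by (auto simp: Q_simps)
    obtain k where k: "\<And>n a. J (n + k) a \<Longrightarrow> J n (a * u)" using J_absorb[of u] by blast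
    have "\<exists>v'\<in>carrier V. \<pi> \<odot>\<^bsub>TV\<^esub> tp q v = unit v'" if \<pi>: "projector (1 + k) \<pi>" for \<pi>
    proof -
      have idealizer: "idealizer (\<pi> * u)" unfolding idealizer_def
        using \<pi> k[of 1] by (auto simp: projector_def I_iff_J mult.assoc[symmetric])
      then show ?thesis using tp V.smult_closed[OF H_carrierI[OF idealizer]] by (auto simp: u act_tp tp_idealizer)
    qed
    then show ?case by blast
  next
    case (diff a b)
    then obtain n m where nm: "\<And>\<pi>. projector n \<pi> \<Longrightarrow> \<exists>v\<in>carrier V. \<pi> \<odot>\<^bsub>TV\<^esub> a = unit v"
      "\<And>\<pi>. projector m \<pi> \<Longrightarrow> \<exists>v\<in>carrier V. \<pi> \<odot>\<^bsub>TV\<^esub> b = unit v" by blast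
    have "\<exists>v\<in>carrier V. \<pi> \<odot>\<^bsub>TV\<^esub> (a \<ominus>\<^bsub>TV\<^esub> b) = unit v" if \<pi>: "projector (max n m) \<pi>" for \<pi>
    proof -
      obtain v w where "v \<in> carrier V" "\<pi> \<odot>\<^bsub>TV\<^esub> a = unit v" "w \<in> carrier V" "\<pi> \<odot>\<^bsub>TV\<^esub> b = unit w"
        using nm projector_antimono[OF \<pi>] by (meson max.cobounded1 max.cobounded2)
      then show ?thesis using diff by (intro bexI[of _ "v \<ominus>\<^bsub>V\<^esub> w"]) (simp_all add: TV.act_rdiff unit_diff)
    qed
    then show ?case by blast
  qed
  moreover have "t \<in> carrier TV" using t Wh_iff[OF TV_module] by simp
  ultimately obtain n where n: "\<And>\<pi>. projector n \<pi> \<Longrightarrow> \<exists>v\<in>carrier V. \<pi> \<odot>\<^bsub>TV\<^esub> t = unit v" by blast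
  obtain \<pi> where \<pi>: "projector n \<pi>" using ex_projector by blast
  show ?thesis using n[OF \<pi>] projector_id[OF TV_module t \<pi>] by simp
qed

text \<open>A left inverse of \<open>v \<mapsto> 1 \<otimes> v\<close> would be \<open>q \<otimes> v \<mapsto> (\<pi> q) v\<close>, but no single \<open>\<pi>\<close> maps all of \<open>Q\<close> into \<open>H\<close>.
  So one works with a sequence of projectors \<open>\<pi>\<^sub>k\<close>, each element \<open>q\<close> being mapped into \<open>H\<close> by almost all
  of them.\<close>

lemma unit_inj: assumes vw: "v \<in> carrier V" "w \<in> carrier V" and eq: "unit v = unit w" shows "v = w"
proof -
  define \<pi> where "\<pi> k = (SOME \<pi>. projector k \<pi>)" for k
  have \<pi>: "projector k (\<pi> k)" for k unfolding \<pi>_def using ex_projector by (rule someI_ex)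
  define c where "c k q = \<pi> k \<odot>\<^bsub>Q\<^esub> q" for k q
  have c_co: "c k (co u) = co (\<pi> k * u)" for k u by (simp add: c_def Q_simps)
  have c1: "c k (co 1) = \<one>\<^bsub>H\<^esub>" for k
    using \<pi>[of k] by (simp add: c_co H_simps co_eq_iff projector_def)
  have cH: "\<exists>n. \<forall>k\<ge>n. c k q \<in> carrier H" if q: "q \<in> carrier Q" for q
  proof -
    obtain u where u: "q = co u" using q by (auto simp: Q_simps)
    obtain m where m: "\<And>n a. J (n + m) a \<Longrightarrow> J n (a * u)" using J_absorb[of u] by blast
    have "idealizer (\<pi> k * u)" if "1 + m \<le> k" for k unfolding idealizer_def
      using projector_antimono[OF \<pi> that] m[of 1] by (auto simp: projector_def I_iff_J mult.assoc[symmetric])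
    then show ?thesis using H_carrierI by (metis u c_co)
  qed
  \<comment> \<open>For fixed \<open>q\<close> only finitely many \<open>k\<close> fall into the second case.\<close>
  define \<beta> where "\<beta> k q v = (if c k q \<in> carrier H then c k q \<odot>\<^bsub>V\<^esub> v else \<zero>\<^bsub>V\<^esub>)" for k q v
  have ab: "abelian_group V" ..
  have \<beta>cl: "\<beta> k q v \<in> carrier V" if "q \<in> carrier Q" "v \<in> carrier V" for k q v
    using that by (simp add: \<beta>_def V.smult_closed)
  have "\<forall>k. \<exists>h. h \<in> hom (tensor_gens Q V) (add_monoid V) \<and>
     (\<forall>q\<in>carrier Q. \<forall>v\<in>carrier V. h (frag_of (q, v)) = \<beta> k q v)"
    using ex_free_hom[of V "\<beta> k" for k, OF ab \<beta>cl] by blast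
  from choice[OF this] obtain h where h: "\<And>k. h k \<in> hom (tensor_gens Q V) (add_monoid V)"
    and h\<beta>: "\<And>k q v. q \<in> carrier Q \<Longrightarrow> v \<in> carrier V \<Longrightarrow> h k (frag_of (q, v)) = \<beta> k q v" by blast
  note hdiff = free_hom_diff[OF ab h]
  have "\<exists>n. \<forall>k\<ge>n. h k r = \<zero>\<^bsub>V\<^esub>" if "r \<in> tensor_relations H Q V" for r
    using that
  proof cases
    case (1 p q v)
    obtain n m where nm: "\<And>k. n \<le> k \<Longrightarrow> c k p \<in> carrier H" "\<And>k. m \<le> k \<Longrightarrow> c k q \<in> carrier H"
      using cH 1 by meson
    have "h k r = \<zero>\<^bsub>V\<^esub>" if "max n m \<le> k" for k
    proof -
      have cc: "c k p \<in> carrier H" "c k q \<in> carrier H" using nm that by auto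
      have "c k (p \<oplus>\<^bsub>Q\<^esub> q) = c k p \<oplus>\<^bsub>H\<^esub> c k q"
        using 1 by (auto simp: Q_simps c_co H_simps distrib_left)
      then have "\<beta> k (p \<oplus>\<^bsub>Q\<^esub> q) v = \<beta> k p v \<oplus>\<^bsub>V\<^esub> \<beta> k q v"
        using cc 1 V.smult_l_distr by (simp add: \<beta>_def)
      then show ?thesis using 1 \<beta>cl V.add_diff_self
        by (simp add: hdiff supported_diff supported_of Q_add h\<beta>)
    qed
    then show ?thesis by blast
  next
    case (2 q v w)
    have "h k r = \<zero>\<^bsub>V\<^esub>" for k
    proof -
      have "\<beta> k q (v \<oplus>\<^bsub>V\<^esub> w) = \<beta> k q v \<oplus>\<^bsub>V\<^esub> \<beta> k q w"
        using 2 V.smult_r_distr by (simp add: \<beta>_def)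
      then show ?thesis using 2 \<beta>cl V.add_diff_self
        by (simp add: hdiff supported_diff supported_of h\<beta>)
    qed
    then show ?thesis by blast
  next
    case (3 q s v)
    obtain n where n: "\<And>k. n \<le> k \<Longrightarrow> c k q \<in> carrier H" using cH 3 by meson
    have "h k r = \<zero>\<^bsub>V\<^esub>" if "n \<le> k" for k
    proof -
      obtain y where y: "idealizer y" "s = co y" using 3 by (elim H_carrierE)
      obtain u where u: "q = co u" using 3 by (auto simp: Q_simps)
      have ck: "c k (rsmult Q q s) = c k q \<otimes>\<^bsub>H\<^esub> s"
        using y by (simp add: u Q_simps c_co H_simps mult.assoc)
      have "c k (rsmult Q q s) \<in> carrier H" unfolding ck
        by (rule V.R.m_closed[OF n[OF that] 3(3)])
      then have "\<beta> k (rsmult Q q s) v = \<beta> k q (s \<odot>\<^bsub>V\<^esub> v)"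
        using n[OF that] 3 by (simp add: \<beta>_def ck V.smult_assoc1)
      then show ?thesis using 3 \<beta>cl
        by (simp add: hdiff supported_diff supported_of Q_rsmult h\<beta> V.smult_closed a_minus_def V.M.r_neg)
    qed
    then show ?thesis by blast
  qed
  from kernel_eventually[OF ab h this tp_eqD[OF co_Q vw(1) co_Q vw(2) eq]]
  obtain k where "h k (frag_of (co 1, v) - frag_of (co 1, w)) = \<zero>\<^bsub>V\<^esub>" by blast
  moreover have "h k (frag_of (co 1, x)) = x" if "x \<in> carrier V" for x
    using that V.R.one_closed by (simp add: h\<beta> co_Q \<beta>_def c1 V.smult_one)
  ultimately have "v \<ominus>\<^bsub>V\<^esub> w = \<zero>\<^bsub>V\<^esub>" using vw by (simp add: hdiff supported_of co_Q)
  then show ?thesis using V.eq_if_diff_zero vw by blast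
qed

lemma unit_bij: "bij_betw (restrict (tp (co 1)) (carrier V)) (carrier V) (carrier (Wh \<chi> \<mm> TV))"
  unfolding bij_betw_def
proof
  show "inj_on (restrict (tp (co 1)) (carrier V)) (carrier V)" using unit_inj by (auto simp: inj_on_def)
  show "restrict (tp (co 1)) (carrier V) ` carrier V = carrier (Wh \<chi> \<mm> TV)"
    using unit_Wh unit_surj by (fastforce simp: image_iff)
qed

end

context whittaker_pair
begin

lemma whittaker_inducedI:
  fixes V :: "('g uea set, 'u) module"
  shows "relabelled_pair uea_ring H V Q \<Longrightarrow> whittaker_induced Basis \<chi> G M D V"
  by (simp add: whittaker_induced_def whittaker_pair_axioms)

text \<open>The multiplication map \<open>u \<otimes> w \<mapsto> u w\<close> is onto because Whittaker vectors generate \<open>E\<close>.  By Engel's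
  theorem a nonzero kernel would contain a nonzero Whittaker vector \<open>1 \<otimes> w\<close>, but this is mapped to \<open>w\<close>.\<close>

lemma ex_counit:
  fixes E :: "('g uea, 'u) module"
  assumes E: "left_module uea_ring E" and lw: "locally_whittaker \<chi> \<mm> E"
    and P: "relabelled_pair uea_ring H (Wh \<chi> \<mm> E) Q"
  defines "TW \<equiv> relabelled_pair.TV H (Wh \<chi> \<mm> E) Q"
  shows "\<exists>\<epsilon>. \<epsilon> \<in> module_homs uea_ring TW E \<and> bij_betw \<epsilon> (carrier TW) (carrier E) \<and>
     (\<forall>u. \<forall>w\<in>carrier (Wh \<chi> \<mm> E). \<epsilon> (relabelled_pair.tp H (Wh \<chi> \<mm> E) Q (co u) w) = u \<odot>\<^bsub>E\<^esub> w)"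
proof -
  interpret E: uea_mod E using E by (simp add: uea_mod_def)
  interpret whittaker_induced Basis \<chi> G M D "Wh \<chi> \<mm> E" by (rule whittaker_inducedI[OF P])
  let ?W = "carrier (Wh \<chi> \<mm> E)"
  have WE: "w \<in> carrier E" if "w \<in> ?W" for w using that Wh_iff[OF E] by simp
  define \<beta> where "\<beta> q w = (SOME u. u \<in> q) \<odot>\<^bsub>E\<^esub> w" for q w
  have \<beta>: "\<beta> (co u) w = u \<odot>\<^bsub>E\<^esub> w" if "w \<in> ?W" for u w
    unfolding \<beta>_def by (rule Wh_some[OF E that])
  have "\<exists>g. (\<forall>t\<in>carrier TV. g t \<in> carrier E) \<and>
     (\<forall>s\<in>carrier TV. \<forall>t\<in>carrier TV. g (s \<oplus>\<^bsub>TV\<^esub> t) = g s \<oplus>\<^bsub>E\<^esub> g t) \<and>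
     (\<forall>q\<in>carrier Q. \<forall>v\<in>?W. g (tp q v) = \<beta> q v)"
  proof (rule TV_universal)
    show "abelian_group E" ..
    show "\<beta> q v \<in> carrier E" if "q \<in> carrier Q" "v \<in> ?W" for q v
      using that by (auto simp: Q_simps \<beta> E.act_closed WE)
    show "\<beta> (p \<oplus>\<^bsub>Q\<^esub> q) v = \<beta> p v \<oplus>\<^bsub>E\<^esub> \<beta> q v" if "p \<in> carrier Q" "q \<in> carrier Q" "v \<in> ?W" for p q v
      using that by (auto simp: Q_simps \<beta> E.act_add WE)
    show "\<beta> q (v \<oplus>\<^bsub>Wh \<chi> \<mm> E\<^esub> w) = \<beta> q v \<oplus>\<^bsub>E\<^esub> \<beta> q w" if q: "q \<in> carrier Q" and vw: "v \<in> ?W" "w \<in> ?W" for q v w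
    proof -
      have "v \<oplus>\<^bsub>E\<^esub> w \<in> ?W" using V.a_closed[OF vw] by (simp add: Wh_simps)
      then show ?thesis using q vw by (auto simp: Q_simps \<beta> E.act_distr WE Wh_simps)
    qed
    show "\<beta> (rsmult Q q r) v = \<beta> q (r \<odot>\<^bsub>Wh \<chi> \<mm> E\<^esub> v)" if q: "q \<in> carrier Q" and r: "r \<in> carrier H" and v: "v \<in> ?W" for q r v
    proof -
      obtain u y where uy: "q = co u" "idealizer y" "r = co y" using q r by (auto simp: Q_simps elim!: H_carrierE)
      have "r \<odot>\<^bsub>Wh \<chi> \<mm> E\<^esub> v \<in> ?W" using V.smult_closed[OF r v] .
      then show ?thesis using v by (simp add: uy Q_simps \<beta> Wh_smult[OF E v] E.act_mult WE)
    qed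
  qed
  then obtain g where g: "\<And>t. t \<in> carrier TV \<Longrightarrow> g t \<in> carrier E"
    and gadd: "\<And>s t. s \<in> carrier TV \<Longrightarrow> t \<in> carrier TV \<Longrightarrow> g (s \<oplus>\<^bsub>TV\<^esub> t) = g s \<oplus>\<^bsub>E\<^esub> g t"
    and gtp: "\<And>u v. v \<in> ?W \<Longrightarrow> g (tp (co u) v) = u \<odot>\<^bsub>E\<^esub> v"
    using \<beta> co_Q by metis
  have g0: "g \<zero>\<^bsub>TV\<^esub> = \<zero>\<^bsub>E\<^esub>"
    using gadd[of "\<zero>\<^bsub>TV\<^esub>" "\<zero>\<^bsub>TV\<^esub>"] g[of "\<zero>\<^bsub>TV\<^esub>"] by simp
  have gdiff: "g (s \<ominus>\<^bsub>TV\<^esub> t) = g s \<ominus>\<^bsub>E\<^esub> g t" if st: "s \<in> carrier TV" "t \<in> carrier TV" for s t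
  proof -
    have "g s = g ((s \<ominus>\<^bsub>TV\<^esub> t) \<oplus>\<^bsub>TV\<^esub> t)" using st by (simp add: a_minus_def TV.M.a_assoc TV.M.l_neg)
    also have "\<dots> = g (s \<ominus>\<^bsub>TV\<^esub> t) \<oplus>\<^bsub>E\<^esub> g t" using st by (intro gadd) auto
    finally show ?thesis using st g[of "s \<ominus>\<^bsub>TV\<^esub> t"] g[of t] by (simp add: a_minus_def E.M.a_assoc E.M.r_neg)
  qed
  have gact: "g (a \<odot>\<^bsub>TV\<^esub> t) = a \<odot>\<^bsub>E\<^esub> g t" if "t \<in> carrier TV" for a t
    using that
  proof (induction rule: TV_induct)
    case zero
    show ?case by (simp add: TV.act_null g0 E.act_null)
  next
    case (tp q v)
    then show ?case by (auto simp: Q_simps act_tp gtp E.act_mult WE)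
  next
    case (diff s t)
    then show ?case using g by (simp add: TV.act_rdiff gdiff TV.act_closed E.act_rdiff)
  qed
  have ghom: "restrict g (carrier TV) \<in> module_homs uea_ring TV E"
    unfolding module_homs_def by (auto simp: g gadd gact TV.act_closed)
  have sub_im: "E.submod (g ` carrier TV)"
  proof (rule E.submodI)
    show "\<zero>\<^bsub>E\<^esub> \<in> g ` carrier TV" unfolding g0[symmetric] by (rule imageI) simp
    show "a \<odot>\<^bsub>E\<^esub> x \<in> g ` carrier TV" if "x \<in> g ` carrier TV" for a x
      using that by (auto simp: gact[symmetric] intro!: imageI TV.act_closed)
    show "x \<oplus>\<^bsub>E\<^esub> y \<in> g ` carrier TV" if "x \<in> g ` carrier TV" "y \<in> g ` carrier TV" for x y
      using that by (auto simp: gadd[symmetric] intro!: imageI TV.a_closed)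
  qed (use g in auto)
  have "?W \<subseteq> g ` carrier TV"
  proof
    fix w assume w: "w \<in> ?W"
    then have "g (unit w) = w" by (simp add: gtp E.act_one WE)
    with imageI[OF tp_closed[OF co_Q[of 1] w], of g] show "w \<in> g ` carrier TV" by simp
  qed
  with sub_im have surj: "g ` carrier TV = carrier E" by (rule Wh_generates[OF E lw])
  define Ke where "Ke = {t \<in> carrier TV. g t = \<zero>\<^bsub>E\<^esub>}"
  have sub_K: "TV.submod Ke"
    by (rule TV.submodI) (auto simp: Ke_def g0 gadd gact TV.act_closed E.act_null)
  have sub_0: "TV.submod {\<zero>\<^bsub>TV\<^esub>}" by (rule TV.submodI) (auto simp: TV.act_null)
  have K0: "Ke = {\<zero>\<^bsub>TV\<^esub>}"
  proof (rule ccontr)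
    assume "Ke \<noteq> {\<zero>\<^bsub>TV\<^esub>}"
    then have "{\<zero>\<^bsub>TV\<^esub>} \<subset> Ke" using TV.submodD(2)[OF sub_K] by blast
    from whittaker_engel[OF TV_module TV_locally_whittaker sub_K sub_0 this]
    obtain t where t: "t \<in> Ke" "t \<noteq> \<zero>\<^bsub>TV\<^esub>" "\<And>x. x \<in> \<mm> \<Longrightarrow> \<rho> x \<odot>\<^bsub>TV\<^esub> t = \<zero>\<^bsub>TV\<^esub>" by blast
    then have "t \<in> carrier (Wh \<chi> \<mm> TV)" by (simp add: Wh_rho[OF TV_module] Ke_def)
    then obtain w where w: "w \<in> ?W" "t = unit w" using unit_surj by blast
    then have "w = \<zero>\<^bsub>E\<^esub>" using t(1) by (simp add: Ke_def gtp E.act_one WE)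
    then show False using t(2) w unit_zero by (simp add: Wh_simps)
  qed
  have "inj_on g (carrier TV)"
  proof (rule inj_onI)
    fix s t assume st: "s \<in> carrier TV" "t \<in> carrier TV" "g s = g t"
    then have "g (s \<ominus>\<^bsub>TV\<^esub> t) = g t \<ominus>\<^bsub>E\<^esub> g t" by (simp add: gdiff)
    also have "\<dots> = \<zero>\<^bsub>E\<^esub>" using g[OF st(2)] by (simp add: a_minus_def E.M.r_neg)
    finally have "g (s \<ominus>\<^bsub>TV\<^esub> t) = \<zero>\<^bsub>E\<^esub>" .
    then have "s \<ominus>\<^bsub>TV\<^esub> t \<in> Ke" using st by (simp add: Ke_def)
    then show "s = t" using K0 st TV.eq_if_diff_zero by simp
  qed
  then have "bij_betw (restrict g (carrier TV)) (carrier TV) (carrier E)"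
    using surj by (auto simp: bij_betw_def inj_on_def)
  then show ?thesis unfolding TW_def using ghom gtp tp_closed[OF co_Q]
    by (intro exI[of _ "restrict g (carrier TV)"]) simp
qed

section \<open>Skryabin's equivalence\<close>

theorem skryabin:
  fixes \<iota> :: "complex \<Rightarrow> 'u"
  assumes \<iota>: "inj \<iota>"
  shows "inverse_equivalences (fg_module_category H :: (('g uea set, 'u) module, 'u \<Rightarrow> 'u) cat) (whit_category \<chi> \<mm>)
     (tensor_functor H Q) (Wh_functor \<chi> \<mm>)"
proof -
  let ?HM = "fg_module_category H :: (('g uea set, 'u) module, 'u \<Rightarrow> 'u) cat"
  let ?C = "whit_category \<chi> \<mm> :: (('g uea, 'u) module, 'u \<Rightarrow> 'u) cat"
  let ?T = "tensor_functor H Q :: (('g uea set, 'u) module, 'u \<Rightarrow> 'u, ('g uea, 'u) module, 'u \<Rightarrow> 'u) cat_functor"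
  let ?Wh = "Wh_functor \<chi> \<mm> :: (('g uea, 'u) module, 'u \<Rightarrow> 'u, ('g uea set, 'u) module, 'u \<Rightarrow> 'u) cat_functor"
  have pair: "relabelled_pair uea_ring H V Q" if "left_module H V" "finitely_generated H V" for V :: "('g uea set, 'u) module"
    by (rule fg_relabelled_pair(1)[OF \<iota> that])
  have T: "is_functor ?HM ?C ?T"
    unfolding fg_module_category_def whit_category_def
  proof (rule tensor_functor_is_functor[OF pair])
    fix V :: "('g uea set, 'u) module" assume V: "left_module H V" "finitely_generated H V"
    interpret whittaker_induced Basis \<chi> G M D V by (rule whittaker_inducedI[OF pair[OF V]])
    show "finitely_generated uea_ring (omap ?T V) \<and> locally_whittaker \<chi> \<mm> (omap ?T V)"
      unfolding tensor_functor_omap using fg_relabelled_pair(2)[OF \<iota> V] TV_locally_whittaker by simp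
  qed
  note W = Wh_is_functor
  let ?u = "\<lambda>V. restrict (relabelled_pair.tp H V Q (co 1)) (carrier V)"
  define \<eta> where "\<eta> V = (\<lambda>x\<in>carrier (Wh \<chi> \<mm> (relabelled_pair.TV H V Q)). inv_into (carrier V) (?u V) x)"
    for V :: "('g uea set, 'u) module"
  have \<eta>: "omap (functor_comp ?Wh ?T) V = Wh \<chi> \<mm> (relabelled_pair.TV H V Q)"
    "\<eta> V \<in> module_homs H (Wh \<chi> \<mm> (relabelled_pair.TV H V Q)) V"
    "bij_betw (\<eta> V) (carrier (Wh \<chi> \<mm> (relabelled_pair.TV H V Q))) (carrier V)"
    "\<And>v. v \<in> carrier V \<Longrightarrow> \<eta> V (relabelled_pair.tp H V Q (co 1) v) = v"
    if V: "left_module H V" "finitely_generated H V" for V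
  proof -
    interpret whittaker_induced Basis \<chi> G M D V by (rule whittaker_inducedI[OF pair[OF V]])
    note inv = module_homs_inverse[OF unit_hom unit_bij V(1) Wh_module[OF TV_module], folded \<eta>_def]
    show "\<eta> V \<in> module_homs H (Wh \<chi> \<mm> TV) V" "bij_betw (\<eta> V) (carrier (Wh \<chi> \<mm> TV)) (carrier V)"
      by (fact inv)+
    show "\<eta> V (unit v) = v" if "v \<in> carrier V" for v using inv(3)[OF that] that by simp
    show "omap (functor_comp ?Wh ?T) V = Wh \<chi> \<mm> TV"
      by (simp add: functor_comp_def Wh_functor_def tensor_functor_omap)
  qed
  have "naturally_isomorphic ?HM ?HM (functor_comp ?Wh ?T) identity_functor"
    unfolding fg_module_category_def
  proof (rule module_cat_identity_naturally_isomorphic[where \<eta> = \<eta>])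
    show "is_functor (module_cat H (finitely_generated H)) (module_cat H (finitely_generated H)) (functor_comp ?Wh ?T)"
      using is_functor_comp[OF W T] by (simp add: fg_module_category_def)
    fix X Y :: "('g uea set, 'u) module" and f x
    assume X: "left_module H X" "finitely_generated H X" and Y: "left_module H Y" "finitely_generated H Y"
      and f: "f \<in> module_homs H X Y" and x: "x \<in> carrier (omap (functor_comp ?Wh ?T) X)"
    interpret X: relabelled_pair uea_ring H X Q by (rule pair[OF X])
    interpret Y: relabelled_pair uea_ring H Y Q by (rule pair[OF Y])
    have xW: "x \<in> carrier (Wh \<chi> \<mm> X.TV)" using x \<eta>(1)[OF X] by simp
    obtain v where v: "v \<in> carrier X" "x = X.tp (co 1) v"
      using whittaker_induced.unit_surj[OF whittaker_inducedI[OF pair[OF X]] xW] by blast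
    have "amap ?T X Y f x = Y.tp (co 1) (f v)"
      unfolding v(2) by (rule X.tensor_functor_amap(2)[OF Y.relabelled_pair_axioms f _ v(1)]) (simp add: Q_simps)
    moreover have "amap (functor_comp ?Wh ?T) X Y f x = amap ?T X Y f x"
      using xW by (simp add: functor_comp_def Wh_functor_def X.tensor_functor_omap)
    ultimately show "f (\<eta> X x) = \<eta> Y (amap (functor_comp ?Wh ?T) X Y f x)"
      using v \<eta>(4)[OF X] \<eta>(4)[OF Y] module_homsD(1)[OF f v(1)] by simp
  qed (simp_all add: \<eta>)
  moreover
  define counit where "counit E \<epsilon> \<longleftrightarrow> \<epsilon> \<in> module_homs uea_ring (relabelled_pair.TV H (Wh \<chi> \<mm> E) Q) E \<and>
     bij_betw \<epsilon> (carrier (relabelled_pair.TV H (Wh \<chi> \<mm> E) Q)) (carrier E) \<and>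
     (\<forall>u. \<forall>w\<in>carrier (Wh \<chi> \<mm> E). \<epsilon> (relabelled_pair.tp H (Wh \<chi> \<mm> E) Q (co u) w) = u \<odot>\<^bsub>E\<^esub> w)"
    for E :: "('g uea, 'u) module" and \<epsilon> :: "'u \<Rightarrow> 'u"
  define \<epsilon> where "\<epsilon> E = (SOME \<epsilon>. counit E \<epsilon>)" for E
  have \<epsilon>: "relabelled_pair uea_ring H (Wh \<chi> \<mm> E) Q" "counit E (\<epsilon> E)"
    "omap (functor_comp ?T ?Wh) E = relabelled_pair.TV H (Wh \<chi> \<mm> E) Q"
    if E: "left_module uea_ring E" "finitely_generated uea_ring E \<and> locally_whittaker \<chi> \<mm> E" for E
  proof -
    have lw: "locally_whittaker \<chi> \<mm> E" and fg: "finitely_generated uea_ring E" using E(2) by auto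
    show P: "relabelled_pair uea_ring H (Wh \<chi> \<mm> E) Q"
      by (rule pair[OF Wh_module[OF E(1)] Wh_finitely_generated[OF E(1) lw fg]])
    have "\<exists>\<epsilon>. counit E \<epsilon>" unfolding counit_def by (rule ex_counit[OF E(1) lw P])
    then show "counit E (\<epsilon> E)" unfolding \<epsilon>_def by (rule someI_ex)
    show "omap (functor_comp ?T ?Wh) E = relabelled_pair.TV H (Wh \<chi> \<mm> E) Q"
      by (simp add: functor_comp_def Wh_functor_def relabelled_pair.tensor_functor_omap[OF P])
  qed
  have "naturally_isomorphic ?C ?C (functor_comp ?T ?Wh) identity_functor"
    unfolding whit_category_def
  proof (rule module_cat_identity_naturally_isomorphic[where \<eta> = \<epsilon>])
    show "is_functor (module_cat uea_ring (\<lambda>E. finitely_generated uea_ring E \<and> locally_whittaker \<chi> \<mm> E))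
        (module_cat uea_ring (\<lambda>E. finitely_generated uea_ring E \<and> locally_whittaker \<chi> \<mm> E)) (functor_comp ?T ?Wh)"
      using is_functor_comp[OF T W] by (simp add: whit_category_def)
    fix E F :: "('g uea, 'u) module" and f x
    assume E: "left_module uea_ring E" "finitely_generated uea_ring E \<and> locally_whittaker \<chi> \<mm> E"
      and F: "left_module uea_ring F" "finitely_generated uea_ring F \<and> locally_whittaker \<chi> \<mm> F"
      and f: "f \<in> module_homs uea_ring E F" and x: "x \<in> carrier (omap (functor_comp ?T ?Wh) E)"
    note cE = \<epsilon>(2)[OF E, unfolded counit_def] and cF = \<epsilon>(2)[OF F, unfolded counit_def]
    note Wf = Wh_hom[OF E(1) F(1) f]
    interpret X: relabelled_pair uea_ring H "Wh \<chi> \<mm> E" Q by (rule \<epsilon>(1)[OF E])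
    interpret Y: relabelled_pair uea_ring H "Wh \<chi> \<mm> F" Q by (rule \<epsilon>(1)[OF F])
    let ?Tf = "amap ?T (Wh \<chi> \<mm> E) (Wh \<chi> \<mm> F) (restrict f (carrier (Wh \<chi> \<mm> E)))"
    note Tf = X.tensor_functor_amap[OF Y.relabelled_pair_axioms Wf]
    have "compose (carrier X.TV) f (\<epsilon> E) = compose (carrier X.TV) (\<epsilon> F) ?Tf"
    proof (rule X.TV_hom_ext[OF F(1)])
      show "compose (carrier X.TV) f (\<epsilon> E) \<in> module_homs uea_ring X.TV F"
        using cE by (intro module_homs_compose[OF _ f X.TV_module]) simp
      show "compose (carrier X.TV) (\<epsilon> F) ?Tf \<in> module_homs uea_ring X.TV F"
        using cF by (intro module_homs_compose[OF Tf(1) _ X.TV_module]) simp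
      fix q w assume q: "q \<in> carrier Q" and w: "w \<in> carrier (Wh \<chi> \<mm> E)"
      obtain u where u: "q = co u" using q by (auto simp: Q_simps)
      have wE: "w \<in> carrier E" using w Wh_iff[OF E(1)] by simp
      have fw: "f w \<in> carrier (Wh \<chi> \<mm> F)" using module_homsD(1)[OF Wf w] w by simp
      have "f (\<epsilon> E (X.tp q w)) = u \<odot>\<^bsub>F\<^esub> f w" using cE w wE module_homsD(4)[OF f] by (simp add: u)
      also have "\<dots> = \<epsilon> F (Y.tp q (f w))" using cF fw by (simp add: u)
      also have "Y.tp q (f w) = ?Tf (X.tp q w)" using Tf(2)[OF q w] w by simp
      finally show "compose (carrier X.TV) f (\<epsilon> E) (X.tp q w) = compose (carrier X.TV) (\<epsilon> F) ?Tf (X.tp q w)"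
        using X.tp_closed[OF q w] by (simp add: compose_eq)
    qed
    from fun_cong[OF this, of x] show "f (\<epsilon> E x) = \<epsilon> F (amap (functor_comp ?T ?Wh) E F f x)"
      using x \<epsilon>(3)[OF E] by (simp add: compose_eq functor_comp_def Wh_functor_def)
  qed (use \<epsilon>(2,3) in \<open>simp_all add: counit_def\<close>)
  ultimately show ?thesis unfolding inverse_equivalences_def using T W by blast
qed

end

theorem theorem6p1:
  fixes e h f :: "'g::complex_lie_algebra"
    and l \<mm> :: "'g set"
    and \<chi> :: "'g \<Rightarrow> complex"
    and H :: "'g uea set ring"
    and Q :: "('g uea, 'g uea set, 'g uea set) bimodule"
    and HMod :: "(('g uea set, 'u) module, 'u \<Rightarrow> 'u) cat"
    and \<C> :: "(('g uea, 'u) module, 'u \<Rightarrow> 'u) cat"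
  assumes "\<exists>\<iota> :: complex \<Rightarrow> 'u. inj \<iota>"
    and "semisimple_lie_algebra TYPE('g)"
    and "e \<noteq> 0" and "ad_nilpotent e"
    and "sl2_triple e h f"
    and "\<chi> = nilpotent_char e f"
    and "lagrangian \<chi> h l"
    and "\<mm> = whittaker_subalgebra h l"
    and "H = whit_algebra \<chi> \<mm>"
    and "Q = whit_bimodule \<chi> \<mm>"
    and "HMod = fg_module_category H"
    and "\<C> = whit_category \<chi> \<mm>"
  shows "equivalence_of_categories HMod \<C> (tensor_functor H Q)
    \<and> inverse_equivalences HMod \<C> (tensor_functor H Q) (Wh_functor \<chi> \<mm>)
    \<and> exact_functor \<C> HMod (Wh_functor \<chi> \<mm>)"
proof -
  obtain \<iota> :: "complex \<Rightarrow> 'u" where \<iota>: "inj \<iota>" using assms(1) by blast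
  obtain B :: "'g set" where "finite B" "cvs.span B = UNIV"
    using assms(2) by (auto simp: semisimple_lie_algebra_def)
  then obtain Basis :: "'g set" where B: "finite Basis" "cvs.independent Basis" "cvs.span Basis = UNIV"
    by (metis cvs.maximal_independent_subset cvs.span_superset cvs.span_span cvs.span_mono finite_subset subset_antisym top_greatest)
  interpret sl2_lie Basis e h f
    by unfold_locales (use B assms in auto)
  obtain D :: nat where D: "\<And>k. k < - int D \<Longrightarrow> grading h k = {0}" using grading_bounded by blast
  define M where "M d = (if d = 0 then {0} else if d = 1 then l else grading h (- int d))" for d :: nat
  have lag: "cvs.subspace l" "l \<subseteq> grading h (- 1)" "l = {x \<in> grading h (- 1). \<forall>y\<in>l. \<chi> (bracket x y) = 0}"
    using assms(7) by (auto simp: lagrangian_def)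
  have MG: "M d \<subseteq> grading h (- int d)" for d
    using lag(2) cvs.subspace_0[OF grading_subspace, of 0] by (auto simp: M_def)
  \<comment> \<open>The bound is at least \<open>1\<close> because \<open>M 1 = l\<close> need not vanish when \<open>D = 0\<close>.\<close>
  interpret W: whittaker_pair Basis \<chi> "grading h" M "max 1 D"
  proof unfold_locales
    show "\<chi> (x + y) = \<chi> x + \<chi> y" "\<chi> (c *\<^sub>C x) = c * \<chi> x" for x y c
      unfolding assms(6) by (rule nilpotent_char_linear)+
    show "cvs.span (\<Union>k. grading h k) = UNIV"
    proof -
      have "v \<in> cvs.span (\<Union>k. grading h k)" for v
      proof -
        obtain K w where "finite K" "\<And>k. w k \<in> grading h k" "v = (\<Sum>k\<in>K. w k)" using grading_decomp by metis
        then show ?thesis by (simp only:) (intro cvs.span_sum cvs.span_base, blast)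
      qed
      then show ?thesis by blast
    qed
    show "cvs.subspace (M d)" for d
      using lag(1) grading_subspace by (auto simp: M_def)
    show "M d \<subseteq> grading h (- int d)" for d by (rule MG)
    show "M d = grading h (- int d)" if "2 \<le> d" for d using that by (simp add: M_def)
    show "\<chi> (bracket x y) = 0" if "x \<in> M 1" "y \<in> M 1" for x y
      using that lag(3) by (auto simp: M_def)
    show "\<chi> x = 0" if "x \<in> grading h k" "k \<noteq> - 2" for x k
      unfolding assms(6) by (rule nilpotent_char_grading[OF that])
    show "\<exists>u\<in>grading h (int d - 2). \<chi> (bracket x u) \<noteq> 0" if "1 \<le> d" "x \<in> M d" "x \<noteq> 0" for d x
      unfolding assms(6) using char_pairing_nondegenerate[OF assms(2,3) _ that(3,1)] MG that(2) by blast
    show "M d = {0}" if "max 1 D < d" for d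
      using that D[of "- int d"] by (simp add: M_def)
    show "bracket x y \<in> grading h (i + j)" if "x \<in> grading h i" "y \<in> grading h j" for x y i j
      by (rule grading_bracket[OF that])
  qed (rule grading_subspace)
  have "\<mm> = W.\<mm>"
  proof -
    have "l \<union> (\<Union>i\<in>{..- 2}. grading h i) = (\<Union>d\<in>{1..}. M d)"
    proof (intro equalityI subsetI)
      fix x assume "x \<in> l \<union> (\<Union>i\<in>{..- 2}. grading h i)"
      then consider "x \<in> l" | i :: int where "i \<le> - 2" "x \<in> grading h i" by auto
      then show "x \<in> (\<Union>d\<in>{1..}. M d)"
      proof cases
        case 1
        then have "x \<in> M 1" by (simp add: M_def)
        then show ?thesis by blast
      next
        case 2
        then have "x \<in> M (nat (- i))" "nat (- i) \<in> {1..}" by (auto simp: M_def)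
        then show ?thesis by blast
      qed
    next
      fix x assume "x \<in> (\<Union>d\<in>{1..}. M d)"
      then obtain d where d: "1 \<le> d" "x \<in> M d" by auto
      then show "x \<in> l \<union> (\<Union>i\<in>{..- 2}. grading h i)"
      proof (cases "d = 1")
        case False
        then have "x \<in> grading h (- int d)" "- int d \<in> {..- 2}" using d by (auto simp: M_def)
        then show ?thesis by blast
      qed (simp add: M_def)
    qed
    then show ?thesis unfolding assms(8) whittaker_subalgebra_def W.\<mm>_def by simp
  qed
  then have "inverse_equivalences HMod \<C> (tensor_functor H Q) (Wh_functor \<chi> \<mm>)"
    "exact_functor \<C> HMod (Wh_functor \<chi> \<mm>)"
    unfolding assms(9-12) using W.skryabin[OF \<iota>] W.Wh_exact by simp_all
  then show ?thesis unfolding equivalence_of_categories_def by blast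
qed

end
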